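(* Let $\Lambda$ be a quasi-lacunary and subgeometric sequence. Let $\alpha>0$, $0<\beta<1$, and let $\mu$ be a positive Borel measure on $[0,1]$. Then, for any $p\geq1$ (with $p<\infty$), the following are equivalent: (i) it holds $M_{\Lambda,\alpha}^{p/\beta}\hookrightarrow L^p(\mathrm d\mu)$; (ii) it holds $\displaystyle\sum_{k\geq0}\lambda_{n_k}^{\frac{\beta\alpha}{1-\beta}}\left(\int_{[0,1]}t^{p\lambda_{n_k}}\,\mathrm d\mu(t)\right)^{\frac1{1-\beta}}<+\infty$. The embeddings are in fact compact.
   Context: $\Lambda=\{\lambda_k\}_{k\geq 0}$ is an increasing sequence of positive real numbers with $\sum_{k\ge0}1/\lambda_k<\infty$. $M_\Lambda$ is the space of functions $f:[0,1]\to\mathbb C$ of the form $f(t)=\sum_{k=0}^K a_kt^{\lambda_k}$, $a_k\in\mathbb C$, $K\geq 0$. $\Lambda$ is quasi-lacunary if there exist $N\geq1$, $q_0>1$ and a strictly increasing sequence of integers $(n_k)_{k\ge0}$ (with $n_0=-1$) such that $\Lambda$ is the disjoint union of the blocks $E_k=\{\lambda_{n_k+1},\dots,\lambda_{n_{k+1}}\}$, $k\ge 0$, with $\#E_k\leq N$ for all $k$ and $\lambda_{n_{k+1}}/\lambda_{n_k}>q_0$ for all $k$ large enough. It is quasi-lacunary and subgeometric if in addition, for some $q'>1$, $\lambda_{n_{k+1}}/\lambda_{n_k}\leq q'$ for all $k$ large enough. Such a decomposition is fixed, and $\{\lambda_{n_k}\}_{k\ge0}$ denotes the associated lacunary sequence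 (with $\lambda_{n_0}$ read as $\lambda_0$). $\mathrm d\nu_{\alpha-1}=(1-x)^{\alpha-1}\mathrm dx$ on $[0,1]$. The embedding $M_{\Lambda,\alpha}^{p/\beta}\hookrightarrow L^p(\mathrm d\mu)$ means that there is a constant $C>0$ such that $\|f\|_{L^p(\mathrm d\mu)}\leq C\|f\|_{L^{p/\beta}(\mathrm d\nu_{\alpha-1})}$ for all $f\in M_\Lambda$. It is compact if the unit ball $\{f\in M_\Lambda:\|f\|_{L^{p/\beta}(\mathrm d\nu_{\alpha-1})}\leq1\}$ is relatively compact in $L^p(\mathrm d\mu)$. *)

theory Defs
  imports "HOL-Analysis.Analysis"
begin

section \<open>The Banach space of p-integrable complex functions\<close>

text \<open>Real powers of extended nonnegative numbers, meant for exponents \<open>r > 0\<close>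
  (so that the value at infinity is infinity and the value at zero is zero).\<close>

definition ennpowr :: "ennreal \<Rightarrow> real \<Rightarrow> ennreal" where
  "ennpowr x r = (if x = \<infinity> then \<infinity> else ennreal (enn2real x powr r))"

definition Lp_norm :: "'a measure \<Rightarrow> real \<Rightarrow> ('a \<Rightarrow> complex) \<Rightarrow> ennreal" where
  "Lp_norm M p f = ennpowr (\<integral>\<^sup>+x. ennreal (norm (f x) powr p) \<partial>M) (1 / p)"

definition Lp_fun :: "'a measure \<Rightarrow> real \<Rightarrow> ('a \<Rightarrow> complex) set" where
  "Lp_fun M p = {f \<in> borel_measurable M. Lp_norm M p f < \<infinity>}"

definition Lp_eq :: "'a measure \<Rightarrow> real \<Rightarrow> (('a \<Rightarrow> complex) \<times> ('a \<Rightarrow> complex)) set" where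
  "Lp_eq M p = {(f, g). f \<in> Lp_fun M p \<and> g \<in> Lp_fun M p \<and> (AE x in M. f x = g x)}"

definition Lp_class :: "'a measure \<Rightarrow> real \<Rightarrow> ('a \<Rightarrow> complex) \<Rightarrow> ('a \<Rightarrow> complex) set" where
  "Lp_class M p f = Lp_eq M p `` {f}"

definition Lp_space :: "'a measure \<Rightarrow> real \<Rightarrow> ('a \<Rightarrow> complex) set set" where
  "Lp_space M p = Lp_fun M p // Lp_eq M p"

text \<open>The distance does not depend on the chosen representatives,
  see \<open>Lp_dist_class\<close> below.\<close>

definition Lp_dist :: "'a measure \<Rightarrow> real \<Rightarrow> ('a \<Rightarrow> complex) set \<Rightarrow> ('a \<Rightarrow> complex) set \<Rightarrow> real" where
  "Lp_dist M p F G = enn2real (Lp_norm M p (\<lambda>x. (SOME f. f \<in> F) x - (SOME g. g \<in> G) x))"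

definition Lp_topology :: "'a measure \<Rightarrow> real \<Rightarrow> ('a \<Rightarrow> complex) set topology" where
  "Lp_topology M p = Metric_space.mtopology (Lp_space M p) (Lp_dist M p)"

definition relatively_compact_in :: "'a topology \<Rightarrow> 'a set \<Rightarrow> bool" where
  "relatively_compact_in X S \<longleftrightarrow> S \<subseteq> topspace X \<and> compactin X (X closure_of S)"


section \<open>Muentz spaces and quasi-lacunary sequences\<close>

definition muentz_sequence :: "(nat \<Rightarrow> real) \<Rightarrow> bool" where
  "muentz_sequence l \<longleftrightarrow> strict_mono l \<and> (\<forall>k. 0 < l k) \<and> summable (\<lambda>k. 1 / l k)"

text \<open>Only the values on \<open>[0,1]\<close> matter, since all measures used below live there;
  note that \<open>0 powr a = 0\<close>.\<close>

definition muentz_space :: "(nat \<Rightarrow> real) \<Rightarrow> (real \<Rightarrow> complex) set" where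
  "muentz_space l = {f. \<exists>K a. f = (\<lambda>t. \<Sum>k\<le>K. a k * complex_of_real (t powr l k))}"

definition block :: "(nat \<Rightarrow> real) \<Rightarrow> (nat \<Rightarrow> int) \<Rightarrow> nat \<Rightarrow> real set" where
  "block l n k = l ` {j. n k + 1 \<le> int j \<and> int j \<le> n (Suc k)}"

text \<open>As \<open>nat (- 1) = 0\<close>, the term with index \<open>n 0 = - 1\<close> is read as \<open>l 0\<close>.\<close>

definition lacunary_part :: "(nat \<Rightarrow> real) \<Rightarrow> (nat \<Rightarrow> int) \<Rightarrow> nat \<Rightarrow> real" where
  "lacunary_part l n k = l (nat (n k))"

definition quasi_lacunary :: "(nat \<Rightarrow> real) \<Rightarrow> (nat \<Rightarrow> int) \<Rightarrow> bool" where
  "quasi_lacunary l n \<longleftrightarrow>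
     n 0 = - 1 \<and> strict_mono n \<and>
     range l = (\<Union>k. block l n k) \<and> disjoint_family (block l n) \<and>
     (\<exists>N\<ge>1. \<forall>k. card (block l n k) \<le> N) \<and>
     (\<exists>q\<^sub>0>1. \<forall>\<^sub>F k in sequentially. lacunary_part l n (Suc k) / lacunary_part l n k > q\<^sub>0)"

definition subgeometric :: "(nat \<Rightarrow> real) \<Rightarrow> (nat \<Rightarrow> int) \<Rightarrow> bool" where
  "subgeometric l n \<longleftrightarrow>
     (\<exists>q>1. \<forall>\<^sub>F k in sequentially. lacunary_part l n (Suc k) / lacunary_part l n k \<le> q)"


section \<open>Embeddings\<close>

text \<open>\<open>nu a\<close> is the measure \<open>(1 - x)\<^sup>a dx\<close> on \<open>[0,1]\<close>.\<close>

definition nu :: "real \<Rightarrow> real measure" where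
  "nu a = density (restrict_space lborel {0..1}) (\<lambda>x. ennreal ((1 - x) powr a))"

text \<open>The embedding of the Muentz space with the norm of \<open>L\<^sup>r(nu (\<alpha> - 1))\<close> into \<open>L\<^sup>p(\<mu>)\<close>.\<close>

definition muentz_embedding ::
  "(nat \<Rightarrow> real) \<Rightarrow> real \<Rightarrow> real \<Rightarrow> real \<Rightarrow> real measure \<Rightarrow> bool" where
  "muentz_embedding l \<alpha> r p \<mu> \<longleftrightarrow>
     (\<exists>C::real. C > 0 \<and>
       (\<forall>f\<in>muentz_space l. Lp_norm \<mu> p f \<le> ennreal C * Lp_norm (nu (\<alpha> - 1)) r f))"

definition muentz_unit_ball :: "(nat \<Rightarrow> real) \<Rightarrow> real \<Rightarrow> real \<Rightarrow> (real \<Rightarrow> complex) set" where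
  "muentz_unit_ball l \<alpha> r = {f \<in> muentz_space l. Lp_norm (nu (\<alpha> - 1)) r f \<le> 1}"

text \<open>A function outside \<open>Lp_fun \<mu> p\<close> has the empty set as its class, which is not a point of
  \<open>Lp_space \<mu> p\<close>; so this includes that the unit ball is contained in \<open>L\<^sup>p(\<mu>)\<close>.\<close>

definition muentz_embedding_compact ::
  "(nat \<Rightarrow> real) \<Rightarrow> real \<Rightarrow> real \<Rightarrow> real \<Rightarrow> real measure \<Rightarrow> bool" where
  "muentz_embedding_compact l \<alpha> r p \<mu> \<longleftrightarrow>
     relatively_compact_in (Lp_topology \<mu> p) (Lp_class \<mu> p ` muentz_unit_ball l \<alpha> r)"


section \<open>The distance on the space of classes is a metric\<close>

lemma ennpowr_le_iff:
  assumes "p > 0" "c \<ge> 0"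
  shows "ennpowr x (1 / p) \<le> ennreal c \<longleftrightarrow> x \<le> ennreal (c powr p)"
proof (cases x)
  case (real r)
  have "r powr (1/p) \<le> c \<longleftrightarrow> r \<le> c powr p"
  proof
    assume "r powr (1/p) \<le> c"
    hence "(r powr (1/p)) powr p \<le> c powr p" using assms by (intro powr_mono2) auto
    thus "r \<le> c powr p" using assms real by (simp add: powr_powr)
  next
    assume "r \<le> c powr p"
    hence "r powr (1/p) \<le> (c powr p) powr (1/p)" using assms real by (intro powr_mono2) auto
    thus "r powr (1/p) \<le> c" using assms by (simp add: powr_powr)
  qed
  thus ?thesis using real assms by (simp add: ennpowr_def)
next
  case top
  thus ?thesis by (simp add: ennpowr_def top_unique)
qed

lemma Lp_norm_le_iff:
  assumes "p > 0" "c \<ge> 0"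
  shows "Lp_norm M p f \<le> ennreal c \<longleftrightarrow> (\<integral>\<^sup>+x. ennreal (norm (f x) powr p) \<partial>M) \<le> ennreal (c powr p)"
  unfolding Lp_norm_def by (rule ennpowr_le_iff[OF assms])

lemma powr_convex_nonneg:
  fixes x y u v p :: real
  assumes "p \<ge> 1" "x \<ge> 0" "y \<ge> 0" "u > 0" "v > 0" "u + v = 1"
  shows "(u * x + v * y) powr p \<le> u * x powr p + v * y powr p"
proof -
  have le: "w powr p \<le> w" if "w > 0" "w \<le> 1" for w :: real
    using powr_mono'[of 1 p w] that assms(1) by simp
  consider "x = 0" | "y = 0" | "x > 0" "y > 0" using assms by linarith
  thus ?thesis
  proof cases
    case 1
    have "(v * y) powr p \<le> v * y powr p"
      using le[of v] assms by (simp add: powr_mult mult_right_mono)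
    thus ?thesis using 1 assms by simp
  next
    case 2
    have "(u * x) powr p \<le> u * x powr p"
      using le[of u] assms by (simp add: powr_mult mult_right_mono)
    thus ?thesis using 2 assms by simp
  next
    case 3
    have u: "u = 1 - v" using assms by simp
    have "v \<le> 1" using assms by linarith
    thus ?thesis
      unfolding u using convex_onD[OF powr_convex[OF assms(1)], of v x y] 3 assms(5) by simp
  qed
qed

lemma Lp_norm_triangle:
  assumes p: "p \<ge> 1" and f: "f \<in> borel_measurable M" and g: "g \<in> borel_measurable M"
  shows "Lp_norm M p (\<lambda>x. f x + g x) \<le> Lp_norm M p f + Lp_norm M p g"
proof -
  note [measurable] = f g
  have main: "Lp_norm M p (\<lambda>x. f x + g x) \<le> ennreal (a + b)"
    if a: "a > 0" "Lp_norm M p f \<le> ennreal a" and b: "b > 0" "Lp_norm M p g \<le> ennreal b" for a b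
  proof -
    define A where "A = (a + b) powr p * (a / (a + b)) / a powr p"
    define B where "B = (a + b) powr p * (b / (a + b)) / b powr p"
    have AB: "A \<ge> 0" "B \<ge> 0" using a b by (auto simp: A_def B_def)
    have pw: "norm (f x + g x) powr p \<le> A * norm (f x) powr p + B * norm (g x) powr p" for x
    proof -
      let ?u = "a / (a + b)" and ?v = "b / (a + b)"
      have uv: "?u + ?v = 1" using a b by (simp add: add_divide_distrib [symmetric])
      have eq: "norm (f x) + norm (g x) = (a + b) * (?u * (norm (f x) / a) + ?v * (norm (g x) / b))"
        using a b by (simp add: divide_simps)
      have "norm (f x + g x) powr p \<le> (norm (f x) + norm (g x)) powr p"
        using p by (intro powr_mono2 norm_triangle_ineq) auto
      also have "\<dots> = (a + b) powr p * (?u * (norm (f x) / a) + ?v * (norm (g x) / b)) powr p"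
        unfolding eq using a b by (intro powr_mult)
      also have "\<dots> \<le> (a + b) powr p *
          (?u * (norm (f x) / a) powr p + ?v * (norm (g x) / b) powr p)"
        using p a b uv by (intro mult_left_mono powr_convex_nonneg) auto
      also have "\<dots> = A * norm (f x) powr p + B * norm (g x) powr p"
        using a b by (simp add: A_def B_def powr_divide algebra_simps)
      finally show ?thesis .
    qed
    have If: "(\<integral>\<^sup>+x. ennreal (norm (f x) powr p) \<partial>M) \<le> ennreal (a powr p)"
      and Ig: "(\<integral>\<^sup>+x. ennreal (norm (g x) powr p) \<partial>M) \<le> ennreal (b powr p)"
      using a b p by (auto simp: Lp_norm_le_iff)
    have "(\<integral>\<^sup>+x. ennreal (norm (f x + g x) powr p) \<partial>M)
        \<le> (\<integral>\<^sup>+x. ennreal A * ennreal (norm (f x) powr p) + ennreal B * ennreal (norm (g x) powr p) \<partial>M)"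
      using pw AB
      by (intro nn_integral_mono)
        (simp add: ennreal_mult'[symmetric] ennreal_plus[symmetric] ennreal_leI del: ennreal_plus)
    also have "\<dots> = ennreal A * (\<integral>\<^sup>+x. ennreal (norm (f x) powr p) \<partial>M)
        + ennreal B * (\<integral>\<^sup>+x. ennreal (norm (g x) powr p) \<partial>M)"
      by (simp add: nn_integral_add nn_integral_cmult)
    also have "\<dots> \<le> ennreal A * ennreal (a powr p) + ennreal B * ennreal (b powr p)"
      by (intro add_mono mult_left_mono If Ig) auto
    also have "\<dots> = ennreal (A * a powr p + B * b powr p)"
      using AB by (simp add: ennreal_mult')
    also have "A * a powr p + B * b powr p = (a + b) powr p * (a / (a + b) + b / (a + b))"
      using a b by (simp add: A_def B_def distrib_left)
    also have "\<dots> = (a + b) powr p" using a b by (simp add: add_divide_distrib [symmetric])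
    finally show ?thesis using a b p by (subst Lp_norm_le_iff) auto
  qed
  show ?thesis
  proof (cases "Lp_norm M p f = \<infinity> \<or> Lp_norm M p g = \<infinity>")
    case True
    thus ?thesis by auto
  next
    case False
    then obtain a b where a: "Lp_norm M p f = ennreal a" "a \<ge> 0"
      and b: "Lp_norm M p g = ennreal b" "b \<ge> 0"
      by (metis ennreal_cases infinity_ennreal_def)
    have "Lp_norm M p (\<lambda>x. f x + g x) \<le> ennreal (a + b) + ennreal e" if "e > 0" for e :: real
    proof -
      have "Lp_norm M p (\<lambda>x. f x + g x) \<le> ennreal ((a + e/2) + (b + e/2))"
        using that a b by (intro main) (auto intro!: ennreal_leI)
      also have "\<dots> = ennreal (a + b) + ennreal e"
        using that a b by (subst ennreal_plus[symmetric]) auto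
      finally show ?thesis .
    qed
    hence "Lp_norm M p (\<lambda>x. f x + g x) \<le> ennreal (a + b)"
      by (rule ennreal_le_epsilon)
    thus ?thesis using a b by simp
  qed
qed

lemma Lp_norm_minus: "Lp_norm M p (\<lambda>x. g x - f x) = Lp_norm M p (\<lambda>x. f x - g x)"
  by (simp add: Lp_norm_def norm_minus_commute)

lemma Lp_norm_cong_AE:
  assumes "AE x in M. f x = g x"
  shows "Lp_norm M p f = Lp_norm M p g"
proof -
  have "(\<integral>\<^sup>+x. ennreal (norm (f x) powr p) \<partial>M) = (\<integral>\<^sup>+x. ennreal (norm (g x) powr p) \<partial>M)"
    by (rule nn_integral_cong_AE) (use assms in \<open>eventually_elim, simp\<close>)
  thus ?thesis by (simp add: Lp_norm_def)
qed

lemma Lp_norm_eq_0: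
  assumes "p > 0" "f \<in> borel_measurable M" "Lp_norm M p f = 0"
  shows "AE x in M. f x = 0"
proof -
  note [measurable] = assms(2)
  have "(\<integral>\<^sup>+x. ennreal (norm (f x) powr p) \<partial>M) \<le> 0"
    using assms Lp_norm_le_iff[of p 0 M f] by simp
  hence "AE x in M. ennreal (norm (f x) powr p) = 0"
    by (subst nn_integral_0_iff_AE [symmetric]) auto
  thus ?thesis by eventually_elim (use assms in \<open>simp add: ennreal_eq_0_iff\<close>)
qed

lemma equiv_Lp_eq: "equiv (Lp_fun M p) (Lp_eq M p)"
proof (rule equivI)
  show "Lp_eq M p \<subseteq> Lp_fun M p \<times> Lp_fun M p" by (auto simp: Lp_eq_def)
  show "refl_on (Lp_fun M p) (Lp_eq M p)" by (auto simp: refl_on_def Lp_eq_def)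
  show "sym (Lp_eq M p)" by (auto simp: sym_def Lp_eq_def)
  show "trans (Lp_eq M p)"
  proof (rule transI)
    fix f g h assume fg: "(f, g) \<in> Lp_eq M p" and gh: "(g, h) \<in> Lp_eq M p"
    have "AE x in M. f x = g x" "AE x in M. g x = h x" using fg gh by (auto simp: Lp_eq_def)
    hence "AE x in M. f x = h x" by eventually_elim simp
    thus "(f, h) \<in> Lp_eq M p" using fg gh by (auto simp: Lp_eq_def)
  qed
qed

lemma Lp_class_some:
  assumes "f \<in> Lp_fun M p"
  shows "(SOME g. g \<in> Lp_class M p f) \<in> Lp_fun M p"
    and "AE x in M. (SOME g. g \<in> Lp_class M p f) x = f x"
proof -
  define h where "h = (SOME g. g \<in> Lp_class M p f)"
  have "f \<in> Lp_class M p f" using assms by (simp add: Lp_class_def Lp_eq_def)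
  hence "h \<in> Lp_class M p f"
    unfolding h_def by (rule someI[of "\<lambda>g. g \<in> Lp_class M p f"])
  hence h: "h \<in> Lp_fun M p" "AE x in M. f x = h x"
    by (simp_all add: Lp_class_def Lp_eq_def)
  show "(SOME g. g \<in> Lp_class M p f) \<in> Lp_fun M p" using h(1) by (simp only: h_def)
  have "AE x in M. h x = f x" using h(2) by eventually_elim (rule sym)
  thus "AE x in M. (SOME g. g \<in> Lp_class M p f) x = f x" by (simp only: h_def)
qed

lemma Lp_dist_class:
  assumes "f \<in> Lp_fun M p" "g \<in> Lp_fun M p"
  shows "Lp_dist M p (Lp_class M p f) (Lp_class M p g) = enn2real (Lp_norm M p (\<lambda>x. f x - g x))"
proof -
  have "AE x in M. (SOME h. h \<in> Lp_class M p f) x - (SOME h. h \<in> Lp_class M p g) x = f x - g x"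
    using Lp_class_some(2)[OF assms(1)] Lp_class_some(2)[OF assms(2)] by eventually_elim simp
  thus ?thesis unfolding Lp_dist_def by (intro arg_cong[where f = enn2real] Lp_norm_cong_AE)
qed

lemma Lp_spaceE:
  assumes "F \<in> Lp_space M p"
  obtains f where "f \<in> Lp_fun M p" "F = Lp_class M p f"
  using assms unfolding Lp_space_def Lp_class_def by (auto elim: quotientE)

lemma Lp_norm_diff_finite:
  assumes "p \<ge> 1" "f \<in> Lp_fun M p" "g \<in> Lp_fun M p"
  shows "Lp_norm M p (\<lambda>x. f x - g x) < \<infinity>"
proof -
  have "Lp_norm M p (\<lambda>x. f x + (- g x)) \<le> Lp_norm M p f + Lp_norm M p (\<lambda>x. - g x)"
    using assms by (intro Lp_norm_triangle) (auto simp: Lp_fun_def)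
  also have "Lp_norm M p (\<lambda>x. - g x) = Lp_norm M p g" by (simp add: Lp_norm_def)
  also have "Lp_norm M p f + Lp_norm M p g < \<infinity>" using assms by (simp add: Lp_fun_def)
  finally show ?thesis by simp
qed

lemma Metric_space_Lp:
  assumes p: "p \<ge> 1"
  shows "Metric_space (Lp_space M p) (Lp_dist M p)"
proof
  show "0 \<le> Lp_dist M p F G" for F G by (simp add: Lp_dist_def)
  show "Lp_dist M p F G = Lp_dist M p G F" for F G
    unfolding Lp_dist_def by (subst Lp_norm_minus) simp
next
  fix F G assume "F \<in> Lp_space M p" "G \<in> Lp_space M p"
  then obtain f g where f: "f \<in> Lp_fun M p" "F = Lp_class M p f"
    and g: "g \<in> Lp_fun M p" "G = Lp_class M p g" by (metis Lp_spaceE)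
  have fin: "Lp_norm M p (\<lambda>x. f x - g x) \<noteq> top"
    using Lp_norm_diff_finite[OF p f(1) g(1)] by simp
  have "F = G \<longleftrightarrow> (f, g) \<in> Lp_eq M p"
    unfolding f(2) g(2) Lp_class_def
    using equiv_Lp_eq f(1) g(1) by (rule eq_equiv_class_iff)
  also have "\<dots> \<longleftrightarrow> (AE x in M. f x = g x)" using f g by (simp add: Lp_eq_def)
  also have "\<dots> \<longleftrightarrow> Lp_norm M p (\<lambda>x. f x - g x) = 0"
  proof
    assume "AE x in M. f x = g x"
    hence "AE x in M. f x - g x = 0" by eventually_elim simp
    hence "Lp_norm M p (\<lambda>x. f x - g x) = Lp_norm M p (\<lambda>x. 0)" by (rule Lp_norm_cong_AE)
    also have "\<dots> = 0" using p by (simp add: Lp_norm_def ennpowr_def)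
    finally show "Lp_norm M p (\<lambda>x. f x - g x) = 0" .
  next
    assume *: "Lp_norm M p (\<lambda>x. f x - g x) = 0"
    have "AE x in M. f x - g x = 0"
      using p f g by (intro Lp_norm_eq_0[OF _ _ *]) (auto simp: Lp_fun_def)
    thus "AE x in M. f x = g x" by eventually_elim simp
  qed
  also have "\<dots> \<longleftrightarrow> Lp_dist M p F G = 0"
    unfolding f(2) g(2) Lp_dist_class[OF f(1) g(1)] using fin by (simp add: enn2real_eq_0_iff)
  finally show "Lp_dist M p F G = 0 \<longleftrightarrow> F = G" by simp
next
  fix F G H assume "F \<in> Lp_space M p" "G \<in> Lp_space M p" "H \<in> Lp_space M p"
  then obtain f g h where f: "f \<in> Lp_fun M p" "F = Lp_class M p f"
    and g: "g \<in> Lp_fun M p" "G = Lp_class M p g"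
    and h: "h \<in> Lp_fun M p" "H = Lp_class M p h" by (metis Lp_spaceE)
  have "Lp_norm M p (\<lambda>x. (f x - g x) + (g x - h x))
      \<le> Lp_norm M p (\<lambda>x. f x - g x) + Lp_norm M p (\<lambda>x. g x - h x)"
    using f g h p by (intro Lp_norm_triangle) (auto simp: Lp_fun_def)
  hence *: "Lp_norm M p (\<lambda>x. f x - h x)
      \<le> Lp_norm M p (\<lambda>x. f x - g x) + Lp_norm M p (\<lambda>x. g x - h x)" by simp
  have fin: "Lp_norm M p (\<lambda>x. f x - g x) < top" "Lp_norm M p (\<lambda>x. g x - h x) < top"
    using Lp_norm_diff_finite[OF p] f g h by auto
  have "enn2real (Lp_norm M p (\<lambda>x. f x - h x))
      \<le> enn2real (Lp_norm M p (\<lambda>x. f x - g x) + Lp_norm M p (\<lambda>x. g x - h x))"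
    using * fin by (intro enn2real_mono) auto
  also have "\<dots> = enn2real (Lp_norm M p (\<lambda>x. f x - g x)) + enn2real (Lp_norm M p (\<lambda>x. g x - h x))"
    using fin by (rule enn2real_plus)
  finally show "Lp_dist M p F H \<le> Lp_dist M p F G + Lp_dist M p G H"
    using f g h by (simp add: Lp_dist_class)
qed

lemma topspace_Lp_topology:
  assumes "p \<ge> 1"
  shows "topspace (Lp_topology M p) = Lp_space M p"
  unfolding Lp_topology_def using Metric_space_Lp[OF assms] by (rule Metric_space.topspace_mtopology)

end

theory Submission
  imports Defs "HOL-Complex_Analysis.Great_Picard"
begin

text \<open>Substitute \<open>t = exp (- s)\<close> and put \<open>r = p / \<beta>\<close>. A function of the Muentz space becomes an exponential sum
\<open>f(s) = \<Sum>i. b i * exp (- l i * s)\<close>. The exponents split into clusters of boundedly many neighbours, any two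
clusters being separated by a fixed ratio. The cluster of scale \<open>\<Lambda>\<close> has a sum which matters only for
\<open>s \<lesssim> 1 / \<Lambda>\<close>, and the shell \<open>s \<approx> 1 / \<Lambda>\<close> has mass \<open>\<approx> \<Lambda> powr (- \<alpha>)\<close> for \<open>nu (\<alpha> - 1)\<close>.

The heart of the proof is the lower estimate \<open>sum_cluster_norm_le\<close>: the norms \<open>M k\<close> of the cluster sums satisfy
\<open>(\<Sum>k. scale k powr (- \<alpha>) * M k powr r) \<le> C * (\<integral> |f| powr r \<partial>nu (\<alpha> - 1))\<close>.
To isolate the cluster \<open>k\<close>, apply to \<open>f\<close> operators \<open>g \<mapsto> g (s + h) - exp (- \<theta> * h) * g s\<close> with
\<open>h = 1 / scale k\<close>. If \<open>\<theta>\<close> is an exponent, then this exponent disappears, while a cluster which stays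
away from \<open>\<theta>\<close> loses at most a constant factor (\<open>wnorm_le_fwd_diff\<close>). All clusters within \<open>L\<close> places of \<open>k\<close>
are removed in this way. The operator with \<open>\<theta> = 0\<close> is applied \<open>H\<close> times as well; it multiplies a slow cluster
\<open>j\<close> by about \<open>(scale j / scale k) ^ H\<close>, whereas a fast cluster has already decayed exponentially at
\<open>s \<approx> 1 / scale k\<close>. The price is a constant exponential in \<open>L + H\<close>, the gain is exponential in \<open>L * H\<close>; so a
large \<open>H\<close> and then a large \<open>L\<close> make the influence of the other clusters as small as desired
(\<open>cluster_norm_le_local_mean\<close>). What is left of \<open>f\<close> is a local mean of \<open>|f|\<close>, and the small
remainder is absorbed by the Schur test.

Conversely \<open>|f t| \<le> (\<Sum>j. M j * t powr y j)\<close>, where \<open>y j\<close> is comparable to the scale of the cluster \<open>j\<close>. Let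
\<open>x k\<close> be the lacunary part of the sequence. On the shell \<open>1 / x (k + 1) \<le> s < 1 / x k\<close> this sum is at most its
value \<open>F k\<close> at the left end point, and \<open>t powr (p * x k)\<close> is at least \<open>exp (- p)\<close>, so that \<open>\<integral> |f| powr p \<partial>\<mu>\<close> is
controlled by \<open>\<Sum>k. F k powr p * (\<integral> t powr (p * x k) \<partial>\<mu>)\<close>. The Schur test compares the weighted
sums of \<open>F\<close> and \<open>M\<close>; here the ratios \<open>x (k + 1) / x k\<close> have to be bounded, which is
the subgeometric growth. Hoelder's inequality with the exponents \<open>1 / \<beta>\<close> and \<open>1 / (1 - \<beta>)\<close> now shows that the
summability condition implies the embedding. For the other implication, the embedding is tested on positive
combinations of the \<open>t powr x k\<close> whose coefficients give equality in Hoelder's inequality.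

For the compactness, the tail of the convergent series bounds the contribution of a neighbourhood of \<open>t = 1\<close>
uniformly on the unit ball, and the coefficients of the functions in the ball are bounded. A diagonal
subsequence along which all coefficients converge is therefore a Cauchy sequence in \<open>L\<^sup>p(\<mu>)\<close>, and it converges
pointwise away from \<open>t = 1\<close>, a null set.\<close>

section \<open>Finite sums, the Schur test and lacunary sequences\<close>

lemma Holder_inequality_sum:
  fixes x y :: "'a \<Rightarrow> real"
  assumes "finite S" and p: "p > 1" and q: "q > 1" and pq: "1 / p + 1 / q = 1"
    and x: "\<And>i. i \<in> S \<Longrightarrow> x i \<ge> 0" and y: "\<And>i. i \<in> S \<Longrightarrow> y i \<ge> 0"
  shows "(\<Sum>i\<in>S. x i * y i) \<le> (\<Sum>i\<in>S. x i powr p) powr (1 / p) * (\<Sum>i\<in>S. y i powr q) powr (1 / q)"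
proof -
  define X where "X = (\<Sum>i\<in>S. x i powr p)"
  define Y where "Y = (\<Sum>i\<in>S. y i powr q)"
  have "X \<ge> 0" "Y \<ge> 0" by (auto simp: X_def Y_def intro!: sum_nonneg)
  show ?thesis
  proof (cases "X = 0 \<or> Y = 0")
    case True
    have "x i * y i = 0" if "i \<in> S" for i
      using True that \<open>finite S\<close> unfolding X_def Y_def
      by (auto simp: sum_nonneg_eq_0_iff)
    then have "(\<Sum>i\<in>S. x i * y i) = 0" by (intro sum.neutral) auto
    then show ?thesis by simp
  next
    case False
    then have XY: "X > 0" "Y > 0" using \<open>X \<ge> 0\<close> \<open>Y \<ge> 0\<close> by auto
    let ?a = "X powr (1 / p)" and ?b = "Y powr (1 / q)"
    have "(\<Sum>i\<in>S. (x i / ?a) * (y i / ?b)) \<le> (\<Sum>i\<in>S. (x i / ?a) powr p / p + (y i / ?b) powr q / q)"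
      using p q pq x y by (intro sum_mono Youngs_inequality) auto
    also have "\<dots> = (\<Sum>i\<in>S. x i powr p / X / p + y i powr q / Y / q)"
      using x y XY p q by (intro sum.cong) (auto simp: powr_divide powr_powr)
    also have "\<dots> = X / X / p + Y / Y / q"
      by (simp only: X_def Y_def sum.distrib sum_divide_distrib)
    also have "\<dots> = 1" using XY pq by simp
    finally have "(\<Sum>i\<in>S. x i * y i) / (?a * ?b) \<le> 1"
      by (simp add: sum_divide_distrib)
    then show ?thesis using XY by (simp add: X_def Y_def divide_le_eq)
  qed
qed

text \<open>Write \<open>A = A powr (1 / r') * A powr (1 / r)\<close> with the conjugate exponent \<open>r'\<close>. Hoelder's inequality uses the
bound on the row sums; exchanging the order of summation afterwards uses the bound on the column sums.\<close>

lemma Schur_test_sum: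
  fixes A :: "'a \<Rightarrow> 'b \<Rightarrow> real" and x :: "'b \<Rightarrow> real"
  assumes S: "finite S" and T: "finite T" and r: "r > 1" and "d \<ge> 0"
    and A: "\<And>k j. k \<in> S \<Longrightarrow> j \<in> T \<Longrightarrow> A k j \<ge> 0"
    and row: "\<And>k. k \<in> S \<Longrightarrow> (\<Sum>j\<in>T. A k j) \<le> d"
    and col: "\<And>j. j \<in> T \<Longrightarrow> (\<Sum>k\<in>S. A k j) \<le> d"
    and x: "\<And>j. j \<in> T \<Longrightarrow> x j \<ge> 0"
  shows "(\<Sum>k\<in>S. (\<Sum>j\<in>T. A k j * x j) powr r) \<le> d powr r * (\<Sum>j\<in>T. x j powr r)"
proof -
  define q where "q = r / (r - 1)"
  have q: "q > 1" "1 / r + 1 / q = 1" using r by (auto simp: q_def field_simps)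
  have iq: "1 / q = 1 - 1 / r" using q(2) by simp
  have rq: "1 / q * r = r - 1" using r by (simp add: iq algebra_simps)
  have one: "(\<Sum>j\<in>T. A k j * x j) powr r \<le> d powr (r - 1) * (\<Sum>j\<in>T. A k j * x j powr r)"
    if k: "k \<in> S" for k
  proof -
    have "(\<Sum>j\<in>T. A k j * x j) = (\<Sum>j\<in>T. (A k j powr (1 / r) * x j) * A k j powr (1 / q))"
    proof (intro sum.cong refl)
      fix j assume "j \<in> T"
      then have "A k j \<ge> 0" using A k by auto
      have "A k j powr (1/r) * A k j powr (1/q) = A k j powr (1/r + 1/q)" by (simp only: powr_add)
      also have "\<dots> = A k j" using \<open>A k j \<ge> 0\<close> q(2) by simp
      finally show "A k j * x j = (A k j powr (1 / r) * x j) * A k j powr (1 / q)"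
        by (simp add: mult_ac)
    qed
    also have "\<dots> \<le> (\<Sum>j\<in>T. (A k j powr (1 / r) * x j) powr r) powr (1 / r)
        * (\<Sum>j\<in>T. (A k j powr (1 / q)) powr q) powr (1 / q)"
      using T r q A k x by (intro Holder_inequality_sum) auto
    also have "(\<Sum>j\<in>T. (A k j powr (1 / r) * x j) powr r) = (\<Sum>j\<in>T. A k j * x j powr r)"
      using A k x r by (intro sum.cong) (auto simp: powr_mult powr_powr)
    also have "(\<Sum>j\<in>T. (A k j powr (1 / q)) powr q) = (\<Sum>j\<in>T. A k j)"
      using A k q by (intro sum.cong) (auto simp: powr_powr)
    also have "(\<Sum>j\<in>T. A k j * x j powr r) powr (1 / r) * (\<Sum>j\<in>T. A k j) powr (1 / q)
       \<le> (\<Sum>j\<in>T. A k j * x j powr r) powr (1 / r) * d powr (1 / q)"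
      using row[OF k] q A k by (intro mult_left_mono powr_mono2 sum_nonneg) auto
    finally have "(\<Sum>j\<in>T. A k j * x j) powr r \<le>
        ((\<Sum>j\<in>T. A k j * x j powr r) powr (1 / r) * d powr (1 / q)) powr r"
      using r A k x by (intro powr_mono2) (auto intro!: sum_nonneg)
    also have "\<dots> = d powr (r - 1) * (\<Sum>j\<in>T. A k j * x j powr r)"
    proof -
      have "(\<Sum>j\<in>T. A k j * x j powr r) \<ge> 0" using A k by (auto intro!: sum_nonneg)
      then show ?thesis using r rq by (simp add: powr_mult powr_powr)
    qed
    finally show ?thesis .
  qed
  have "(\<Sum>k\<in>S. (\<Sum>j\<in>T. A k j * x j) powr r) \<le> (\<Sum>k\<in>S. d powr (r - 1) * (\<Sum>j\<in>T. A k j * x j powr r))"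
    by (intro sum_mono one)
  also have "\<dots> = d powr (r - 1) * (\<Sum>j\<in>T. (\<Sum>k\<in>S. A k j) * x j powr r)"
    by (simp add: sum_distrib_left[symmetric] sum_distrib_right sum.swap[of _ T S])
  also have "\<dots> \<le> d powr (r - 1) * (\<Sum>j\<in>T. d * x j powr r)"
    using col by (intro mult_left_mono sum_mono mult_right_mono) auto
  also have "\<dots> = d powr r * (\<Sum>j\<in>T. x j powr r)"
    using \<open>d \<ge> 0\<close> powr_mult_base[of d "r - 1"] by (simp add: sum_distrib_left[symmetric] mult_ac)
  finally show ?thesis .
qed

definition lacunary :: "real \<Rightarrow> (nat \<Rightarrow> real) \<Rightarrow> bool" where
  "lacunary q y \<longleftrightarrow> (\<forall>k. 0 < y k \<and> q * y k \<le> y (Suc k))"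

lemma lacunary_pos: "lacunary q y \<Longrightarrow> 0 < y k"
  by (simp add: lacunary_def)

lemma lacunary_power:
  assumes "lacunary q y" "q > 1" "j \<le> k"
  shows "q ^ (k - j) * y j \<le> y k"
  using assms(3)
proof (induction k rule: dec_induct)
  case (step k)
  have "q ^ (Suc k - j) * y j = q * (q ^ (k - j) * y j)"
    using step by (simp add: Suc_diff_le)
  also have "\<dots> \<le> q * y k" using step assms by (intro mult_left_mono) auto
  also have "\<dots> \<le> y (Suc k)" using assms by (simp add: lacunary_def)
  finally show ?case .
qed simp

lemma lacunary_strict_mono: "lacunary q y \<Longrightarrow> q > 1 \<Longrightarrow> strict_mono y"
  unfolding strict_mono_Suc_iff lacunary_def
  by (metis less_le_trans mult_less_cancel_right1 not_less_iff_gr_or_eq)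

lemma geometric_sum_le:
  fixes z :: real
  assumes "0 < z" "z < 1" "finite S" "inj_on f S"
  shows "(\<Sum>k\<in>S. z ^ (f k)) \<le> 1 / (1 - z)"
proof -
  have "(\<Sum>k\<in>S. z ^ (f k)) = (\<Sum>i\<in>f ` S. z ^ i)" using assms by (simp add: sum.reindex)
  also have "\<dots> \<le> (\<Sum>i. z ^ i)" using assms by (intro sum_le_suminf summable_geometric) auto
  also have "\<dots> = 1 / (1 - z)" using assms by (intro suminf_geometric) auto
  finally show ?thesis .
qed

text \<open>A lacunary sequence contributes a geometric series on either side of a given scale \<open>X\<close>. This is what
makes the row and column sums of the kernels below finite.\<close>

lemma lacunary_sum_bound:
  assumes y: "lacunary q y" and q: "q > 1" and a: "a > 0" and X: "X > 0" and S: "finite S"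
  shows "(\<Sum>k\<in>S. min ((y k / X) powr a) ((X / y k) powr a)) \<le> 2 / (1 - (1 / q) powr a)"
proof -
  define z where "z = (1 / q) powr a"
  have z: "0 < z" "z < 1" using q a powr_less_mono2[of a "1 / q" 1] by (auto simp: z_def)
  have ypos: "y k > 0" for k using y by (simp add: lacunary_def)
  define S1 where "S1 = {k \<in> S. y k \<le> X}"
  define S2 where "S2 = {k \<in> S. y k > X}"
  have fin: "finite S1" "finite S2" using S by (auto simp: S1_def S2_def)
  have zp: "z ^ n = (1 / q ^ n) powr a" for n
  proof -
    have "((1 / q) ^ n) powr a = z ^ n"
      using q by (induction n) (simp_all add: z_def powr_mult powr_divide)
    then show ?thesis by (simp add: power_divide)
  qed
  have "(\<Sum>k\<in>S1. min ((y k / X) powr a) ((X / y k) powr a)) \<le> 1 / (1 - z)"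
  proof (cases "S1 = {}")
    case False
    define K where "K = Max S1"
    have K: "K \<in> S1" "\<And>k. k \<in> S1 \<Longrightarrow> k \<le> K" using False fin by (auto simp: K_def)
    have "(\<Sum>k\<in>S1. min ((y k / X) powr a) ((X / y k) powr a)) \<le> (\<Sum>k\<in>S1. z ^ (K - k))"
    proof (intro sum_mono)
      fix k assume k: "k \<in> S1"
      have "q ^ (K - k) * y k \<le> X"
        using lacunary_power[OF y q K(2)[OF k]] K(1) by (auto simp: S1_def)
      then have "y k / X \<le> 1 / q ^ (K - k)" using X q by (simp add: field_simps)
      then have "(y k / X) powr a \<le> z ^ (K - k)"
        unfolding zp using X ypos[of k] a by (intro powr_mono2) auto
      then show "min ((y k / X) powr a) ((X / y k) powr a) \<le> z ^ (K - k)" by linarith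
    qed
    also have "\<dots> \<le> 1 / (1 - z)"
      using z fin K(2) by (intro geometric_sum_le inj_onI) (auto, metis diff_diff_cancel)
    finally show ?thesis .
  qed (use z in simp)
  moreover have "(\<Sum>k\<in>S2. min ((y k / X) powr a) ((X / y k) powr a)) \<le> 1 / (1 - z)"
  proof (cases "S2 = {}")
    case False
    define K where "K = Min S2"
    have K: "K \<in> S2" "\<And>k. k \<in> S2 \<Longrightarrow> K \<le> k" using False fin by (auto simp: K_def)
    have "(\<Sum>k\<in>S2. min ((y k / X) powr a) ((X / y k) powr a)) \<le> (\<Sum>k\<in>S2. z ^ (k - K))"
    proof (intro sum_mono)
      fix k assume k: "k \<in> S2"
      have "q ^ (k - K) * X \<le> q ^ (k - K) * y K" using K(1) q by (auto simp: S2_def)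
      also have "\<dots> \<le> y k" using lacunary_power[OF y q K(2)[OF k]] .
      finally have "X / y k \<le> 1 / q ^ (k - K)" using ypos[of k] q by (simp add: field_simps)
      then have "(X / y k) powr a \<le> z ^ (k - K)"
        unfolding zp using X ypos[of k] a by (intro powr_mono2) auto
      then show "min ((y k / X) powr a) ((X / y k) powr a) \<le> z ^ (k - K)" by linarith
    qed
    also have "\<dots> \<le> 1 / (1 - z)"
      using z fin K(2) by (intro geometric_sum_le inj_onI) (auto, metis le_add_diff_inverse)
    finally show ?thesis .
  qed (use z in simp)
  moreover have "(\<Sum>k\<in>S. min ((y k / X) powr a) ((X / y k) powr a)) =
      (\<Sum>k\<in>S1. min ((y k / X) powr a) ((X / y k) powr a)) +
      (\<Sum>k\<in>S2. min ((y k / X) powr a) ((X / y k) powr a))"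
    using fin by (subst sum.union_disjoint[symmetric]) (auto simp: S1_def S2_def intro!: sum.cong)
  ultimately show ?thesis unfolding z_def[symmetric] by simp
qed

lemma exp_minus_le_powr:
  fixes c b :: real
  assumes "c > 0" "b \<ge> 0"
  shows "\<exists>C>0. \<forall>u>0. exp (- c * u) \<le> C * (1 / u) powr b"
proof -
  obtain n :: nat where n: "b \<le> real n" using real_arch_simple by blast
  define C where "C = max 1 (fact n / c ^ n)"
  have "exp (- c * u) \<le> C * (1 / u) powr b" if "u > 0" for u
  proof (cases "u \<le> 1")
    case True
    have "1 \<le> (1 / u) powr b" using True that assms by (intro ge_one_powr_ge_zero) auto
    have "1 * 1 \<le> C * (1 / u) powr b"
      using \<open>1 \<le> (1 / u) powr b\<close> by (intro mult_mono) (auto simp: C_def)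
    moreover have "exp (- c * u) \<le> 1" using that assms by simp
    ultimately show ?thesis by linarith
  next
    case False
    have "(c * u) ^ n / fact n \<le> exp (c * u)"
    proof -
      have "(\<Sum>k\<in>{n}. inverse (fact k) * (c * u) ^ k) \<le> (\<Sum>k. inverse (fact k) * (c * u) ^ k)"
        using assms that summable_exp[of "c * u"] by (intro sum_le_suminf) auto
      also have "\<dots> = exp (c * u)" by (simp add: exp_def)
      finally show ?thesis by (simp add: divide_inverse mult.commute)
    qed
    then have "exp (- c * u) \<le> fact n / c ^ n * (1 / u ^ n)"
      using assms that by (simp add: exp_minus field_simps)
    also have "\<dots> \<le> C * (1 / u ^ n)"
      using that by (intro mult_right_mono) (auto simp: C_def)
    also have "1 / u ^ n = (1 / u) powr n"
      using that by (simp add: powr_realpow power_one_over)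
    also have "C * (1 / u) powr n \<le> C * (1 / u) powr b"
      using False n that by (intro mult_left_mono powr_mono') (auto simp: C_def)
    finally show ?thesis .
  qed
  moreover have "C > 0" by (simp add: C_def)
  ultimately show ?thesis by blast
qed

text \<open>The kernel \<open>u powr a * exp (- c * u)\<close> will be summed over ratios \<open>u\<close> of lacunary sequences, by
\<open>lacunary_sum_bound\<close>.\<close>

lemma exp_kernel_bound:
  fixes a c :: real
  assumes "a > 0" "c > 0"
  shows "\<exists>C>0. \<forall>u>0. u powr a * exp (- c * u) \<le> C * min (u powr a) ((1 / u) powr a)"
proof -
  obtain C where C: "C > 0" "\<And>u. u > 0 \<Longrightarrow> exp (- c * u) \<le> C * (1 / u) powr (2 * a)"
    using exp_minus_le_powr[of c "2 * a"] assms by auto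
  have "u powr a * exp (- c * u) \<le> max 1 C * min (u powr a) ((1 / u) powr a)" if u: "u > 0" for u
  proof -
    have "u powr a * exp (- c * u) \<le> u powr a * 1"
      using u assms by (intro mult_left_mono) auto
    also have "\<dots> \<le> max 1 C * u powr a" by (simp add: mult_le_cancel_right1)
    finally have 1: "u powr a * exp (- c * u) \<le> max 1 C * u powr a" .
    have "u powr a * exp (- c * u) \<le> u powr a * (C * (1 / u) powr (2 * a))"
      using C(2)[OF u] by (intro mult_left_mono) auto
    also have "\<dots> = C * (1 / u) powr a"
    proof -
      have "u powr a * (1 / u) powr (2 * a) = (1 / u) powr a"
        using u by (simp add: powr_divide powr_mult divide_simps flip: powr_add)
      then show ?thesis by (simp add: mult_ac)
    qed
    also have "\<dots> \<le> max 1 C * (1 / u) powr a" by (intro mult_right_mono) auto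
    finally have 2: "u powr a * exp (- c * u) \<le> max 1 C * (1 / u) powr a" .
    show ?thesis using 1 2 by (auto simp: min_def)
  qed
  then show ?thesis by (intro exI[of _ "max 1 C"]) auto
qed

text \<open>Young's inequality, read as the statement that the graph of \<open>y powr r\<close> lies above its tangents.\<close>

lemma powr_ge_tangent:
  fixes y m r :: real
  assumes "r > 1" "y \<ge> 0" "m \<ge> 0"
  shows "m powr r + r * m powr (r - 1) * (y - m) \<le> y powr r"
proof -
  define q where "q = r / (r - 1)"
  have q: "q > 1" "1 / r + 1 / q = 1" using assms by (auto simp: q_def field_simps)
  have "y * m powr (r - 1) \<le> y powr r / r + (m powr (r - 1)) powr q / q"
    using assms q by (intro Youngs_inequality) auto
  also have "(m powr (r - 1)) powr q = m powr r" using assms by (simp add: powr_powr q_def)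
  finally have "r * (y * m powr (r - 1)) \<le> r * (y powr r / r + m powr r / q)"
    using assms by (intro mult_left_mono) auto
  also have "\<dots> = y powr r + (r - 1) * m powr r"
    using assms by (simp add: q_def field_simps)
  finally have "r * (y * m powr (r - 1)) \<le> y powr r + (r - 1) * m powr r" .
  moreover have "m powr (r - 1) * m = m powr r" using assms powr_mult_base[of m "r - 1"] by (simp add: mult.commute)
  ultimately show ?thesis by (simp add: algebra_simps)
qed

section \<open>Exponential sums and difference operators\<close>

definition esum :: "'i set \<Rightarrow> ('i \<Rightarrow> complex) \<Rightarrow> ('i \<Rightarrow> real) \<Rightarrow> real \<Rightarrow> complex" where
  "esum A b u s = (\<Sum>i\<in>A. b i * complex_of_real (exp (- u i * s)))"

lemma continuous_on_esum [continuous_intros]: "continuous_on S (esum A b u)"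
  unfolding esum_def by (intro continuous_intros)

lemma continuous_on_esum_compose [continuous_intros]:
  "continuous_on S g \<Longrightarrow> continuous_on S (\<lambda>s. esum A b u (g s))"
  unfolding esum_def by (intro continuous_intros)

lemma integrable_esum: "esum A b u integrable_on {x..y}"
  by (intro integrable_continuous_interval continuous_intros)

lemma integrable_norm_esum: "(\<lambda>s. norm (esum A b u s)) integrable_on {x..y}"
  by (intro integrable_continuous_interval continuous_intros)

text \<open>On \<open>exp (- u * s)\<close> this operator is the multiplication by \<open>exp (- u * h) - exp (- \<theta> * h)\<close>. In particular it
annihilates the exponent \<open>\<theta>\<close>.\<close>

definition fwd_diff :: "real \<Rightarrow> real \<Rightarrow> (real \<Rightarrow> complex) \<Rightarrow> real \<Rightarrow> complex" where
  "fwd_diff h \<theta> P s = P (s + h) - complex_of_real (exp (- \<theta> * h)) * P s"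

lemma fwd_diff_esum:
  "fwd_diff h \<theta> (esum A b u) = esum A (\<lambda>i. b i * complex_of_real (exp (- u i * h) - exp (- \<theta> * h))) u"
proof (rule ext)
  fix s
  have e: "exp (- u i * (s + h)) = exp (- u i * s) * exp (- u i * h)" for i
    by (simp add: algebra_simps flip: exp_add)
  show "fwd_diff h \<theta> (esum A b u) s
      = esum A (\<lambda>i. b i * complex_of_real (exp (- u i * h) - exp (- \<theta> * h))) u s"
    unfolding fwd_diff_def esum_def sum_distrib_left sum_subtractf[symmetric] e of_real_mult of_real_diff
    by (intro sum.cong refl) (simp only: ring_distribs mult_ac)
qed

lemma fwd_diff_esum_remove:
  assumes "finite A" "i\<^sub>0 \<in> A"
  shows "fwd_diff h (u i\<^sub>0) (esum A b u) =
    esum (A - {i\<^sub>0}) (\<lambda>i. b i * complex_of_real (exp (- u i * h) - exp (- u i\<^sub>0 * h))) u"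
  using assms unfolding fwd_diff_esum by (intro ext) (simp add: esum_def sum.remove)

text \<open>The reciprocal of \<open>\<integral> exp (- \<theta> * s) ds\<close> over \<open>[0, h]\<close>, so that \<open>mean_diff\<close> below annihilates the
exponent \<open>\<theta>\<close>.\<close>

definition mean_factor :: "real \<Rightarrow> real \<Rightarrow> real" where
  "mean_factor \<theta> h = \<theta> / (1 - exp (- \<theta> * h))"

lemma mean_factor_bounds:
  assumes "0 < \<theta>" "\<theta> \<le> D" "0 < h"
  shows "0 < mean_factor \<theta> h" "mean_factor \<theta> h \<le> exp (D * h) / h"
proof -
  have e: "exp (- \<theta> * h) < 1" using assms by simp
  then show "0 < mean_factor \<theta> h" using assms by (simp add: mean_factor_def)
  have "\<theta> * h \<le> exp (\<theta> * h) - 1" using exp_ge_add_one_self[of "\<theta> * h"] by linarith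
  also have "\<dots> = exp (\<theta> * h) * (1 - exp (- \<theta> * h))"
    by (simp add: exp_minus right_diff_distrib)
  finally have "\<theta> * h \<le> exp (\<theta> * h) * (1 - exp (- \<theta> * h))" .
  also have "\<dots> \<le> exp (D * h) * (1 - exp (- \<theta> * h))"
    using assms e by (intro mult_right_mono) auto
  finally show "mean_factor \<theta> h \<le> exp (D * h) / h"
    using assms e by (simp add: mean_factor_def field_simps)
qed

text \<open>A variant of \<open>fwd_diff\<close> in which the translate is replaced by a mean. The part that is subtracted is
controlled by an \<open>L\<^sup>1\<close> norm and its increments are small; \<open>fwd_diff\<close> has neither property.\<close>

definition mean_diff :: "real \<Rightarrow> real \<Rightarrow> (real \<Rightarrow> complex) \<Rightarrow> real \<Rightarrow> complex" where
  "mean_diff h \<theta> P s = P s - complex_of_real (mean_factor \<theta> h) * integral {s..s + h} P"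

lemma integral_esum:
  assumes "finite A" "\<And>i. i \<in> A \<Longrightarrow> u i > 0" "h \<ge> 0"
  shows "integral {s..s + h} (esum A b u) =
    esum A (\<lambda>i. b i * complex_of_real ((1 - exp (- u i * h)) / u i)) u s"
proof -
  have 1: "((\<lambda>x. complex_of_real (exp (- u i * x))) has_integral
      complex_of_real ((1 - exp (- u i * h)) / u i * exp (- u i * s))) {s..s + h}" if "i \<in> A" for i
  proof -
    have "((\<lambda>x. exp (- u i * x)) has_integral
        ((- exp (- u i * (s + h)) / u i) - (- exp (- u i * s) / u i))) {s..s + h}"
      using assms(2)[OF that] assms(3)
      by (intro fundamental_theorem_of_calculus)
        (auto intro!: derivative_eq_intros simp flip: has_real_derivative_iff_has_vector_derivative)
    also have "exp (- u i * (s + h)) = exp (- u i * h) * exp (- u i * s)"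
      by (simp add: algebra_simps flip: exp_add)
    also have "- (exp (- u i * h) * exp (- u i * s)) / u i - (- exp (- u i * s) / u i)
        = (1 - exp (- u i * h)) / u i * exp (- u i * s)"
      by (simp add: diff_divide_distrib left_diff_distrib)
    finally show ?thesis by (rule has_integral_of_real)
  qed
  have "(esum A b u has_integral (\<Sum>i\<in>A. b i * complex_of_real ((1 - exp (- u i * h)) / u i * exp (- u i * s)))) {s..s + h}"
    unfolding esum_def using assms 1 by (intro has_integral_sum has_integral_mult_right) auto
  then show ?thesis by (simp add: integral_unique esum_def mult_ac)
qed

lemma mean_diff_esum_remove:
  assumes "finite A" "i\<^sub>0 \<in> A" "\<And>i. i \<in> A \<Longrightarrow> u i > 0" "h > 0"
  shows "\<exists>b'. mean_diff h (u i\<^sub>0) (esum A b u) = esum (A - {i\<^sub>0}) b' u"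
proof -
  let ?b = "\<lambda>i. b i * complex_of_real (1 - mean_factor (u i\<^sub>0) h * ((1 - exp (- u i * h)) / u i))"
  have "?b i\<^sub>0 = 0" using assms(3)[OF assms(2)] assms(4) by (simp add: mean_factor_def)
  moreover have "mean_diff h (u i\<^sub>0) (esum A b u) = esum A ?b u"
    using assms by (intro ext) (simp only: mean_diff_def integral_esum less_imp_le esum_def
      sum_distrib_left sum_subtractf[symmetric] of_real_diff of_real_mult of_real_1, simp add: algebra_simps)
  ultimately have "mean_diff h (u i\<^sub>0) (esum A b u) = esum (A - {i\<^sub>0}) ?b u"
    using assms by (intro ext) (simp add: esum_def sum.remove[of A i\<^sub>0])
  then show ?thesis by blast
qed

lemma norm_integral_le_integral_norm:
  fixes P :: "real \<Rightarrow> complex"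
  assumes "continuous_on UNIV P" "x \<le> x'" "y' \<le> y"
  shows "norm (integral {x'..y'} P) \<le> integral {x..y} (\<lambda>s. norm (P s))"
proof -
  have c: "continuous_on {v..w} P" for v w using assms(1) continuous_on_subset by blast
  have "norm (integral {x'..y'} P) \<le> integral {x'..y'} (\<lambda>s. norm (P s))"
    by (intro integral_norm_bound_integral integrable_continuous_interval c continuous_intros) auto
  also have "\<dots> \<le> integral {x..y} (\<lambda>s. norm (P s))"
    using assms by (intro integral_subset_le integrable_continuous_interval c continuous_intros) auto
  finally show ?thesis .
qed

text \<open>Pointwise values are controlled by a local \<open>L\<^sup>1\<close> norm, uniformly in the exponents, which may even be arbitrarily
close to each other. Induction on the number of terms: \<open>mean_diff\<close> removes one exponent, and changes the
function by at most a multiple of the \<open>L\<^sup>1\<close> norm.\<close>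

lemma esum_le_integral:
  assumes "D > 0"
  shows "0 \<le> h \<Longrightarrow> h < h' \<Longrightarrow> \<exists>C>0. \<forall>A b u. finite A \<longrightarrow> card A \<le> d \<longrightarrow> (\<forall>i\<in>A. 0 < u i \<and> u i \<le> D) \<longrightarrow>
    (\<forall>s\<in>{0..h}. norm (esum (A :: nat set) b u s) \<le> C * integral {0..h'} (\<lambda>s. norm (esum A b u s)))"
proof (induction d arbitrary: h h')
  case 0
  show ?case by (intro exI[of _ 1]) (auto simp: esum_def)
next
  case (Suc d)
  define \<delta> where "\<delta> = (h' - h) / 2"
  have \<delta>: "\<delta> > 0" "h + \<delta> + \<delta> = h'" using Suc.prems by (auto simp: \<delta>_def field_simps)
  define \<kappa> where "\<kappa> = exp (D * \<delta>) / \<delta>"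
  have \<kappa>: "\<kappa> > 0" using \<delta> by (simp add: \<kappa>_def)
  obtain C where C: "C > 0" "\<And>A b u s. finite A \<Longrightarrow> card A \<le> d \<Longrightarrow> (\<forall>i\<in>A. 0 < u i \<and> u i \<le> D) \<Longrightarrow>
     s \<in> {0..h} \<Longrightarrow> norm (esum (A :: nat set) b u s) \<le> C * integral {0..h+\<delta>} (\<lambda>s. norm (esum A b u s))"
    using Suc.IH[of h "h + \<delta>"] Suc.prems \<delta> by auto
  define C' where "C' = C * (1 + (h + \<delta>) * \<kappa>) + \<kappa>"
  have C': "C' > 0" using C \<kappa> \<delta> Suc.prems by (auto simp: C'_def intro!: add_pos_pos mult_pos_pos add_nonneg_pos add_pos_nonneg mult_nonneg_nonneg)
  show ?case
  proof (intro exI[of _ C'] conjI allI impI ballI C')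
    fix A :: "nat set" and b u s
    assume A: "finite A" "card A \<le> Suc d" and u: "\<forall>i\<in>A. 0 < u i \<and> u i \<le> D" and s: "s \<in> {0..h}"
    define P where "P = esum A b u"
    have cP: "continuous_on X P" for X unfolding P_def by (intro continuous_intros)
    define I where "I = integral {0..h'} (\<lambda>s. norm (P s))"
    have I0: "I \<ge> 0" unfolding I_def by (intro integral_nonneg integrable_continuous_interval continuous_intros cP) auto
    have "norm (P s) \<le> C' * I"
    proof (cases "A = {}")
      case True
      then show ?thesis using I0 C' by (simp add: P_def esum_def)
    next
      case False
      then obtain i\<^sub>0 where i\<^sub>0: "i\<^sub>0 \<in> A" by auto
      define R where "R = mean_diff \<delta> (u i\<^sub>0) P"
      obtain b' where R: "R = esum (A - {i\<^sub>0}) b' u"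
        using mean_diff_esum_remove[of A i\<^sub>0 u \<delta> b] A u i\<^sub>0 \<delta> unfolding R_def P_def by auto
      have PR: "norm (P x - R x) \<le> \<kappa> * I" if "x \<in> {0..h + \<delta>}" for x
      proof -
        have "norm (P x - R x) = mean_factor (u i\<^sub>0) \<delta> * norm (integral {x..x + \<delta>} P)"
          using mean_factor_bounds(1)[of "u i\<^sub>0" D \<delta>] u i\<^sub>0 \<delta> by (simp add: R_def mean_diff_def norm_mult)
        also have "\<dots> \<le> \<kappa> * I"
          unfolding I_def \<kappa>_def using mean_factor_bounds[of "u i\<^sub>0" D \<delta>] u i\<^sub>0 \<delta> that
          by (intro mult_mono norm_integral_le_integral_norm cP) auto
        finally show ?thesis .
      qed
      have "norm (R s) \<le> C * integral {0..h+\<delta>} (\<lambda>s. norm (R s))"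
        unfolding R using A u s i\<^sub>0 by (intro C(2)) auto
      also have "integral {0..h+\<delta>} (\<lambda>s. norm (R s)) \<le> integral {0..h+\<delta>} (\<lambda>s. norm (P s) + \<kappa> * I)"
      proof (intro integral_le integrable_continuous_interval continuous_intros cP)
        show "continuous_on {0..h + \<delta>} R" unfolding R by (intro continuous_intros)
        fix x assume "x \<in> {0..h + \<delta>}"
        then show "norm (R x) \<le> norm (P x) + \<kappa> * I"
          using PR[of x] norm_triangle_ineq2[of "R x" "P x"] by (simp add: norm_minus_commute)
      qed
      also have "\<dots> = integral {0..h+\<delta>} (\<lambda>s. norm (P s)) + (h + \<delta>) * (\<kappa> * I)"
        using Suc.prems \<delta> by (subst integral_add) (auto intro!: integrable_continuous_interval continuous_intros cP)
      also have "integral {0..h+\<delta>} (\<lambda>s. norm (P s)) \<le> I"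
        unfolding I_def using \<delta> by (intro integral_subset_le integrable_continuous_interval continuous_intros cP) auto
      finally have "norm (R s) \<le> C * (I + (h + \<delta>) * (\<kappa> * I))" using C by simp
      moreover have "norm (P s) \<le> norm (R s) + \<kappa> * I"
        using PR[of s] s \<delta> norm_triangle_ineq2[of "P s" "R s"] by auto
      ultimately show ?thesis by (simp add: C'_def algebra_simps)
    qed
    then show "norm (esum A b u s) \<le> C' * integral {0..h'} (\<lambda>s. norm (esum A b u s))"
      by (simp add: P_def I_def)
  qed
qed

section \<open>A weighted supremum norm\<close>

text \<open>The growth of a sum of exponentials with exponents in \<open>[c, c']\<close>, at both ends of the real line.
Every such sum is bounded by a multiple of this weight, and a translation by \<open>h > 0\<close> changes the weight by a
factor between \<open>exp (- c' * h)\<close> and \<open>exp (- c * h)\<close>.\<close>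

definition wt :: "real \<Rightarrow> real \<Rightarrow> real \<Rightarrow> real" where
  "wt c c' s = max (exp (- c * s)) (exp (- c' * s))"

lemma wt_pos [simp]: "0 < wt c c' s"
  by (simp add: wt_def less_max_iff_disj)

lemma wt_nonneg [simp]: "0 \<le> wt c c' s"
  by (rule less_imp_le) simp

lemma wt_of_nonneg: "c \<le> c' \<Longrightarrow> 0 \<le> s \<Longrightarrow> wt c c' s = exp (- c * s)"
  by (simp add: wt_def mult_right_mono)

lemma wt_of_nonpos: "c \<le> c' \<Longrightarrow> s \<le> 0 \<Longrightarrow> wt c c' s = exp (- c' * s)"
  by (simp add: wt_def mult_right_mono_neg max_def)

lemma wt_shift_le:
  assumes "c \<le> c'" "h \<ge> 0"
  shows "wt c c' (s + h) \<le> exp (- c * h) * wt c c' s"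
proof -
  have "exp (- c' * (s + h)) = exp (- c' * h) * exp (- c' * s)"
    by (simp add: exp_add[symmetric] algebra_simps)
  also have "\<dots> \<le> exp (- c * h) * exp (- c' * s)"
    using assms by (intro mult_right_mono) (auto simp: mult_right_mono)
  finally show ?thesis
    by (simp add: wt_def max_def exp_add[symmetric] algebra_simps mult_le_cancel_left)
qed

lemma wt_le_shift:
  assumes "c \<le> c'" "h \<ge> 0"
  shows "wt c c' s \<le> exp (c' * h) * wt c c' (s + h)"
proof -
  have "exp (- c * s) = exp (c * h) * exp (- c * (s + h))"
    by (simp add: exp_add[symmetric] algebra_simps)
  also have "\<dots> \<le> exp (c' * h) * exp (- c * (s + h))"
    using assms by (intro mult_right_mono) (auto simp: mult_right_mono)
  finally have 1: "exp (- c * s) \<le> exp (c' * h) * exp (- c * (s + h))" .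
  have "exp (- c' * s) = exp (c' * h) * exp (- c' * (s + h))"
    by (simp add: exp_add[symmetric] algebra_simps)
  then show ?thesis using 1 by (auto simp: wt_def max_def mult_le_cancel_left intro: order_trans)
qed

lemma wt_antimono:
  assumes "0 \<le> c" "c \<le> c'" "x \<le> y"
  shows "wt c c' y \<le> wt c c' x"
proof -
  have "wt c c' (x + (y - x)) \<le> exp (- c * (y - x)) * wt c c' x"
    using assms by (intro wt_shift_le) auto
  also have "\<dots> \<le> 1 * wt c c' x" using assms by (intro mult_right_mono) auto
  finally show ?thesis by simp
qed

lemma exp_le_wt: "c \<le> v \<Longrightarrow> v \<le> c' \<Longrightarrow> exp (- v * s) \<le> wt c c' s"
  by (cases "s \<ge> 0") (auto simp: wt_def le_max_iff_disj mult_right_mono mult_right_mono_neg)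

definition wnorm :: "real \<Rightarrow> real \<Rightarrow> (real \<Rightarrow> complex) \<Rightarrow> real" where
  "wnorm c c' P = (SUP s. norm (P s) / wt c c' s)"

definition wbounded :: "real \<Rightarrow> real \<Rightarrow> (real \<Rightarrow> complex) \<Rightarrow> bool" where
  "wbounded c c' P \<longleftrightarrow> (\<exists>B. \<forall>s. norm (P s) \<le> B * wt c c' s)"

lemma wnorm_bound:
  assumes "wbounded c c' P"
  shows "norm (P s) \<le> wnorm c c' P * wt c c' s"
proof -
  have "norm (P s) / wt c c' s \<le> wnorm c c' P"
    unfolding wnorm_def using assms
    by (intro cSUP_upper) (auto simp: wbounded_def bdd_above_def pos_divide_le_eq)
  then show ?thesis by (simp add: pos_divide_le_eq)
qed

lemma wnorm_least: "(\<And>s. norm (P s) \<le> B * wt c c' s) \<Longrightarrow> wnorm c c' P \<le> B"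
  unfolding wnorm_def by (intro cSUP_least) (auto simp: pos_divide_le_eq)

lemma wboundedI: "(\<And>s. norm (P s) \<le> B * wt c c' s) \<Longrightarrow> wbounded c c' P"
  unfolding wbounded_def by blast

lemma wnorm_nonneg:
  assumes "wbounded c c' P" shows "0 \<le> wnorm c c' P"
proof -
  have "0 \<le> wnorm c c' P * wt c c' 0"
    using wnorm_bound[OF assms, of 0] norm_ge_zero order_trans by blast
  then show ?thesis using wt_pos[of c c' 0] by (simp add: zero_le_mult_iff)
qed

lemma esum_wt_bound:
  assumes "\<And>i. i \<in> A \<Longrightarrow> c \<le> u i \<and> u i \<le> c'"
  shows "norm (esum A b u s) \<le> (\<Sum>i\<in>A. norm (b i)) * wt c c' s"
proof -
  have "norm (esum A b u s) \<le> (\<Sum>i\<in>A. norm (b i) * exp (- u i * s))"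
    unfolding esum_def by (rule order_trans[OF norm_sum]) (simp add: norm_mult)
  also have "\<dots> \<le> (\<Sum>i\<in>A. norm (b i) * wt c c' s)"
    using assms by (intro sum_mono mult_left_mono exp_le_wt) auto
  finally show ?thesis by (simp add: sum_distrib_right)
qed

lemma fwd_diff_wt_bound:
  assumes c: "0 \<le> c" "c \<le> c'" and "h \<ge> 0" "\<theta> \<ge> 0" and P: "\<And>s. norm (P s) \<le> B * wt c c' s"
  shows "norm (fwd_diff h \<theta> P s) \<le> 2 * B * wt c c' s"
proof -
  have "0 \<le> B * wt c c' 0" using P[of 0] norm_ge_zero order_trans by blast
  then have B: "B \<ge> 0" using wt_pos[of c c' 0] by (simp add: zero_le_mult_iff)
  have "norm (fwd_diff h \<theta> P s) \<le> norm (P (s + h)) + exp (- \<theta> * h) * norm (P s)"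
    unfolding fwd_diff_def by (rule order_trans[OF norm_triangle_ineq4]) (simp add: norm_mult)
  also have "\<dots> \<le> B * wt c c' s + 1 * (B * wt c c' s)"
  proof (intro add_mono mult_mono P)
    have "norm (P (s + h)) \<le> B * wt c c' (s + h)" by (rule P)
    also have "\<dots> \<le> B * wt c c' s" using c \<open>h \<ge> 0\<close> B by (intro mult_left_mono wt_antimono) auto
    finally show "norm (P (s + h)) \<le> B * wt c c' s" .
  qed (use assms B in auto)
  finally show ?thesis by simp
qed

lemma wbounded_fwd_diff:
  assumes "0 \<le> c" "c \<le> c'" "h \<ge> 0" "\<theta> \<ge> 0" "wbounded c c' P"
  shows "wbounded c c' (fwd_diff h \<theta> P)"
  using fwd_diff_wt_bound[OF assms(1-4) wnorm_bound[OF assms(5)]] by (rule wboundedI)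

section \<open>Exponential sums with a bounded number of exponents of comparable size\<close>

text \<open>All constants depend on \<open>c\<close>, \<open>\<gamma>\<close> and \<open>D\<close> and the number of exponents, but not on the exponents. These lie
between \<open>c\<close> and \<open>c' \<le> D\<close>, at a distance of at least \<open>\<gamma>\<close> from both. The upper
rate \<open>c'\<close> is not a parameter, as it will depend on the cluster.\<close>

locale window =
  fixes c \<gamma> D :: real
  assumes c: "0 < c" and \<gamma>: "0 < \<gamma>" "c + \<gamma> \<le> 1" and D: "1 \<le> D"
begin

definition admissible :: "nat \<Rightarrow> nat set \<Rightarrow> (nat \<Rightarrow> real) \<Rightarrow> real \<Rightarrow> bool" where
  "admissible d A u c' \<longleftrightarrow> finite A \<and> card A \<le> d \<and> 1 \<le> c' \<and> c' \<le> D \<and> (\<forall>i\<in>A. 1 \<le> u i \<and> u i + \<gamma> \<le> c')"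

lemma admissible_c_le: "admissible d A u c' \<Longrightarrow> 0 \<le> c" "admissible d A u c' \<Longrightarrow> c \<le> c'"
  using c \<gamma> by (auto simp: admissible_def)

lemma admissible_exponent:
  assumes "admissible d A u c'" "i \<in> A"
  shows "c + \<gamma> \<le> u i" "1 \<le> u i" "u i + \<gamma> \<le> c'" "u i \<le> D"
  using assms \<gamma> by (auto simp: admissible_def)

lemma admissible_remove: "admissible (Suc d) A u c' \<Longrightarrow> i \<in> A \<Longrightarrow> admissible d (A - {i}) u c'"
  by (auto simp: admissible_def)

lemma wbounded_esum: "admissible d A u c' \<Longrightarrow> wbounded c c' (esum A b u)"
  using c \<gamma> by (intro wboundedI[of _ "\<Sum>i\<in>A. norm (b i)"] esum_wt_bound) (force simp: admissible_def)

text \<open>A sum of \<open>d\<close> exponentials is controlled everywhere by its values on a short interval. Induction on \<open>d\<close>: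
a difference removes the exponent \<open>v\<close>, and the recursion \<open>P (s + \<eta>) = exp (- v * \<eta>) * P s + Q s\<close> propagates the
bound from the interval to the right and to the left. In both directions the recursion is a contraction
with respect to the weight, because \<open>v\<close> keeps the distance \<open>\<gamma>\<close> from \<open>c\<close> and \<open>c'\<close>.\<close>

lemma esum_wnorm_le_sup:
  "0 < h \<Longrightarrow> \<exists>C>0. \<forall>A b u c' a. admissible d A u c' \<longrightarrow> a \<ge> 0 \<longrightarrow> (\<forall>s\<in>{0..h}. norm (esum A b u s) \<le> a) \<longrightarrow>
     wnorm c c' (esum A b u) \<le> C * a"
proof (induction d arbitrary: h)
  case 0
  show ?case by (intro exI[of _ 1]) (auto simp: admissible_def esum_def intro!: wnorm_least)
next
  case (Suc d)
  define \<eta> where "\<eta> = h / 2"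
  have \<eta>: "\<eta> > 0" "\<eta> + \<eta> = h" using Suc.prems by (auto simp: \<eta>_def)
  obtain C where C: "C > 0" "\<And>A b u c' a. admissible d A u c' \<Longrightarrow> a \<ge> 0 \<Longrightarrow> (\<forall>s\<in>{0..\<eta>}. norm (esum A b u s) \<le> a) \<Longrightarrow>
     wnorm c c' (esum A b u) \<le> C * a"
    using Suc.IH[OF \<eta>(1)] by blast
  define t where "t = exp (- \<gamma> * \<eta>)"
  have t: "0 < t" "t < 1" using \<eta> \<gamma> by (auto simp: t_def)
  define E where "E = exp (c * h) + exp (c * \<eta>) * (2 * C) + exp (D * \<eta>) * (1 + 2 * C)"
  have E: "exp (c * h) \<le> E" "exp (c * \<eta>) * (2 * C) \<le> E" "exp (D * \<eta>) * (1 + 2 * C) \<le> E"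
      "exp (D * \<eta>) * (2 * C) \<le> E" "E > 0"
    using C by (auto simp: E_def algebra_simps add_increasing add_increasing2 add_pos_pos)
  show ?case
  proof (intro exI[of _ "E / (1 - t)"] conjI allI impI)
    show "E / (1 - t) > 0" using E t by simp
    fix A b u c' a assume admissible: "admissible (Suc d) A u c'" and a: "a \<ge> 0"
      and P': "\<forall>s\<in>{0..h}. norm (esum A b u s) \<le> a"
    note c_le = admissible_c_le[OF admissible]
    define P where "P = esum A b u"
    have Pa: "norm (P s) \<le> a" if "s \<in> {0..h}" for s using P' that by (simp add: P_def)
    define N where "N = wnorm c c' P"
    have wb: "wbounded c c' P" unfolding P_def using admissible by (rule wbounded_esum)
    have N: "norm (P s) \<le> N * wt c c' s" for s unfolding N_def using wb by (rule wnorm_bound)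
    have N0: "N \<ge> 0" unfolding N_def using wb by (rule wnorm_nonneg)
    show "wnorm c c' (esum A b u) \<le> E / (1 - t) * a"
    proof (cases "A = {}")
      case True
      then have "N \<le> 0" unfolding N_def P_def by (intro wnorm_least) (simp add: esum_def)
      also have "0 \<le> E / (1 - t) * a" using E t a by simp
      finally show ?thesis by (simp add: N_def P_def)
    next
      case False
      then obtain i\<^sub>0 where i\<^sub>0: "i\<^sub>0 \<in> A" by auto
      define v where "v = u i\<^sub>0"
      have v: "1 \<le> v" "v \<le> D" "c + \<gamma> \<le> v" "v + \<gamma> \<le> c'"
        using admissible_exponent[OF admissible i\<^sub>0] by (simp_all add: v_def)
      define Q where "Q = fwd_diff \<eta> v P"
      obtain b' where Q: "Q = esum (A - {i\<^sub>0}) b' u"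
        using fwd_diff_esum_remove[of A i\<^sub>0 \<eta> u b] admissible i\<^sub>0 by (auto simp: admissible_def Q_def P_def v_def)
      have Q_eq: "P (s + \<eta>) = complex_of_real (exp (- v * \<eta>)) * P s + Q s" for s
        by (simp add: Q_def fwd_diff_def)
      have "wnorm c c' Q \<le> C * (2 * a)"
        unfolding Q
      proof (intro C(2) admissible_remove[OF admissible i\<^sub>0] ballI)
        fix s assume s: "s \<in> {0..\<eta>}"
        have "norm (Q s) \<le> norm (P (s + \<eta>)) + exp (- v * \<eta>) * norm (P s)"
          unfolding Q_def fwd_diff_def by (rule order_trans[OF norm_triangle_ineq4]) (simp add: norm_mult)
        also have "\<dots> \<le> a + 1 * a"
          using s \<eta> v a by (intro add_mono mult_mono Pa) auto
        finally show "norm (esum (A - {i\<^sub>0}) b' u s) \<le> 2 * a" by (simp add: Q)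
      qed (use a in auto)
      then have NQ: "wnorm c c' Q \<le> 2 * C * a" by simp
      have wQ: "wbounded c c' Q" unfolding Q using admissible_remove[OF admissible i\<^sub>0] by (rule wbounded_esum)
      have Qb: "norm (Q s) \<le> 2 * C * a * wt c c' s" for s
        using wnorm_bound[OF wQ, of s] mult_right_mono[OF NQ wt_nonneg, of c c' s] by linarith
      have main: "norm (P s) \<le> (t * N + E * a) * wt c c' s" for s
      proof -
        consider "s \<in> {0..h}" | "s > h" | "s < 0" "s + \<eta> \<le> 0" | "s < 0" "s + \<eta> > 0"
          using \<eta> by fastforce
        then show ?thesis
        proof cases
          case 1
          have "1 \<le> exp (c * h) * exp (- c * s)"
            using 1 c by (simp add: exp_add[symmetric] mult_left_mono flip: exp_zero)
          also have "exp (- c * s) = wt c c' s" using 1 c_le by (simp add: wt_of_nonneg)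
          finally have "1 \<le> exp (c * h) * wt c c' s" .
          then have "a * 1 \<le> a * (exp (c * h) * wt c c' s)" using a by (intro mult_left_mono) auto
          also have "\<dots> \<le> a * (E * wt c c' s)" using a E by (intro mult_left_mono mult_right_mono) auto
          finally have "norm (P s) \<le> E * a * wt c c' s" using Pa[OF 1] by (simp add: mult_ac)
          also have "\<dots> \<le> (t * N + E * a) * wt c c' s"
            using t N0 by (intro mult_right_mono) auto
          finally show ?thesis .
        next
          case 2
          have w: "wt c c' (s - \<eta>) = exp (c * \<eta>) * wt c c' s"
            using 2 \<eta> c_le by (simp add: wt_of_nonneg exp_add[symmetric] algebra_simps)
          have "norm (P s) \<le> exp (- v * \<eta>) * norm (P (s - \<eta>)) + norm (Q (s - \<eta>))"
            using Q_eq[of "s - \<eta>"] norm_triangle_ineq[of "complex_of_real (exp (- v * \<eta>)) * P (s - \<eta>)" "Q (s - \<eta>)"]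
            by (simp add: norm_mult)
          also have "\<dots> \<le> exp (- v * \<eta>) * (N * wt c c' (s - \<eta>)) + 2 * C * a * wt c c' (s - \<eta>)"
            by (intro add_mono mult_left_mono N Qb) auto
          also have "\<dots> = (exp ((c - v) * \<eta>) * N + exp (c * \<eta>) * (2 * C) * a) * wt c c' s"
            unfolding w by (simp add: exp_add exp_diff exp_minus field_simps)
          also have "\<dots> \<le> (t * N + E * a) * wt c c' s"
          proof (intro mult_right_mono add_mono)
            show "exp ((c - v) * \<eta>) \<le> t" using v \<eta> unfolding t_def exp_le_cancel_iff
              by (intro mult_right_mono) auto
          qed (use N0 E a in auto)
          finally show ?thesis .
        next
          case 3
          have w: "wt c c' (s + \<eta>) = exp (- c' * \<eta>) * wt c c' s"
            using 3 c_le by (simp add: wt_of_nonpos exp_add[symmetric] algebra_simps)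
          have "P s = complex_of_real (exp (v * \<eta>)) * (P (s + \<eta>) - Q s)"
            by (simp add: Q_eq exp_minus flip: of_real_mult mult.assoc exp_add)
          then have "norm (P s) \<le> exp (v * \<eta>) * (norm (P (s + \<eta>)) + norm (Q s))"
            using norm_triangle_ineq4[of "P (s + \<eta>)" "Q s"] by (simp add: norm_mult)
          also have "\<dots> \<le> exp (v * \<eta>) * (N * wt c c' (s + \<eta>) + 2 * C * a * wt c c' s)"
            by (intro add_mono mult_left_mono N Qb) auto
          also have "\<dots> = (exp ((v - c') * \<eta>) * N + exp (v * \<eta>) * (2 * C) * a) * wt c c' s"
            unfolding w by (simp add: exp_add exp_diff exp_minus field_simps)
          also have "\<dots> \<le> (t * N + E * a) * wt c c' s"
          proof (intro mult_right_mono add_mono)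
            show "exp ((v - c') * \<eta>) \<le> t" using v \<eta> unfolding t_def exp_le_cancel_iff
              by (intro mult_right_mono) auto
            have "exp (v * \<eta>) * (2 * C) \<le> exp (D * \<eta>) * (2 * C)"
              using v \<eta> C by (intro mult_right_mono) auto
            then show "exp (v * \<eta>) * (2 * C) \<le> E" using E by linarith
          qed (use N0 E a in auto)
          finally show ?thesis .
        next
          case 4
          have w: "1 \<le> wt c c' s" using 4 c_le by (simp add: wt_of_nonpos mult_nonneg_nonpos)
          have "P s = complex_of_real (exp (v * \<eta>)) * (P (s + \<eta>) - Q s)"
            by (simp add: Q_eq exp_minus flip: of_real_mult mult.assoc exp_add)
          then have "norm (P s) \<le> exp (v * \<eta>) * (norm (P (s + \<eta>)) + norm (Q s))"
            using norm_triangle_ineq4[of "P (s + \<eta>)" "Q s"] by (simp add: norm_mult)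
          also have "\<dots> \<le> exp (D * \<eta>) * (a * wt c c' s + 2 * C * a * wt c c' s)"
          proof (intro mult_mono add_mono Qb)
            have "norm (P (s + \<eta>)) \<le> a" using 4 \<eta> by (intro Pa) auto
            also have "\<dots> \<le> a * wt c c' s" using w a by (simp add: mult_le_cancel_left1)
            finally show "norm (P (s + \<eta>)) \<le> a * wt c c' s" .
          qed (use v \<eta> in auto)
          also have "\<dots> = exp (D * \<eta>) * (1 + 2 * C) * a * wt c c' s" by (simp add: algebra_simps)
          also have "\<dots> \<le> E * a * wt c c' s" using E a by (intro mult_right_mono) auto
          also have "\<dots> \<le> (t * N + E * a) * wt c c' s"
            using t N0 by (intro mult_right_mono) auto
          finally show ?thesis .
        qed
      qed
      have "N \<le> t * N + E * a" unfolding N_def by (rule wnorm_least) (use main in \<open>simp add: N_def\<close>)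
      then have "N * (1 - t) \<le> E * a" by (simp add: algebra_simps)
      then have "N \<le> E / (1 - t) * a" using t by (simp add: field_simps)
      then show ?thesis by (simp add: N_def P_def)
    qed
  qed
qed


text \<open>A Bernstein inequality in terms of increments. Again by induction on the number of exponents: \<open>mean_diff\<close>
removes one of them, and the increments of a mean are visibly small.\<close>

lemma esum_increment_le:
  "\<exists>C\<ge>1. \<forall>A b u c' \<rho> s. admissible d A u c' \<longrightarrow> \<rho> \<ge> 0 \<longrightarrow>
     norm (esum A b u (s + \<rho>) - esum A b u s) \<le> C * \<rho> * wnorm c c' (esum A b u) * wt c c' s"
proof (induction d)
  case 0
  show ?case
    by (intro exI[of _ 1]) (auto simp: admissible_def esum_def intro!: mult_nonneg_nonneg wnorm_nonneg wboundedI[of _ 0])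
next
  case (Suc d)
  define \<kappa> where "\<kappa> = exp D"
  obtain C where C: "C \<ge> 1" "\<And>A b u c' \<rho> s. admissible d A u c' \<Longrightarrow> \<rho> \<ge> 0 \<Longrightarrow>
     norm (esum A b u (s + \<rho>) - esum A b u s) \<le> C * \<rho> * wnorm c c' (esum A b u) * wt c c' s"
    using Suc.IH by blast
  define C' where "C' = C * (1 + \<kappa>) + 2 * \<kappa>"
  have "C * 1 \<le> C * (1 + \<kappa>)" using C by (intro mult_left_mono) (auto simp: \<kappa>_def)
  moreover have "\<kappa> \<ge> 0" by (simp add: \<kappa>_def)
  ultimately have C': "C' \<ge> 1" using C unfolding C'_def by linarith
  show ?case
  proof (intro exI[of _ C'] conjI allI impI C')
    fix A b u c' \<rho> s assume admissible: "admissible (Suc d) A u c'" and \<rho>: "(\<rho>::real) \<ge> 0"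
    note c_le = admissible_c_le[OF admissible]
    define P where "P = esum A b u"
    define N where "N = wnorm c c' P"
    have wb: "wbounded c c' P" unfolding P_def using admissible by (rule wbounded_esum)
    have N: "norm (P s) \<le> N * wt c c' s" for s unfolding N_def using wb by (rule wnorm_bound)
    have N0: "N \<ge> 0" unfolding N_def using wb by (rule wnorm_nonneg)
    have cP: "continuous_on X P" for X unfolding P_def by (intro continuous_intros)
    have iP: "P integrable_on {x..y}" for x y unfolding P_def by (rule integrable_esum)
    have int_le: "norm (integral {x..x + h} P) \<le> h * (N * wt c c' y)" if "h \<ge> 0" "y \<le> x" for x y h
    proof -
      have "norm (integral {x..x + h} P) \<le> (N * wt c c' y) * (x + h - x)"
      proof (rule integral_bound)
        fix t assume "t \<in> {x..x + h}"
        then have "wt c c' t \<le> wt c c' y" using c_le that by (intro wt_antimono) auto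
        then show "norm (P t) \<le> N * wt c c' y" using N[of t] mult_left_mono[OF _ N0] by fastforce
      qed (use that cP in auto)
      then show ?thesis by (simp add: mult.commute)
    qed
    have "norm (P (s + \<rho>) - P s) \<le> C' * \<rho> * N * wt c c' s"
    proof (cases "A = {}")
      case True
      have "0 \<le> C' * \<rho> * N * wt c c' s" using C' \<rho> N0 by simp
      then show ?thesis using True by (simp add: P_def esum_def)
    next
      case False
      then obtain i\<^sub>0 where i\<^sub>0: "i\<^sub>0 \<in> A" by auto
      define v where "v = u i\<^sub>0"
      have v: "1 \<le> v" "v \<le> D" using admissible_exponent[OF admissible i\<^sub>0] by (simp_all add: v_def)
      define k where "k = mean_factor v 1"
      have k: "0 < k" "k \<le> \<kappa>" using mean_factor_bounds[of v D 1] v by (auto simp: k_def \<kappa>_def)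
      define R where "R = mean_diff 1 v P"
      obtain b' where R: "R = esum (A - {i\<^sub>0}) b' u"
        using mean_diff_esum_remove[of A i\<^sub>0 u 1 b] admissible i\<^sub>0 unfolding R_def P_def v_def admissible_def by force
      have P_eq: "P x = R x + complex_of_real k * integral {x..x + 1} P" for x
        by (simp add: R_def mean_diff_def k_def)
      have "norm (R x) \<le> (1 + \<kappa>) * N * wt c c' x" for x
      proof -
        have "norm (R x) \<le> norm (P x) + k * norm (integral {x..x + 1} P)"
          using P_eq[of x] k norm_triangle_ineq4[of "P x" "complex_of_real k * integral {x..x + 1} P"]
          by (simp add: norm_mult)
        also have "\<dots> \<le> N * wt c c' x + \<kappa> * (1 * (N * wt c c' x))"
          using k by (intro add_mono N mult_mono int_le) auto
        finally show ?thesis by (simp add: algebra_simps)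
      qed
      then have wR: "wnorm c c' R \<le> (1 + \<kappa>) * N" by (intro wnorm_least)
      have "norm (R (s + \<rho>) - R s) \<le> C * \<rho> * wnorm c c' R * wt c c' s"
        unfolding R using admissible_remove[OF admissible i\<^sub>0] \<rho> by (rule C(2))
      also have "\<dots> \<le> C * \<rho> * ((1 + \<kappa>) * N) * wt c c' s"
        using C \<rho> wR by (intro mult_right_mono mult_left_mono) auto
      finally have 1: "norm (R (s + \<rho>) - R s) \<le> C * \<rho> * ((1 + \<kappa>) * N) * wt c c' s" .
      have "integral {s..s + \<rho>} P + integral {s + \<rho>..s + \<rho> + 1} P = integral {s..s + \<rho> + 1} P"
        using \<rho> by (intro Henstock_Kurzweil_Integration.integral_combine iP) auto
      moreover have "integral {s..s + 1} P + integral {s + 1..s + \<rho> + 1} P = integral {s..s + \<rho> + 1} P"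
        using \<rho> by (intro Henstock_Kurzweil_Integration.integral_combine iP) auto
      ultimately have I: "integral {s + \<rho>..s + \<rho> + 1} P - integral {s..s + 1} P =
          integral {s + 1..(s + 1) + \<rho>} P - integral {s..s + \<rho>} P"
        by (simp add: algebra_simps)
      have "norm (integral {s + \<rho>..s + \<rho> + 1} P - integral {s..s + 1} P) \<le> \<rho> * (N * wt c c' s) + \<rho> * (N * wt c c' s)"
        unfolding I using \<rho> by (intro order_trans[OF norm_triangle_ineq4] add_mono int_le) auto
      then have "k * norm (integral {s + \<rho>..s + \<rho> + 1} P - integral {s..s + 1} P) \<le> \<kappa> * (\<rho> * (N * wt c c' s) + \<rho> * (N * wt c c' s))"
        using k by (intro mult_mono) auto
      moreover have "P (s + \<rho>) - P s = (R (s + \<rho>) - R s)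
          + complex_of_real k * (integral {s + \<rho>..s + \<rho> + 1} P - integral {s..s + 1} P)"
        by (simp only: P_eq[of "s + \<rho>"] P_eq[of s] right_diff_distrib) simp
      ultimately have "norm (P (s + \<rho>) - P s) \<le>
          C * \<rho> * ((1 + \<kappa>) * N) * wt c c' s + \<kappa> * (\<rho> * (N * wt c c' s) + \<rho> * (N * wt c c' s))"
        using 1 k norm_triangle_ineq[of "R (s + \<rho>) - R s"
            "complex_of_real k * (integral {s + \<rho>..s + \<rho> + 1} P - integral {s..s + 1} P)"]
        by (simp add: norm_mult)
      also have "\<dots> = C' * \<rho> * N * wt c c' s" by (simp add: C'_def algebra_simps)
      finally show ?thesis .
    qed
    then show "norm (esum A b u (s + \<rho>) - esum A b u s) \<le> C' * \<rho> * wnorm c c' (esum A b u) * wt c c' s"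
      by (simp add: P_def N_def)
  qed
qed

text \<open>A difference with \<open>\<theta>\<close> outside \<open>[c, c']\<close> is invertible for the weighted norm. For small \<open>\<theta>\<close> solve
\<open>Q s = P (s + 1) - exp (- \<theta>) * P s\<close> for \<open>P s\<close>, for large \<open>\<theta>\<close> solve it for \<open>P (s + 1)\<close>. Either
way, the remaining term with \<open>P\<close> has norm at most \<open>exp (- \<gamma>)\<close> times the norm of \<open>P\<close> and can be absorbed.\<close>

lemma wnorm_le_fwd_diff:
  "\<exists>C\<ge>1. \<forall>P \<theta> c'. c \<le> c' \<longrightarrow> c' \<le> D \<longrightarrow> wbounded c c' P \<longrightarrow> 0 \<le> \<theta> \<longrightarrow> \<theta> + \<gamma> \<le> c \<or> c' + \<gamma> \<le> \<theta> \<longrightarrow>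
    wnorm c c' P \<le> C * wnorm c c' (fwd_diff 1 \<theta> P)"
proof -
  define C where "C = exp D / (1 - exp (- \<gamma>))"
  have pos: "1 - exp (- \<gamma>) > 0" using \<gamma> by auto
  then have C: "C > 0" by (auto simp: C_def)
  show ?thesis
  proof (intro exI[of _ "max 1 C"] conjI allI impI)
    fix P \<theta> c' assume c': "c \<le> c'" "c' \<le> D" and wb: "wbounded c c' P"
      and \<theta>: "0 \<le> \<theta>" "\<theta> + \<gamma> \<le> c \<or> c' + \<gamma> \<le> (\<theta>::real)"
    have c_le: "0 \<le> c" "c \<le> c'" using c c' by auto
    define N where "N = wnorm c c' P"
    define Q where "Q = fwd_diff 1 \<theta> P"
    have N: "norm (P s) \<le> N * wt c c' s" for s unfolding N_def using wb by (rule wnorm_bound)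
    have N0: "N \<ge> 0" unfolding N_def using wb by (rule wnorm_nonneg)
    have wQ: "wbounded c c' Q"
      unfolding Q_def using c_le \<theta> wb by (intro wbounded_fwd_diff) auto
    define M where "M = wnorm c c' Q"
    have M: "norm (Q s) \<le> M * wt c c' s" for s unfolding M_def using wQ by (rule wnorm_bound)
    have M0: "M \<ge> 0" unfolding M_def using wQ by (rule wnorm_nonneg)
    have step: "N \<le> C * M" if "\<And>s. norm (P s) \<le> (exp (- \<gamma>) * N + exp D * M) * wt c c' s"
    proof -
      have "N \<le> exp (- \<gamma>) * N + exp D * M" unfolding N_def by (rule wnorm_least) (use that in \<open>simp add: N_def\<close>)
      then have "N * (1 - exp (- \<gamma>)) \<le> exp D * M" by (simp add: algebra_simps)
      then show "N \<le> C * M" using pos by (simp add: C_def pos_le_divide_eq)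
    qed
    have "N \<le> C * M"
    proof (cases "\<theta> + \<gamma> \<le> c")
      case True
      have "norm (P s) \<le> (exp (- \<gamma>) * N + exp D * M) * wt c c' s" for s
      proof -
        have "P s = complex_of_real (exp \<theta>) * (P (s + 1) - Q s)"
          by (simp add: Q_def fwd_diff_def exp_minus flip: of_real_mult mult.assoc exp_add)
        then have "norm (P s) \<le> exp \<theta> * (norm (P (s + 1)) + norm (Q s))"
          using norm_triangle_ineq4[of "P (s + 1)" "Q s"] by (simp add: norm_mult)
        also have "\<dots> \<le> exp \<theta> * (N * (exp (- c * 1) * wt c c' s) + M * wt c c' s)"
        proof (intro mult_left_mono add_mono M)
          have "norm (P (s + 1)) \<le> N * wt c c' (s + 1)" by (rule N)
          also have "\<dots> \<le> N * (exp (- c * 1) * wt c c' s)"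
            using c_le N0 by (intro mult_left_mono wt_shift_le) auto
          finally show "norm (P (s + 1)) \<le> N * (exp (- c * 1) * wt c c' s)" .
        qed auto
        also have "\<dots> = (exp (\<theta> - c) * N + exp \<theta> * M) * wt c c' s"
          by (simp add: exp_diff exp_minus field_simps)
        also have "\<dots> \<le> (exp (- \<gamma>) * N + exp D * M) * wt c c' s"
          using True \<gamma> D N0 M0 by (intro mult_right_mono add_mono) auto
        finally show ?thesis .
      qed
      then show ?thesis by (rule step)
    next
      case False
      then have \<theta>': "c' + \<gamma> \<le> \<theta>" using \<theta> by auto
      have "norm (P s) \<le> (exp (- \<gamma>) * N + exp D * M) * wt c c' s" for s
      proof -
        have "P s = complex_of_real (exp (- \<theta>)) * P (s - 1) + Q (s - 1)"
          by (simp add: Q_def fwd_diff_def)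
        then have "norm (P s) \<le> exp (- \<theta>) * norm (P (s - 1)) + norm (Q (s - 1))"
          using norm_triangle_ineq[of "complex_of_real (exp (- \<theta>)) * P (s - 1)" "Q (s - 1)"]
          by (simp add: norm_mult)
        also have "\<dots> \<le> exp (- \<theta>) * (N * (exp c' * wt c c' s)) + M * (exp c' * wt c c' s)"
        proof -
          have w: "wt c c' (s - 1) \<le> exp c' * wt c c' s"
            using wt_le_shift[OF c_le(2), of 1 "s - 1"] by simp
          show ?thesis using N0 M0 N[of "s - 1"] M[of "s - 1"] mult_left_mono[OF w N0] mult_left_mono[OF w M0]
            by (intro add_mono mult_mono) auto
        qed
        also have "\<dots> = (exp (c' - \<theta>) * N + exp c' * M) * wt c c' s"
          by (simp add: exp_diff exp_minus field_simps)
        also have "\<dots> \<le> (exp (- \<gamma>) * N + exp D * M) * wt c c' s"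
          using \<theta>' c' N0 M0 by (intro mult_right_mono add_mono) auto
        finally show ?thesis .
      qed
      then show ?thesis by (rule step)
    qed
    also have "\<dots> \<le> max 1 C * M" using M0 by (intro mult_right_mono) auto
    finally show "wnorm c c' P \<le> max 1 C * wnorm c c' (fwd_diff 1 \<theta> P)"
      by (simp add: N_def M_def Q_def)
  qed auto
qed

end

section \<open>Iterated differences\<close>

fun diffs :: "real \<Rightarrow> real list \<Rightarrow> (real \<Rightarrow> complex) \<Rightarrow> real \<Rightarrow> complex" where
  "diffs h [] P = P"
| "diffs h (\<theta> # \<theta>s) P = diffs h \<theta>s (fwd_diff h \<theta> P)"

lemma diffs_esum:
  "diffs h \<theta>s (esum A b u) =
    esum A (\<lambda>i. b i * complex_of_real (\<Prod>\<theta>\<leftarrow>\<theta>s. exp (- u i * h) - exp (- \<theta> * h))) u"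
  by (induction \<theta>s arbitrary: b) (simp_all add: fwd_diff_esum mult_ac)

lemma diffs_append: "diffs h (xs @ ys) P = diffs h ys (diffs h xs P)"
  by (induction xs arbitrary: P) auto

lemma fwd_diff_rescale:
  "\<beta> \<noteq> 0 \<Longrightarrow> fwd_diff h \<theta> (\<lambda>s. P (\<alpha> + \<beta> * s)) = (\<lambda>s. fwd_diff (\<beta> * h) (\<theta> / \<beta>) P (\<alpha> + \<beta> * s))"
  by (rule ext) (simp add: fwd_diff_def algebra_simps)

lemma diffs_rescale:
  assumes "\<beta> \<noteq> 0"
  shows "diffs h \<theta>s (\<lambda>s. P (\<alpha> + \<beta> * s)) s = diffs (\<beta> * h) (map (\<lambda>\<theta>. \<theta> / \<beta>) \<theta>s) P (\<alpha> + \<beta> * s)"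
  using assms by (induction \<theta>s arbitrary: P) (simp_all add: fwd_diff_rescale)

lemma continuous_on_fwd_diff:
  "continuous_on UNIV P \<Longrightarrow> continuous_on UNIV (fwd_diff h \<theta> P)"
  unfolding fwd_diff_def
  by (intro continuous_intros) (auto intro!: continuous_intros continuous_on_compose2[where f = "\<lambda>x. x + h"])

lemma continuous_on_diffs:
  "continuous_on UNIV P \<Longrightarrow> continuous_on UNIV (diffs h \<theta>s P)"
  by (induction \<theta>s arbitrary: P) (simp_all add: continuous_on_fwd_diff)

lemma diffs_wt_bound:
  assumes c: "0 \<le> c" "c \<le> c'" and "h \<ge> 0" and "\<forall>\<theta>\<in>set \<theta>s. \<theta> \<ge> 0"
    and P: "\<And>s. norm (P s) \<le> B * wt c c' s"
  shows "norm (diffs h \<theta>s P s) \<le> 2 ^ length \<theta>s * B * wt c c' s"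
  using assms(4-)
proof (induction \<theta>s arbitrary: P B)
  case (Cons \<theta> \<theta>s)
  have "norm (diffs h \<theta>s (fwd_diff h \<theta> P) s) \<le> 2 ^ length \<theta>s * (2 * B) * wt c c' s"
    using Cons.prems c \<open>h \<ge> 0\<close> by (intro Cons.IH fwd_diff_wt_bound) auto
  then show ?case by (simp add: mult_ac)
qed simp

lemma integral_norm_fwd_diff_le:
  assumes P: "continuous_on UNIV P" and "\<theta> \<ge> 0" "T \<ge> 0"
  shows "integral {0..T} (\<lambda>s. norm (fwd_diff 1 \<theta> P s)) \<le> 2 * integral {0..T + 1} (\<lambda>s. norm (P s))"
proof -
  have cP: "continuous_on X P" for X using P continuous_on_subset by blast
  have cP1: "continuous_on X (\<lambda>s. P (s + 1))" for X
    by (rule continuous_on_compose2[OF P]) (auto intro: continuous_intros)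
  have cQ: "continuous_on X (fwd_diff 1 \<theta> P)" for X
    using continuous_on_fwd_diff[OF P] continuous_on_subset by blast
  have "integral {0..T} (\<lambda>s. norm (fwd_diff 1 \<theta> P s)) \<le> integral {0..T} (\<lambda>s. norm (P (s + 1)) + norm (P s))"
  proof (intro integral_le integrable_continuous_interval continuous_intros cP cP1 cQ)
    fix s
    have "norm (fwd_diff 1 \<theta> P s) \<le> norm (P (s + 1)) + exp (- \<theta>) * norm (P s)"
      unfolding fwd_diff_def by (rule order_trans[OF norm_triangle_ineq4]) (simp add: norm_mult)
    also have "\<dots> \<le> norm (P (s + 1)) + 1 * norm (P s)"
      using assms by (intro add_mono mult_right_mono) auto
    finally show "norm (fwd_diff 1 \<theta> P s) \<le> norm (P (s + 1)) + norm (P s)" by simp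
  qed
  also have "\<dots> = integral {0..T} (\<lambda>s. norm (P (s + 1))) + integral {0..T} (\<lambda>s. norm (P s))"
    by (intro integral_add integrable_continuous_interval continuous_intros cP cP1)
  also have "integral {0..T} (\<lambda>s. norm (P (s + 1))) = integral {1..T + 1} (\<lambda>s. norm (P s))"
    using integral_shift[of 0 1 T "\<lambda>s. norm (P s)"] cP by (simp add: continuous_on_norm o_def)
  also have "\<dots> \<le> integral {0..T + 1} (\<lambda>s. norm (P s))"
    using assms by (intro integral_subset_le integrable_continuous_interval continuous_intros cP) auto
  also have "integral {0..T} (\<lambda>s. norm (P s)) \<le> integral {0..T + 1} (\<lambda>s. norm (P s))"
    using assms by (intro integral_subset_le integrable_continuous_interval continuous_intros cP) auto
  finally show ?thesis by simp
qed

lemma integral_norm_diffs_le: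
  assumes "continuous_on UNIV P" and "\<forall>\<theta>\<in>set \<theta>s. \<theta> \<ge> 0" and "T \<ge> 0"
  shows "integral {0..T} (\<lambda>s. norm (diffs 1 \<theta>s P s)) \<le>
    2 ^ length \<theta>s * integral {0..T + real (length \<theta>s)} (\<lambda>s. norm (P s))"
  using assms(1,2)
proof (induction \<theta>s arbitrary: P)
  case (Cons \<theta> \<theta>s)
  have "integral {0..T} (\<lambda>s. norm (diffs 1 \<theta>s (fwd_diff 1 \<theta> P) s)) \<le>
    2 ^ length \<theta>s * integral {0..T + real (length \<theta>s)} (\<lambda>s. norm (fwd_diff 1 \<theta> P s))"
    using Cons.prems by (intro Cons.IH continuous_on_fwd_diff) auto
  also have "\<dots> \<le> 2 ^ length \<theta>s * (2 * integral {0..T + real (length \<theta>s) + 1} (\<lambda>s. norm (P s)))"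
    using Cons.prems \<open>T \<ge> 0\<close> by (intro mult_left_mono integral_norm_fwd_diff_le) auto
  finally show ?case by (simp add: add_ac)
qed simp

context window
begin

lemma wnorm_le_diffs:
  assumes C: "C \<ge> 1" "\<And>P \<theta>. wbounded c c' P \<Longrightarrow> 0 \<le> \<theta> \<Longrightarrow> \<theta> + \<gamma> \<le> c \<or> c' + \<gamma> \<le> \<theta> \<Longrightarrow>
      wnorm c c' P \<le> C * wnorm c c' (fwd_diff 1 \<theta> P)"
    and c_le: "0 \<le> c" "c \<le> c'"
    and "wbounded c c' P" and "\<forall>\<theta>\<in>set \<theta>s. 0 \<le> \<theta> \<and> (\<theta> + \<gamma> \<le> c \<or> c' + \<gamma> \<le> \<theta>)"
  shows "wnorm c c' P \<le> C ^ length \<theta>s * wnorm c c' (diffs 1 \<theta>s P)"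
  using assms(5,6)
proof (induction \<theta>s arbitrary: P)
  case (Cons \<theta> \<theta>s)
  have wb: "wbounded c c' (fwd_diff 1 \<theta> P)"
    using Cons.prems c_le by (intro wbounded_fwd_diff) auto
  have "wnorm c c' P \<le> C * wnorm c c' (fwd_diff 1 \<theta> P)" using Cons.prems by (intro C) auto
  also have "\<dots> \<le> C * (C ^ length \<theta>s * wnorm c c' (diffs 1 \<theta>s (fwd_diff 1 \<theta> P)))"
    using Cons.prems wb C by (intro mult_left_mono Cons.IH) auto
  finally show ?case by (simp add: mult_ac)
qed simp

text \<open>Differences with \<open>\<theta> = 0\<close> and a step \<open>\<rho>\<close> that is short compared with the scale of the sum make it small.\<close>

lemma wnorm_iterated_diff_le:
  assumes C: "C \<ge> 1" "\<And>A b u \<rho> s. admissible d A u c' \<Longrightarrow> \<rho> \<ge> 0 \<Longrightarrow>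
     norm (esum A b u (s + \<rho>) - esum A b u s) \<le> C * \<rho> * wnorm c c' (esum A b u) * wt c c' s"
    and admissible: "admissible d A u c'" and \<rho>: "\<rho> \<ge> 0"
  shows "wnorm c c' (diffs \<rho> (replicate n 0) (esum A b u)) \<le> (C * \<rho>) ^ n * wnorm c c' (esum A b u)"
proof (induction n arbitrary: b)
  case (Suc n)
  define b' where "b' = (\<lambda>i. b i * complex_of_real (exp (- u i * \<rho>) - exp (- 0 * \<rho>)))"
  have eq: "fwd_diff \<rho> 0 (esum A b u) = esum A b' u" unfolding b'_def by (rule fwd_diff_esum)
  have "wnorm c c' (esum A b' u) \<le> C * \<rho> * wnorm c c' (esum A b u)"
    unfolding eq[symmetric] fwd_diff_def using C(2)[OF admissible \<rho>] by (intro wnorm_least) simp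
  then have "(C * \<rho>) ^ n * wnorm c c' (esum A b' u) \<le> (C * \<rho>) ^ n * (C * \<rho> * wnorm c c' (esum A b u))"
    using C \<rho> by (intro mult_left_mono) auto
  with Suc[of b'] show ?case by (simp add: eq mult_ac)
qed simp

end

section \<open>Clusters of exponents\<close>

lemma esum_rescale:
  "esum A b u (\<alpha> + \<beta> * s) = esum A (\<lambda>i. b i * complex_of_real (exp (- u i * \<alpha>))) (\<lambda>i. u i * \<beta>) s"
  unfolding esum_def by (intro sum.cong refl) (simp add: algebra_simps flip: exp_add of_real_mult)

lemma diffs_sum:
  "finite S \<Longrightarrow> diffs h \<theta>s (\<lambda>s. \<Sum>j\<in>S. P j s) = (\<lambda>s. \<Sum>j\<in>S. diffs h \<theta>s (P j) s)"
proof (induction \<theta>s arbitrary: P)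
  case (Cons \<theta> \<theta>s)
  have "fwd_diff h \<theta> (\<lambda>s. \<Sum>j\<in>S. P j s) = (\<lambda>s. \<Sum>j\<in>S. fwd_diff h \<theta> (P j) s)"
    by (rule ext) (simp add: fwd_diff_def sum_subtractf sum_distrib_left)
  then show ?case using Cons by simp
qed simp

lemma diffs_esum_eq_0:
  assumes "\<And>i. i \<in> A \<Longrightarrow> u i \<in> set \<theta>s"
  shows "diffs h \<theta>s (esum A b u) s = 0"
proof -
  have "(\<Prod>\<theta>\<leftarrow>\<theta>s. exp (- u i * h) - exp (- \<theta> * h)) = 0" if "i \<in> A" for i
    using assms[OF that] by (auto simp: prod_list_zero_iff)
  then show ?thesis unfolding diffs_esum esum_def by (intro sum.neutral ballI) simp
qed

text \<open>The \<open>k\<close>-th cluster consists of the exponents with indices in \<open>{m k..<m (k + 1)}\<close>. Consecutive clusters are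
separated by the ratio \<open>q\<close>; within a cluster the ratios are at most \<open>D\<close>. The first cluster is the single
exponent \<open>l 0\<close>: for the part of \<open>\<mu>\<close> near \<open>t = 0\<close> the exact power \<open>t powr l 0\<close> is needed, and the sum over a
larger cluster would only be estimated by a power with a slightly smaller exponent.\<close>

locale clusters =
  fixes l :: "nat \<Rightarrow> real" and m :: "nat \<Rightarrow> nat" and K :: nat and q D :: real
  assumes l_pos: "0 < l i" and l_mono: "i \<le> j \<Longrightarrow> l i \<le> l j"
    and m_0: "m 0 = 0" and m_1: "m (Suc 0) = Suc 0" and m_mono: "strict_mono m" and m_Suc_le: "m (Suc k) \<le> m k + K"
    and q: "q > 1" and gap: "q * l (m (Suc k) - 1) \<le> l (m (Suc k))"
    and D: "1 \<le> D" and width: "l (m (Suc k) - 1) \<le> D * l (m k)"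
begin

definition cluster :: "nat \<Rightarrow> nat set" where "cluster k = {m k..<m (Suc k)}"

definition scale :: "nat \<Rightarrow> real" where "scale k = l (m k)"

text \<open>The normalised exponents of a cluster start at \<open>1\<close>, the exponents of the slower clusters are at most \<open>1 / q\<close>.
The lower rate of the weight is put half way in between, and \<open>growth\<close> below lies half way
between the largest exponent of the cluster and \<open>q\<close> times this exponent.\<close>

definition decay :: real where "decay = (1 + 1 / q) / 2"

definition margin :: real where "margin = (1 - 1 / q) / 2"

definition growth :: "nat \<Rightarrow> real" where "growth k = l (m (Suc k) - 1) / scale k * (1 + q) / 2"

lemma scale_pos [simp]: "scale k > 0" "scale k \<noteq> 0" "scale k \<ge> 0"
  using l_pos[of "m k"] by (auto simp: scale_def)

lemma m_less: "m k < m (Suc k)"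
  using m_mono by (simp add: strict_mono_Suc_iff)

lemma scale_le: "i \<in> cluster k \<Longrightarrow> scale k \<le> l i" "i \<in> cluster k \<Longrightarrow> l i \<le> l (m (Suc k) - 1)"
  by (auto simp: cluster_def scale_def intro!: l_mono)

lemma lacunary_scale: "lacunary q scale"
  unfolding lacunary_def
proof safe
  fix k
  have "q * scale k \<le> q * l (m (Suc k) - 1)"
    using q m_less[of k] by (auto simp: scale_def intro!: l_mono)
  then show "q * scale k \<le> scale (Suc k)" using gap[of k] by (simp add: scale_def)
qed simp

sublocale window decay margin "D * (1 + q) / 2"
proof
  show "0 < decay" "0 < margin" "decay + margin \<le> 1" using q by (auto simp: decay_def margin_def field_simps)
  have "1 * 1 \<le> D * ((1 + q) / 2)" using D q by (intro mult_mono) auto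
  then show "1 \<le> D * (1 + q) / 2" by simp
qed

lemma margin_pos: "margin > 0"
  using q by (simp add: margin_def)

lemma margin_le:
  assumes "1 \<le> e" shows "margin \<le> e * ((q - 1) / 2)"
proof -
  have "margin = ((q - 1) / 2) / q" using q by (simp add: margin_def field_simps)
  also have "\<dots> \<le> (q - 1) / 2 / 1" using q by (intro divide_left_mono) auto
  also have "\<dots> = 1 * ((q - 1) / 2)" by simp
  also have "\<dots> \<le> e * ((q - 1) / 2)" using assms q by (intro mult_right_mono) auto
  finally show ?thesis .
qed

lemma admissible_cluster: "admissible K (cluster k) (\<lambda>i. l i * (1 / scale k)) (growth k)"
proof -
  define e where "e = l (m (Suc k) - 1) / scale k"
  have e: "1 \<le> e" "e \<le> D"
    using width[of k] scale_le(1)[of "m (Suc k) - 1" k] m_less[of k]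
    by (auto simp: e_def cluster_def scale_def divide_simps l_pos)
  have c': "growth k = e * ((1 + q) / 2)" by (simp add: growth_def e_def)
  have "margin \<le> e * ((q - 1) / 2)" using e by (intro margin_le) auto
  also have "e * ((q - 1) / 2) = growth k - e" by (simp add: c' algebra_simps)
  finally have g: "e + margin \<le> growth k" by simp
  have 1: "1 \<le> growth k" "growth k \<le> D * (1 + q) / 2"
  proof -
    have "1 * 1 \<le> e * ((1 + q) / 2)" using e q by (intro mult_mono) auto
    then show "1 \<le> growth k" by (simp add: c')
    have "e * ((1 + q) / 2) \<le> D * ((1 + q) / 2)" using e q by (intro mult_right_mono) auto
    then show "growth k \<le> D * (1 + q) / 2" by (simp add: c')
  qed
  have 2: "1 \<le> l i * (1 / scale k)" "l i * (1 / scale k) + margin \<le> growth k" if "i \<in> cluster k" for i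
  proof -
    show "1 \<le> l i * (1 / scale k)" using scale_le(1)[OF that] by (simp add: le_divide_eq)
    have "l i * (1 / scale k) \<le> e"
      using scale_le(2)[OF that] by (simp add: e_def divide_right_mono)
    then show "l i * (1 / scale k) + margin \<le> growth k" using g by linarith
  qed
  have "finite (cluster k)" "card (cluster k) \<le> K" using m_Suc_le[of k] by (auto simp: cluster_def)
  with 1 2 show ?thesis unfolding admissible_def by blast
qed

lemma growth_bounds: "decay \<le> growth k" "growth k \<le> D * (1 + q) / 2"
  using admissible_cluster[of k] admissible_c_le[OF admissible_cluster[of k]] by (auto simp: admissible_def)

lemma decay_nonneg: "0 \<le> decay"
  using c by simp

text \<open>The sum over a cluster in the variable \<open>\<sigma> = (1 + s) / scale k\<close>. In this normalisation all clusters look alike,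
and the interval \<open>s \<ge> 0\<close> stays away from \<open>\<sigma> = 0\<close>, where all the faster clusters are active.\<close>

definition cluster_part :: "(nat \<Rightarrow> complex) \<Rightarrow> nat \<Rightarrow> real \<Rightarrow> complex" where
  "cluster_part b k s = esum (cluster k) b l (1 / scale k + 1 / scale k * s)"

definition cluster_norm :: "(nat \<Rightarrow> complex) \<Rightarrow> nat \<Rightarrow> real" where
  "cluster_norm b k = wnorm decay (growth k) (cluster_part b k)"

lemma cluster_part_esum: "cluster_part b k = esum (cluster k) (\<lambda>i. b i * complex_of_real (exp (- l i * (1 / scale k)))) (\<lambda>i. l i * (1 / scale k))"
  unfolding cluster_part_def by (rule ext) (rule esum_rescale)

lemma wbounded_cluster_part: "wbounded decay (growth k) (cluster_part b k)"
  unfolding cluster_part_esum by (rule wbounded_esum[OF admissible_cluster])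

lemma cluster_norm_nonneg: "cluster_norm b k \<ge> 0"
  unfolding cluster_norm_def by (rule wnorm_nonneg[OF wbounded_cluster_part])

lemma cluster_part_bound: "norm (cluster_part b k s) \<le> cluster_norm b k * wt decay (growth k) s"
  unfolding cluster_norm_def by (rule wnorm_bound[OF wbounded_cluster_part])

lemma esum_cluster_eq_part: "esum (cluster k) b l \<sigma> = cluster_part b k (scale k * \<sigma> - 1)"
  by (simp add: cluster_part_def algebra_simps)

lemma esum_cluster_bound:
  assumes "\<sigma> \<ge> 0"
  shows "norm (esum (cluster k) b l \<sigma>) \<le> exp (D * (1 + q)) * cluster_norm b k * exp (- decay * scale k * \<sigma>)"
proof -
  let ?s = "scale k * \<sigma> - 1"
  have "wt decay (growth k) ?s \<le> exp (growth k * 1) * wt decay (growth k) (?s + 1)"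
    by (rule wt_le_shift) (use growth_bounds in auto)
  also have "wt decay (growth k) (?s + 1) = exp (- decay * scale k * \<sigma>)"
    using assms growth_bounds[of k] by (subst wt_of_nonneg) (auto simp: mult.assoc)
  also have "exp (growth k * 1) * exp (- decay * scale k * \<sigma>) \<le> exp (D * (1 + q)) * exp (- decay * scale k * \<sigma>)"
  proof (intro mult_right_mono)
    have "growth k \<le> D * (1 + q) / 2" by (rule growth_bounds)
    also have "\<dots> \<le> D * (1 + q)" using D q by simp
    finally show "exp (growth k * 1) \<le> exp (D * (1 + q))" by simp
  qed simp
  finally have "cluster_norm b k * wt decay (growth k) ?s \<le> cluster_norm b k * (exp (D * (1 + q)) * exp (- decay * scale k * \<sigma>))"
    using cluster_norm_nonneg by (intro mult_left_mono)
  then show ?thesis unfolding esum_cluster_eq_part using cluster_part_bound[of b k ?s] by (simp add: mult_ac)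
qed

lemma cluster_norm_le_sum: "cluster_norm b k \<le> (\<Sum>i\<in>cluster k. norm (b i))"
proof -
  have "norm (cluster_part b k s) \<le> (\<Sum>i\<in>cluster k. norm (b i)) * wt decay (growth k) s" for s
  proof -
    have "norm (cluster_part b k s) \<le> (\<Sum>i\<in>cluster k. norm (b i * complex_of_real (exp (- l i * (1 / scale k))))) * wt decay (growth k) s"
      unfolding cluster_part_esum
    proof (rule esum_wt_bound)
      fix i assume "i \<in> cluster k"
      from admissible_exponent(1,3)[OF admissible_cluster this] margin_pos
      show "decay \<le> l i * (1 / scale k) \<and> l i * (1 / scale k) \<le> growth k" by linarith
    qed
    also have "\<dots> \<le> (\<Sum>i\<in>cluster k. norm (b i)) * wt decay (growth k) s"
      using l_pos by (intro mult_right_mono sum_mono) (auto simp: norm_mult mult_le_cancel_left2 less_imp_le)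
    finally show ?thesis .
  qed
  then show ?thesis unfolding cluster_norm_def by (intro wnorm_least)
qed

lemma UN_cluster: "(\<Union>j<J. cluster j) = {..<m J}"
proof (induction J)
  case (Suc J)
  then show ?case using m_less[of J] by (auto simp: cluster_def lessThan_Suc)
qed (simp add: m_0)

lemma cluster_disjoint: "j \<noteq> k \<Longrightarrow> cluster j \<inter> cluster k = {}"
proof -
  have "cluster j \<inter> cluster k = {}" if "j < k" for j k
    using strict_mono_less_eq[OF m_mono, of "Suc j" k] that by (auto simp: cluster_def)
  then show "j \<noteq> k \<Longrightarrow> cluster j \<inter> cluster k = {}" by (metis Int_commute nat_neq_iff)
qed

lemma esum_cluster_sum: "esum {..<m J} b l \<sigma> = (\<Sum>j<J. esum (cluster j) b l \<sigma>)"
  unfolding esum_def UN_cluster[symmetric] by (intro sum.UNION_disjoint) (auto simp: cluster_disjoint, auto simp: cluster_def)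

definition ratio :: "nat \<Rightarrow> nat \<Rightarrow> real" where
  "ratio k j = min (scale j / scale k) (scale k / scale j)"

lemma ratio_bounds: "0 < ratio k j" "ratio k j \<le> 1"
  by (auto simp: ratio_def min_le_iff_disj divide_simps)

lemma ratio_le_power: "ratio k j \<le> (1 / q) ^ ((j - k) + (k - j))"
proof (cases "k \<le> j")
  case True
  have "q ^ (j - k) * scale k \<le> scale j" by (rule lacunary_power[OF lacunary_scale q True])
  then have "scale k / scale j \<le> (1 / q) ^ (j - k)" using q by (simp add: field_simps power_divide)
  then show ?thesis using True by (simp add: ratio_def min_le_iff_disj)
next
  case False
  then have "q ^ (k - j) * scale j \<le> scale k" by (intro lacunary_power[OF lacunary_scale q]) auto
  then have "scale j / scale k \<le> (1 / q) ^ (k - j)" using q by (simp add: field_simps power_divide)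
  then show ?thesis using False by (simp add: ratio_def min_le_iff_disj)
qed

lemma m_diff_le: "i \<le> j \<Longrightarrow> m j \<le> m i + K * (j - i)"
proof (induction j rule: dec_induct)
  case (step j)
  then show ?case using m_Suc_le[of j] by (simp add: Suc_diff_le)
qed simp

text \<open>The exponents that are removed in order to isolate the cluster \<open>k\<close>.\<close>

definition near :: "nat \<Rightarrow> nat \<Rightarrow> nat list" where
  "near L k = filter (\<lambda>i. i \<notin> cluster k) [m (k - L)..<m (k + L + 1)]"

lemma length_near: "length (near L k) \<le> (2 * L + 1) * K"
proof -
  have "length (near L k) \<le> m (k + L + 1) - m (k - L)"
    unfolding near_def by (rule order_trans[OF length_filter_le]) simp
  also have "\<dots> \<le> K * ((k + L + 1) - (k - L))"
    using m_diff_le[of "k - L" "k + L + 1"] by linarith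
  also have "\<dots> \<le> K * (2 * L + 1)" by (intro mult_left_mono) auto
  finally show ?thesis by (simp add: mult.commute)
qed

lemma cluster_subset_near:
  assumes "j \<noteq> k" "(j - k) + (k - j) \<le> L" "i \<in> cluster j"
  shows "i \<in> set (near L k)"
proof -
  have "m (k - L) \<le> m j" "m (Suc j) \<le> m (k + L + 1)"
    using assms by (auto simp: strict_mono_less_eq[OF m_mono])
  then show ?thesis using assms cluster_disjoint[of j k] by (auto simp: near_def cluster_def)
qed

text \<open>The exponents of all other clusters are admissible values of \<open>\<theta>\<close> in \<open>wnorm_le_fwd_diff\<close>.\<close>

lemma not_in_cluster:
  assumes "i \<notin> cluster k"
  shows "l i * (1 / scale k) + margin \<le> decay \<or> growth k + margin \<le> l i * (1 / scale k)"
proof -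
  consider "i < m k" | "i \<ge> m (Suc k)" using assms by (force simp: cluster_def)
  then show ?thesis
  proof cases
    case 1
    then obtain k' where k: "k = Suc k'" using m_0 by (cases k) auto
    have "l i \<le> l (m k - 1)" using 1 by (intro l_mono) auto
    then have "q * l i \<le> q * l (m k - 1)" using q by simp
    also have "\<dots> \<le> scale k" using gap[of k'] by (simp add: k scale_def)
    finally have "l i * (1 / scale k) \<le> 1 / q" using q by (simp add: field_simps)
    moreover have "1 / q + margin = decay" by (simp add: margin_def decay_def field_simps)
    ultimately show ?thesis by simp
  next
    case 2
    define e where "e = l (m (Suc k) - 1) / scale k"
    have e: "1 \<le> e"
      using scale_le(1)[of "m (Suc k) - 1" k] m_less[of k]
      by (auto simp: e_def cluster_def scale_def divide_simps l_pos)
    have "q * l (m (Suc k) - 1) \<le> l i" using gap[of k] l_mono[OF 2] by simp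
    then have "q * e \<le> l i * (1 / scale k)" by (simp add: e_def divide_right_mono)
    moreover have "growth k + margin \<le> q * e"
    proof -
      have "margin \<le> e * ((q - 1) / 2)" using e by (intro margin_le) auto
      also have "e * ((q - 1) / 2) = q * e - growth k" by (simp add: growth_def e_def field_simps)
      finally show ?thesis by simp
    qed
    ultimately show ?thesis by simp
  qed
qed


definition rescaled_sum :: "(nat \<Rightarrow> complex) \<Rightarrow> nat \<Rightarrow> nat \<Rightarrow> real \<Rightarrow> complex" where
  "rescaled_sum b J k s = esum {..<m J} b l (1 / scale k + 1 / scale k * s)"

text \<open>The differences described at the beginning of the theory are applied to the whole sum in the variable normalised
for the cluster \<open>k\<close>. On the cluster \<open>k\<close> itself they can be undone, and a local mean controls the result. The
near clusters vanish. A far cluster is compared with its own norm: a faster one has decayed, a slower one is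
reduced by the \<open>H\<close> differences with \<open>\<theta> = 0\<close>. The factor \<open>ratio k j powr a\<close> on the right will later
convert the weight of the \<open>j\<close>-th norm into that of the \<open>k\<close>-th one.\<close>

lemma cluster_norm_le_local_mean:
  assumes "\<epsilon> > 0" "a \<ge> 0"
  shows "\<exists>C>0. \<exists>T\<ge>1. \<forall>b J k. k < J \<longrightarrow> cluster_norm b k \<le> C * integral {0..T} (\<lambda>s. norm (rescaled_sum b J k s))
    + \<epsilon> * (\<Sum>j<J. (1 / 2) ^ ((j - k) + (k - j)) * ratio k j powr a * cluster_norm b j)"
proof -
  obtain C1 where C1: "C1 \<ge> 1" "\<And>P \<theta> c'. decay \<le> c' \<Longrightarrow> c' \<le> D * (1 + q) / 2 \<Longrightarrow> wbounded decay c' P \<Longrightarrow> 0 \<le> \<theta> \<Longrightarrow>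
      \<theta> + margin \<le> decay \<or> c' + margin \<le> \<theta> \<Longrightarrow> wnorm decay c' P \<le> C1 * wnorm decay c' (fwd_diff 1 \<theta> P)"
    using wnorm_le_fwd_diff by blast
  obtain C2 where C2: "C2 > 0" "\<And>A b u c' a. admissible K A u c' \<Longrightarrow> a \<ge> 0 \<Longrightarrow>
      (\<forall>s\<in>{0..1/2}. norm (esum A b u s) \<le> a) \<Longrightarrow> wnorm decay c' (esum A b u) \<le> C2 * a"
    using esum_wnorm_le_sup[of "1/2" K] by (meson half_gt_zero_iff zero_less_one)
  obtain C3 where C3: "C3 > 0" "\<And>A b u s. finite A \<Longrightarrow> card A \<le> K \<Longrightarrow> (\<forall>i\<in>A. 0 < u i \<and> u i \<le> D * (1 + q) / 2) \<Longrightarrow>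
      s \<in> {0..1/2} \<Longrightarrow> norm (esum (A :: nat set) b u s) \<le> C3 * integral {0..1} (\<lambda>s. norm (esum A b u s))"
    using esum_le_integral[of "D * (1 + q) / 2" "1/2" 1 K] D q by auto
  obtain C4 where C4: "C4 \<ge> 1" "\<And>A b u c' \<rho> s. admissible K A u c' \<Longrightarrow> \<rho> \<ge> 0 \<Longrightarrow>
     norm (esum A b u (s + \<rho>) - esum A b u s) \<le> C4 * \<rho> * wnorm decay c' (esum A b u) * wt decay c' s"
    using esum_increment_le[of K] by blast
  define B0 where "B0 = C2 * C3"
  have B0: "B0 > 0" using C2 C3 by (simp add: B0_def)
  have local_mean: "wnorm decay c' (esum A b u) \<le> B0 * integral {0..1} (\<lambda>s. norm (esum A b u s))"
    if "admissible K A u c'" for A b u c'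
    unfolding B0_def mult.assoc
  proof (rule C2(2)[OF that])
    show "0 \<le> C3 * integral {0..1} (\<lambda>s. norm (esum A b u s))"
      using C3 by (intro mult_nonneg_nonneg integral_nonneg integrable_norm_esum) auto
    show "\<forall>s\<in>{0..1/2}. norm (esum A b u s) \<le> C3 * integral {0..1} (\<lambda>s. norm (esum A b u s))"
      using that admissible_exponent[OF that] by (intro ballI C3(2)) (force simp: admissible_def)+
  qed
  define E where "E = 2 * C1"
  have E: "E \<ge> 2" using C1 by (simp add: E_def)
  \<comment> \<open>A far cluster \<open>j\<close> costs at most \<open>E ^ (2 * K * L) \<le> E ^ (2 * K * d)\<close> with \<open>d = |j - k| \<ge> L\<close>. The choice of \<open>H'\<close> pays
    for this and leaves \<open>4 powr (- d)\<close>; one half of that power is kept, the other one is used for \<open>\<epsilon>\<close>.\<close>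
  obtain H' where H': "4 * E ^ (2 * K) \<le> q ^ H'"
    using real_arch_pow[OF q, of "4 * E ^ (2 * K)"] less_imp_le by blast
  obtain na :: nat where na: "a \<le> real na" using real_arch_simple by blast
  define H where "H = H' + na"
  obtain CH where CH: "CH > 0" "\<And>u. u > 0 \<Longrightarrow> exp (- decay * u) \<le> CH * (1 / u) powr real H"
    using exp_minus_le_powr[of decay "real H"] growth_bounds decay_nonneg c by auto
  define C5 where "C5 = max (exp decay * CH) (C4 ^ H * exp (D * (1 + q) / 2))"
  have C5: "C5 > 0" using CH by (simp add: C5_def less_max_iff_disj)
  obtain L where L: "E ^ (K + H) * B0 * C5 * (1 / 2) ^ L \<le> \<epsilon>"
  proof -
    have "(\<lambda>L. E ^ (K + H) * B0 * C5 * (1 / 2) ^ L) \<longlonglongrightarrow> E ^ (K + H) * B0 * C5 * 0"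
      by (intro tendsto_intros) auto
    then have "eventually (\<lambda>L. E ^ (K + H) * B0 * C5 * (1 / 2) ^ L < \<epsilon>) sequentially"
      using \<open>\<epsilon> > 0\<close> by (intro order_tendstoD) auto
    then obtain L where "E ^ (K + H) * B0 * C5 * (1 / 2) ^ L < \<epsilon>"
      unfolding eventually_sequentially by blast
    then show ?thesis using that less_imp_le by blast
  qed
  define n0 where "n0 = (2 * L + 1) * K"
  define T where "T = 1 + real (n0 + H)"
  show ?thesis
  proof (rule exI[of _ "E ^ (n0 + H) * B0"], rule conjI, goal_cases)
    case 1
    show ?case using E B0 by simp
  next
    case 2
    show ?case
    proof (rule exI[of _ T], intro conjI allI impI)
      show "T \<ge> 1" by (simp add: T_def)
      fix b J k assume k: "k < (J::nat)"
      define nr where "nr = map (\<lambda>i. l i * (1 / scale k)) (near L k)"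
      define \<theta>s where "\<theta>s = replicate H 0 @ nr"
      have len_nr: "length nr \<le> n0" using length_near[of L k] by (simp add: nr_def n0_def)
      have len: "length \<theta>s \<le> n0 + H" using len_nr by (simp add: \<theta>s_def)
      have nr_pos: "\<forall>\<theta>\<in>set nr. 0 \<le> \<theta>" using l_pos by (auto simp: nr_def less_imp_le)
      have \<theta>s_pos: "\<forall>\<theta>\<in>set \<theta>s. 0 \<le> \<theta>" using nr_pos by (auto simp: \<theta>s_def)
      have \<theta>s_gap: "\<forall>\<theta>\<in>set \<theta>s. 0 \<le> \<theta> \<and> (\<theta> + margin \<le> decay \<or> growth k + margin \<le> \<theta>)"
      proof
        fix \<theta> assume \<theta>: "\<theta> \<in> set \<theta>s"
        then have "\<theta> = 0 \<or> \<theta> \<in> set nr" by (auto simp: \<theta>s_def)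
        then consider "\<theta> = 0" | i where "i \<notin> cluster k" "\<theta> = l i * (1 / scale k)"
          unfolding nr_def near_def set_map set_filter by blast
        then have "\<theta> + margin \<le> decay \<or> growth k + margin \<le> \<theta>"
        proof cases
          case 1
          have "margin \<le> decay" using q by (simp add: decay_def margin_def)
          then show ?thesis using 1 by simp
        next
          case 2 then show ?thesis using not_in_cluster by blast
        qed
        then show "0 \<le> \<theta> \<and> (\<theta> + margin \<le> decay \<or> growth k + margin \<le> \<theta>)" using \<theta>s_pos \<theta> by auto
      qed
      define u where "u = (\<lambda>j. scale j / scale k)"
      have u: "u j > 0" for j by (simp add: u_def)
      define P where "P = (\<lambda>j s. esum (cluster j) b l (1 / scale k + 1 / scale k * s))"
      have P_esum: "P j = esum (cluster j) (\<lambda>i. b i * complex_of_real (exp (- l i * (1 / scale k)))) (\<lambda>i. l i * (1 / scale k))" for j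
        unfolding P_def by (rule ext) (rule esum_rescale)
      have ratio_inverse: "1 / u j = ratio k j" if "u j \<ge> 1" for j
      proof -
        have "1 / u j \<le> u j" using that by (simp add: divide_le_eq) (metis mult_mono' mult_1 order_trans zero_le_one)
        then show ?thesis by (simp add: ratio_def u_def)
      qed
      have ratio_direct: "u j = ratio k j" if "u j \<le> 1" for j
      proof -
        have "u j \<le> 1 / u j" using that u[of j] by (simp add: le_divide_eq) (metis less_imp_le mult_le_one)
        then show ?thesis by (simp add: ratio_def u_def)
      qed
      have P_part: "P j = (\<lambda>s. cluster_part b j ((u j - 1) + u j * s))" for j
      proof (rule ext)
        fix s
        have "1 / scale j * u j = 1 / scale k" by (simp add: u_def)
        moreover have "1 / scale j + 1 / scale j * ((u j - 1) + u j * s) = 1 / scale j * u j + 1 / scale j * u j * s"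
          by (simp add: algebra_simps)
        ultimately have "1 / scale j + 1 / scale j * ((u j - 1) + u j * s) = 1 / scale k + 1 / scale k * s"
          by simp
        then show "P j s = cluster_part b j ((u j - 1) + u j * s)" by (simp only: P_def cluster_part_def)
      qed
      have Pk: "P k = cluster_part b k" by (simp add: P_def cluster_part_def fun_eq_iff)
      have rescaled_sum: "rescaled_sum b J k = (\<lambda>s. \<Sum>j<J. P j s)"
        by (rule ext) (simp add: rescaled_sum_def P_def esum_cluster_sum)
      have cont: "continuous_on X (rescaled_sum b J k)" for X
        unfolding rescaled_sum_def by (intro continuous_intros)
      have contP: "continuous_on X (diffs 1 \<theta>s (P j))" for X j
        unfolding P_esum diffs_esum by (intro continuous_intros)
      have near0: "diffs 1 \<theta>s (P j) s = 0" if "j \<noteq> k" "(j - k) + (k - j) \<le> L" for j s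
        unfolding P_esum
      proof (rule diffs_esum_eq_0)
        fix i assume "i \<in> cluster j"
        then show "l i * (1 / scale k) \<in> set \<theta>s"
          using cluster_subset_near[OF that] by (auto simp: \<theta>s_def nr_def)
      qed
      have far: "norm (diffs 1 \<theta>s (P j) s) \<le> 2 ^ (n0 + H) * C5 * ratio k j ^ H * cluster_norm b j"
        if "j \<noteq> k" and s: "s \<in> {0..1}" for j s
      proof -
        let ?x = "(u j - 1) + u j * s"
        have rescaled: "diffs 1 \<theta>s (P j) s = diffs (u j) (map (\<lambda>\<theta>. \<theta> / u j) \<theta>s) (cluster_part b j) ?x"
          unfolding P_part using u[of j] by (subst diffs_rescale) auto
        show ?thesis
        proof (cases "u j \<ge> 1")
          case True
          have "norm (diffs 1 \<theta>s (P j) s) \<le> 2 ^ length (map (\<lambda>\<theta>. \<theta> / u j) \<theta>s) * cluster_norm b j * wt decay (growth j) ?x"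
            unfolding rescaled using growth_bounds decay_nonneg u[of j] \<theta>s_pos
            by (intro diffs_wt_bound cluster_part_bound) (auto simp: less_imp_le)
          also have "\<dots> \<le> 2 ^ (n0 + H) * cluster_norm b j * (exp decay * CH * ratio k j ^ H)"
          proof (intro mult_mono mult_nonneg_nonneg cluster_norm_nonneg power_increasing)
            have x: "?x \<ge> u j - 1" "?x \<ge> 0" using True s u[of j] by auto
            have "wt decay (growth j) ?x = exp (- decay * ?x)" using growth_bounds decay_nonneg x by (intro wt_of_nonneg)
            also have "\<dots> \<le> exp (- decay * (u j - 1))" using decay_nonneg x(1) by (simp add: mult_left_mono)
            also have "\<dots> = exp decay * exp (- decay * u j)" by (simp add: exp_add[symmetric] algebra_simps)
            also have "\<dots> \<le> exp decay * (CH * (1 / u j) powr real H)" using CH(2)[OF u] by (intro mult_left_mono) auto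
            also have "(1 / u j) powr real H = (1 / u j) ^ H" using u[of j] by (intro powr_realpow) auto
            also have "1 / u j = ratio k j" using True by (rule ratio_inverse)
            finally show "wt decay (growth j) ?x \<le> exp decay * CH * ratio k j ^ H" by (simp add: mult_ac)
          qed (use len CH in auto)
          also have "\<dots> \<le> 2 ^ (n0 + H) * cluster_norm b j * (C5 * ratio k j ^ H)"
            using ratio_bounds[of k j] cluster_norm_nonneg[of b j]
            by (intro mult_left_mono mult_right_mono) (auto simp: C5_def less_imp_le)
          finally show ?thesis by (simp add: mult_ac)
        next
          case False
          let ?\<rho> = "u j"
          let ?P' = "diffs ?\<rho> (replicate H 0) (cluster_part b j)"
          have map: "map (\<lambda>\<theta>. \<theta> / u j) \<theta>s = replicate H 0 @ map (\<lambda>\<theta>. \<theta> / u j) nr" by (simp add: \<theta>s_def)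
          have wn: "wnorm decay (growth j) ?P' \<le> (C4 * ?\<rho>) ^ H * cluster_norm b j"
            unfolding cluster_norm_def cluster_part_esum
          proof (rule wnorm_iterated_diff_le[OF C4(1) _ admissible_cluster])
            show "u j \<ge> 0" using u[of j] by simp
          qed (rule C4(2))
          have wb': "wbounded decay (growth j) ?P'"
            unfolding cluster_part_esum diffs_esum by (rule wbounded_esum[OF admissible_cluster])
          have P': "norm (?P' x) \<le> (C4 * ?\<rho>) ^ H * cluster_norm b j * wt decay (growth j) x" for x
            by (rule order_trans[OF wnorm_bound[OF wb'] mult_right_mono[OF wn wt_nonneg]])
          have "norm (diffs 1 \<theta>s (P j) s) \<le> 2 ^ length (map (\<lambda>\<theta>. \<theta> / u j) nr) * ((C4 * ?\<rho>) ^ H * cluster_norm b j) * wt decay (growth j) ?x"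
            unfolding rescaled map diffs_append using growth_bounds decay_nonneg u[of j] nr_pos
            by (intro diffs_wt_bound P') (auto simp: less_imp_le)
          also have "\<dots> \<le> 2 ^ (n0 + H) * ((C4 * ?\<rho>) ^ H * cluster_norm b j) * exp (D * (1 + q) / 2)"
          proof (rule mult_mono[OF mult_right_mono])
            show "(2::real) ^ length (map (\<lambda>\<theta>. \<theta> / u j) nr) \<le> 2 ^ (n0 + H)"
              using len_nr by (intro power_increasing) auto
            show X: "0 \<le> (C4 * u j) ^ H * cluster_norm b j" using C4(1) u[of j] cluster_norm_nonneg by simp
            show "0 \<le> 2 ^ (n0 + H) * ((C4 * u j) ^ H * cluster_norm b j)" by (intro mult_nonneg_nonneg X) simp
            have "0 \<le> u j * s" using s u[of j] by simp
            then have "wt decay (growth j) ?x \<le> wt decay (growth j) (- 1)"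
              using growth_bounds decay_nonneg u[of j] by (intro wt_antimono) auto
            also have "\<dots> = exp (growth j)" using growth_bounds decay_nonneg by (simp add: wt_of_nonpos)
            also have "\<dots> \<le> exp (D * (1 + q) / 2)" using growth_bounds decay_nonneg by simp
            finally show "wt decay (growth j) ?x \<le> exp (D * (1 + q) / 2)" .
          qed simp
          also have "?\<rho> = ratio k j" using False by (intro ratio_direct) auto
          also have "2 ^ (n0 + H) * ((C4 * ratio k j) ^ H * cluster_norm b j) * exp (D * (1 + q) / 2)
              = 2 ^ (n0 + H) * cluster_norm b j * ((C4 ^ H * exp (D * (1 + q) / 2)) * ratio k j ^ H)"
            by (simp add: power_mult_distrib mult_ac)
          also have "\<dots> \<le> 2 ^ (n0 + H) * cluster_norm b j * (C5 * ratio k j ^ H)"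
            using ratio_bounds[of k j] cluster_norm_nonneg[of b j]
            by (intro mult_left_mono mult_right_mono) (auto simp: C5_def less_imp_le)
          finally show ?thesis by (simp add: mult_ac)
        qed
      qed
      \<comment> \<open>With truncated subtraction, \<open>(j - k) + (k - j)\<close> is the distance of \<open>j\<close> and \<open>k\<close>.\<close>
      define far_set where "far_set = {j. j < J \<and> (j - k) + (k - j) > L}"
      define S where "S = (\<Sum>j\<in>far_set. 2 ^ (n0 + H) * C5 * ratio k j ^ H * cluster_norm b j)"
      have bound: "norm (diffs 1 \<theta>s (P k) s) \<le> norm (diffs 1 \<theta>s (rescaled_sum b J k) s) + S" if s: "s \<in> {0..1}" for s
      proof -
        have "diffs 1 \<theta>s (rescaled_sum b J k) s = (\<Sum>j<J. diffs 1 \<theta>s (P j) s)"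
          unfolding rescaled_sum by (simp add: diffs_sum)
        also have "\<dots> = diffs 1 \<theta>s (P k) s + (\<Sum>j\<in>{..<J} - {k}. diffs 1 \<theta>s (P j) s)"
          using k by (intro sum.remove) auto
        also have "(\<Sum>j\<in>{..<J} - {k}. diffs 1 \<theta>s (P j) s) = (\<Sum>j\<in>far_set. diffs 1 \<theta>s (P j) s)"
          by (rule sum.mono_neutral_right) (auto simp: far_set_def intro!: near0)
        finally have "norm (diffs 1 \<theta>s (P k) s) \<le> norm (diffs 1 \<theta>s (rescaled_sum b J k) s) + norm (\<Sum>j\<in>far_set. diffs 1 \<theta>s (P j) s)"
          using norm_triangle_ineq4[of "diffs 1 \<theta>s (rescaled_sum b J k) s" "\<Sum>j\<in>far_set. diffs 1 \<theta>s (P j) s"] by simp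
        moreover have "norm (\<Sum>j\<in>far_set. diffs 1 \<theta>s (P j) s) \<le> S"
          unfolding S_def using s by (intro sum_norm_le far) (auto simp: far_set_def)
        ultimately show ?thesis by linarith
      qed
      have contF: "continuous_on X (diffs 1 \<theta>s (rescaled_sum b J k))" for X
        using continuous_on_diffs[OF cont] continuous_on_subset by blast
      have "cluster_norm b k \<le> C1 ^ length \<theta>s * wnorm decay (growth k) (diffs 1 \<theta>s (cluster_part b k))"
        unfolding cluster_norm_def using growth_bounds decay_nonneg C1 \<theta>s_gap
        by (intro wnorm_le_diffs wbounded_cluster_part) auto
      also have "\<dots> \<le> C1 ^ (n0 + H) * (B0 * integral {0..1} (\<lambda>s. norm (diffs 1 \<theta>s (P k) s)))"
      proof (intro mult_mono power_increasing len)
        show "wnorm decay (growth k) (diffs 1 \<theta>s (cluster_part b k)) \<le> B0 * integral {0..1} (\<lambda>s. norm (diffs 1 \<theta>s (P k) s))"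
          unfolding Pk cluster_part_esum diffs_esum by (rule local_mean[OF admissible_cluster])
        show "0 \<le> wnorm decay (growth k) (diffs 1 \<theta>s (cluster_part b k))"
          unfolding cluster_part_esum diffs_esum by (rule wnorm_nonneg[OF wbounded_esum[OF admissible_cluster]])
      qed (use C1 in auto)
      also have "integral {0..1} (\<lambda>s. norm (diffs 1 \<theta>s (P k) s)) \<le> integral {0..1} (\<lambda>s. norm (diffs 1 \<theta>s (rescaled_sum b J k) s) + S)"
        using bound by (intro integral_le integrable_continuous_interval continuous_intros contP contF)
      also have "\<dots> = integral {0..1} (\<lambda>s. norm (diffs 1 \<theta>s (rescaled_sum b J k) s)) + S"
        by (subst integral_add) (auto intro!: integrable_continuous_interval continuous_intros contF)
      also have "integral {0..1} (\<lambda>s. norm (diffs 1 \<theta>s (rescaled_sum b J k) s)) \<le> 2 ^ length \<theta>s * integral {0..1 + real (length \<theta>s)} (\<lambda>s. norm (rescaled_sum b J k s))"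
        using \<theta>s_pos by (intro integral_norm_diffs_le cont) auto
      also have "\<dots> \<le> 2 ^ (n0 + H) * integral {0..T} (\<lambda>s. norm (rescaled_sum b J k s))"
      proof (intro mult_mono power_increasing len integral_nonneg)
        show "integral {0..1 + real (length \<theta>s)} (\<lambda>s. norm (rescaled_sum b J k s)) \<le> integral {0..T} (\<lambda>s. norm (rescaled_sum b J k s))"
          using len by (intro integral_subset_le integrable_continuous_interval continuous_intros cont) (auto simp: T_def)
      qed (auto intro!: integrable_continuous_interval continuous_intros cont)
      finally have "cluster_norm b k \<le> C1 ^ (n0 + H) * (B0 * (2 ^ (n0 + H) * integral {0..T} (\<lambda>s. norm (rescaled_sum b J k s)) + S))"
        using C1 B0 by (simp add: mult_left_mono)
      also have "\<dots> = E ^ (n0 + H) * B0 * integral {0..T} (\<lambda>s. norm (rescaled_sum b J k s)) + C1 ^ (n0 + H) * B0 * S"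
        by (simp add: E_def power_mult_distrib algebra_simps)
      also have "C1 ^ (n0 + H) * B0 * S = (\<Sum>j\<in>far_set. E ^ (n0 + H) * B0 * C5 * ratio k j ^ H * cluster_norm b j)"
        by (simp add: S_def sum_distrib_left E_def power_mult_distrib mult_ac)
      also have "\<dots> \<le> (\<Sum>j\<in>far_set. \<epsilon> * ((1 / 2) ^ ((j - k) + (k - j)) * ratio k j powr a * cluster_norm b j))"
      proof (rule sum_mono)
        fix j assume j: "j \<in> far_set"
        define d where "d = (j - k) + (k - j)"
        have d: "d \<ge> L" using j by (simp add: far_set_def d_def)
        have "ratio k j ^ H' \<le> ((1 / q) ^ d) ^ H'"
          unfolding d_def using ratio_bounds[of k j] by (intro power_mono ratio_le_power) auto
        also have "\<dots> = (1 / q ^ H') ^ d" by (simp add: power_divide power_mult[symmetric] mult.commute)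
        also have "\<dots> \<le> (1 / (4 * E ^ (2 * K))) ^ d"
          using H' E q by (intro power_mono divide_left_mono) auto
        also have "\<dots> = (1 / 2) ^ d * (1 / 2) ^ d * (1 / E ^ (2 * K)) ^ d"
          by (simp add: power_mult_distrib[symmetric])
        also have "\<dots> \<le> (1 / 2) ^ d * (1 / 2) ^ L * (1 / E ^ (2 * K)) ^ L"
          using d E by (intro mult_mono power_decreasing) (auto simp: one_le_power)
        finally have 1: "ratio k j ^ H' \<le> (1 / 2) ^ d * (1 / 2) ^ L * (1 / E ^ (2 * K)) ^ L" .
        have "ratio k j ^ na = ratio k j powr real na" using ratio_bounds[of k j] by (simp add: powr_realpow)
        also have "\<dots> \<le> ratio k j powr a" using ratio_bounds[of k j] na by (intro powr_mono') auto
        finally have 2: "ratio k j ^ na \<le> ratio k j powr a" .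
        have "E ^ (n0 + H) * B0 * C5 * ratio k j ^ H = E ^ (n0 + H) * B0 * C5 * (ratio k j ^ H' * ratio k j ^ na)"
          by (simp add: H_def power_add)
        also have "\<dots> \<le> E ^ (n0 + H) * B0 * C5 * (((1 / 2) ^ d * (1 / 2) ^ L * (1 / E ^ (2 * K)) ^ L) * ratio k j powr a)"
          using E B0 C5 ratio_bounds[of k j] by (intro mult_left_mono mult_mono 1 2) auto
        also have "\<dots> = (E ^ (K + H) * B0 * C5 * (1 / 2) ^ L) * ((1 / 2) ^ d * ratio k j powr a)"
        proof -
          have "n0 + H = (K + H) + 2 * K * L" by (simp add: n0_def algebra_simps)
          then have nE: "E ^ (n0 + H) = E ^ (K + H) * (E ^ (2 * K)) ^ L"
            by (simp only: power_add power_mult)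
          have "E ^ (n0 + H) * B0 * C5 * (((1 / 2) ^ d * (1 / 2) ^ L * (1 / E ^ (2 * K)) ^ L) * ratio k j powr a)
              = (E ^ (n0 + H) * (1 / E ^ (2 * K)) ^ L) * B0 * C5 * (1 / 2) ^ L * ((1 / 2) ^ d * ratio k j powr a)"
            by (simp only: mult_ac)
          also have "E ^ (n0 + H) * (1 / E ^ (2 * K)) ^ L = E ^ (K + H)"
            unfolding nE using E by (simp add: power_one_over)
          finally show ?thesis .
        qed
        also have "\<dots> \<le> \<epsilon> * ((1 / 2) ^ d * ratio k j powr a)" using L by (intro mult_right_mono) auto
        finally have "E ^ (n0 + H) * B0 * C5 * ratio k j ^ H * cluster_norm b j \<le> \<epsilon> * ((1 / 2) ^ d * ratio k j powr a) * cluster_norm b j"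
          using cluster_norm_nonneg by (intro mult_right_mono)
        then show "E ^ (n0 + H) * B0 * C5 * ratio k j ^ H * cluster_norm b j \<le> \<epsilon> * ((1 / 2) ^ ((j - k) + (k - j)) * ratio k j powr a * cluster_norm b j)"
          by (simp add: d_def mult_ac)
      qed
      also have "\<dots> \<le> \<epsilon> * (\<Sum>j<J. (1 / 2) ^ ((j - k) + (k - j)) * ratio k j powr a * cluster_norm b j)"
        unfolding sum_distrib_left[symmetric] using \<open>\<epsilon> > 0\<close> cluster_norm_nonneg
        by (intro mult_left_mono sum_mono2) (auto simp: far_set_def)
      finally show "cluster_norm b k \<le> E ^ (n0 + H) * B0 * integral {0..T} (\<lambda>s. norm (rescaled_sum b J k s))
        + \<epsilon> * (\<Sum>j<J. (1 / 2) ^ ((j - k) + (k - j)) * ratio k j powr a * cluster_norm b j)" by simp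
    qed
  qed
qed

end

lemma ennreal_mult_indicator: "ennreal (a * indicator A x) = ennreal a * indicator A x"
  by (auto simp: indicator_def)

section \<open>The lower estimate for the norms of the cluster sums\<close>

lemma nn_integral_nu:
  assumes [measurable]: "f \<in> borel_measurable borel"
  shows "(\<integral>\<^sup>+x. f x \<partial>nu a) = (\<integral>\<^sup>+x. ennreal ((1 - x) powr a) * f x * indicator {0..1} x \<partial>lborel)"
proof -
  have m: "f \<in> borel_measurable (restrict_space lborel {0..1})"
    by (rule measurable_restrict_space1) simp
  have "(\<integral>\<^sup>+x. f x \<partial>nu a) = (\<integral>\<^sup>+x. ennreal ((1 - x) powr a) * f x \<partial>restrict_space lborel {0..1})"
    unfolding nu_def using m by (intro nn_integral_density measurable_restrict_space1) auto
  also have "\<dots> = (\<integral>\<^sup>+x. ennreal ((1 - x) powr a) * f x * indicator {0..1} x \<partial>lborel)"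
    by (rule nn_integral_restrict_space) auto
  finally show ?thesis .
qed

text \<open>Jensen's inequality: integrate the tangent to \<open>y powr r\<close> at the mean value of \<open>g\<close>.\<close>

lemma integral_powr_le:
  fixes g :: "real \<Rightarrow> real"
  assumes r: "r > 1" and T: "T > 0" and g: "continuous_on {0..T} g" "\<And>s. s \<in> {0..T} \<Longrightarrow> g s \<ge> 0"
  shows "integral {0..T} g powr r \<le> T powr (r - 1) * integral {0..T} (\<lambda>s. g s powr r)"
proof -
  define I where "I = integral {0..T} g"
  define m where "m = I / T"
  have ig: "g integrable_on {0..T}" by (intro integrable_continuous_interval g)
  have igr: "(\<lambda>s. g s powr r) integrable_on {0..T}"
    using r g by (intro integrable_continuous_interval continuous_on_powr' continuous_intros) auto
  have I: "I \<ge> 0" unfolding I_def using g by (intro integral_nonneg ig) auto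
  then have m: "m \<ge> 0" using T by (simp add: m_def)
  have "integral {0..T} (\<lambda>s. m powr r + r * m powr (r - 1) * (g s - m)) \<le> integral {0..T} (\<lambda>s. g s powr r)"
    using r g m ig by (intro integral_le igr powr_ge_tangent integrable_add integrable_on_mult_right integrable_diff) auto
  also have "integral {0..T} (\<lambda>s. m powr r + r * m powr (r - 1) * (g s - m)) =
      T * m powr r + r * m powr (r - 1) * (I - T * m)"
  proof (rule integral_unique)
    have "((\<lambda>s. z) has_integral T * z) {0..T}" for z :: real
      using has_integral_const_real[of z 0 T] T by simp
    then show "((\<lambda>s. m powr r + r * m powr (r - 1) * (g s - m)) has_integral
        T * m powr r + r * m powr (r - 1) * (I - T * m)) {0..T}"
      using ig unfolding I_def
      by (intro has_integral_add has_integral_mult_right has_integral_diff integrable_integral)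
  qed
  also have "T * m = I" using T by (simp add: m_def)
  finally have "T * m powr r \<le> integral {0..T} (\<lambda>s. g s powr r)" by simp
  then have "T powr (r - 1) * (T * m powr r) \<le> T powr (r - 1) * integral {0..T} (\<lambda>s. g s powr r)"
    by (intro mult_left_mono) auto
  also have "T powr (r - 1) * (T * m powr r) = I powr r"
  proof -
    have "T powr (r - 1) * (T * m powr r) = T powr r * m powr r"
      using T powr_mult_base[of T "r - 1"] by (simp add: mult_ac)
    also have "\<dots> = (T * m) powr r" using T m by (simp add: powr_mult)
    finally show ?thesis using T by (simp add: m_def)
  qed
  finally show ?thesis by (simp add: I_def)
qed

lemma powr_add_le:
  fixes y z r :: real
  assumes "y \<ge> 0" "z \<ge> 0" "r > 0"
  shows "(y + z) powr r \<le> 2 powr r * (y powr r + z powr r)"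
proof -
  have "(y + z) powr r \<le> (2 * max y z) powr r" using assms by (intro powr_mono2) auto
  also have "\<dots> = 2 powr r * max y z powr r" using assms by (intro powr_mult)
  also have "max y z powr r \<le> y powr r + z powr r" by (auto simp: max_def)
  finally show ?thesis by simp
qed

lemma sum_half_power_distance:
  "finite S \<Longrightarrow> (\<Sum>j\<in>S. (1 / 2 :: real) ^ ((j - k) + (k - j))) \<le> 4"
proof -
  assume S: "finite S"
  have "(\<Sum>j\<in>S. (1 / 2 :: real) ^ ((j - k) + (k - j))) =
      (\<Sum>j\<in>{j\<in>S. j \<le> k}. (1 / 2) ^ ((j - k) + (k - j))) + (\<Sum>j\<in>{j\<in>S. j > k}. (1 / 2) ^ ((j - k) + (k - j)))"
    using S by (subst sum.union_disjoint[symmetric]) (auto intro!: sum.cong)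
  also have "\<dots> \<le> 1 / (1 - 1 / 2) + 1 / (1 - 1 / 2)"
    using S by (intro add_mono geometric_sum_le inj_onI) auto
  finally show ?thesis by simp
qed

lemma esum_exp_minus: "(\<Sum>i\<in>A. b i * complex_of_real (exp (- \<sigma>) powr l i)) = esum A b l \<sigma>"
  by (simp add: esum_def exp_powr_real mult.commute)

definition muentz_sum :: "(nat \<Rightarrow> real) \<Rightarrow> (nat \<Rightarrow> complex) \<Rightarrow> nat \<Rightarrow> real \<Rightarrow> complex" where
  "muentz_sum l b n t = (\<Sum>i<n. b i * complex_of_real (t powr l i))"

lemma muentz_sum_exp: "muentz_sum l b n (exp (- \<sigma>)) = esum {..<n} b l \<sigma>"
  unfolding muentz_sum_def by (rule esum_exp_minus)

lemma borel_measurable_muentz_sum [measurable]: "muentz_sum l b n \<in> borel_measurable borel"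
  unfolding muentz_sum_def by measurable

context clusters
begin

text \<open>The substitution \<open>t = exp (- \<sigma>)\<close>. For \<open>\<sigma>\<close> between \<open>1 / scale k\<close> and \<open>(1 + T) / scale k\<close> the number \<open>1 - t\<close> is
comparable to \<open>1 / scale k\<close>, hence the weight \<open>(1 - t) powr (\<alpha> - 1)\<close> to \<open>scale k powr (1 - \<alpha>)\<close>.\<close>

lemma window_integral_le:
  assumes \<alpha>: "\<alpha> > 0" and r: "r > 1" and T: "T \<ge> 1"
  shows "\<exists>C>0. \<forall>b J k. ennreal (scale k powr (- \<alpha>) * integral {0..T} (\<lambda>s. norm (rescaled_sum b J k s) powr r))
    \<le> ennreal C * (\<integral>\<^sup>+t. ennreal (norm (muentz_sum l b (m J) t) powr r * (1 - t) powr (\<alpha> - 1)) *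
        indicator {exp (- (1 + T) / scale k)..exp (- 1 / scale k)} t \<partial>lborel)"
proof -
  define g0 where "g0 = exp (- (1 + T) / scale 0)"
  define c where "c = g0 * min (g0 powr (\<alpha> - 1)) ((1 + T) powr (\<alpha> - 1))"
  have g0: "0 < g0" "g0 \<le> 1" using T by (auto simp: g0_def divide_nonpos_pos)
  have c: "c > 0" using g0 T by (simp add: c_def)
  show ?thesis
  proof (intro exI[of _ "1 / c"] conjI allI)
    show "1 / c > 0" using c by simp
    fix b J k
    define \<Lambda> where "\<Lambda> = scale k"
    have \<Lambda>: "\<Lambda> > 0" "\<Lambda> \<ge> scale 0"
      using lacunary_strict_mono[OF lacunary_scale q] by (auto simp: \<Lambda>_def strict_mono_less_eq)
    define g where "g = (\<lambda>x. exp (- (1 + T - x) / \<Lambda>))"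
    define \<phi> where "\<phi> = (\<lambda>t. norm (muentz_sum l b (m J) t) powr r * (1 - t) powr (\<alpha> - 1))"
    have [measurable]: "\<phi> \<in> borel_measurable borel" unfolding \<phi>_def by measurable
    have subst: "(\<integral>\<^sup>+t. ennreal (\<phi> t) * indicator {g 0..g T} t \<partial>lborel) =
        (\<integral>\<^sup>+x. ennreal (\<phi> (g x) * (g x / \<Lambda>)) * indicator {0..T} x \<partial>lborel)"
    proof -
      have "(\<integral>\<^sup>+t. ennreal (\<phi> t * indicator {g 0..g T} t) \<partial>lborel) =
        (\<integral>\<^sup>+x. ennreal (\<phi> (g x) * (g x / \<Lambda>) * indicator {0..T} x) \<partial>lborel)"
      proof (rule nn_integral_substitution)
        show "set_borel_measurable borel {g 0..g T} \<phi>"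
          unfolding set_borel_measurable_def by measurable
        show "(g has_real_derivative g x / \<Lambda>) (at x)" for x
          unfolding g_def using \<Lambda> by (auto intro!: derivative_eq_intros simp: divide_simps)
        show "continuous_on {0..T} (\<lambda>x. g x / \<Lambda>)"
          unfolding g_def using \<Lambda> by (intro continuous_intros) auto
      qed (use \<Lambda> T in \<open>auto simp: g_def\<close>)
      then show ?thesis unfolding ennreal_mult_indicator .
    qed
    have lower: "c * \<Lambda> powr (- \<alpha>) * norm (rescaled_sum b J k (T - x)) powr r \<le> \<phi> (g x) * (g x / \<Lambda>)"
      if x: "x \<in> {0..T}" for x
    proof -
      define \<sigma> where "\<sigma> = (1 + T - x) / \<Lambda>"
      have \<sigma>: "1 / \<Lambda> \<le> \<sigma>" "\<sigma> \<le> (1 + T) / \<Lambda>" using x \<Lambda> by (auto simp: \<sigma>_def divide_right_mono)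
      have "1 / \<Lambda> > 0" using \<Lambda> by simp
      then have \<sigma>0: "\<sigma> > 0" using \<sigma> by linarith
      have gx: "g x = exp (- \<sigma>)" by (simp only: g_def \<sigma>_def minus_divide_left)
      have "\<sigma> \<le> (1 + T) / scale 0"
        using \<sigma>(2) \<Lambda> T by (elim order_trans) (intro divide_left_mono, auto)
      then have gg0: "g0 \<le> g x" by (simp only: gx g0_def minus_divide_left[symmetric] exp_le_cancel_iff neg_le_iff_le)
      have "1 - \<sigma> \<le> exp (- \<sigma>)" using exp_ge_add_one_self[of "- \<sigma>"] by simp
      then have up: "1 - g x \<le> (1 + T) / \<Lambda>" using \<sigma> gx by linarith
      have "g x * (1 + \<sigma>) \<le> g x * exp \<sigma>" by (intro mult_left_mono) (auto simp: gx)
      also have "\<dots> = 1" by (simp add: gx exp_minus)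
      finally have "g x * \<sigma> \<le> 1 - g x" by (simp add: algebra_simps)
      moreover have "g0 * (1 / \<Lambda>) \<le> g x * \<sigma>" using gg0 g0 \<sigma> \<Lambda> by (intro mult_mono) auto
      ultimately have low: "g0 / \<Lambda> \<le> 1 - g x" by simp
      define w where "w = \<Lambda> * (1 - g x)"
      have w: "g0 \<le> w" "w \<le> 1 + T" using up low \<Lambda> by (auto simp: w_def field_simps)
      have w1: "min (g0 powr (\<alpha> - 1)) ((1 + T) powr (\<alpha> - 1)) \<le> w powr (\<alpha> - 1)"
      proof (cases "\<alpha> \<ge> 1")
        case True
        then have "g0 powr (\<alpha> - 1) \<le> w powr (\<alpha> - 1)" using w g0 by (intro powr_mono2) auto
        then show ?thesis by simp
      next
        case False
        then have "(1 + T) powr (\<alpha> - 1) \<le> w powr (\<alpha> - 1)" using w g0 by (intro powr_mono2') auto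
        then show ?thesis by simp
      qed
      have "1 - g x = w / \<Lambda>" using \<Lambda> by (simp add: w_def)
      then have e1: "(1 - g x) powr (\<alpha> - 1) = w powr (\<alpha> - 1) * \<Lambda> powr (1 - \<alpha>)"
        using \<Lambda> w g0 by (simp add: powr_divide powr_minus_divide[symmetric] divide_powr_uminus)
      have e2: "\<Lambda> powr (1 - \<alpha>) / \<Lambda> = \<Lambda> powr (- \<alpha>)"
        using \<Lambda> by (simp add: powr_diff powr_minus field_simps)
      have "(1 - g x) powr (\<alpha> - 1) * (g x / \<Lambda>) = (g x * w powr (\<alpha> - 1)) * (\<Lambda> powr (1 - \<alpha>) / \<Lambda>)"
        unfolding e1 by simp
      then have "(1 - g x) powr (\<alpha> - 1) * (g x / \<Lambda>) = (g x * w powr (\<alpha> - 1)) * \<Lambda> powr (- \<alpha>)"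
        unfolding e2 .
      moreover have "c \<le> g x * w powr (\<alpha> - 1)"
        unfolding c_def using gg0 w1 g0 T by (intro mult_mono) auto
      ultimately have 1: "c * \<Lambda> powr (- \<alpha>) \<le> (1 - g x) powr (\<alpha> - 1) * (g x / \<Lambda>)"
        by (simp add: mult_right_mono)
      have "1 / \<Lambda> + 1 / \<Lambda> * (T - x) = \<sigma>" by (simp add: \<sigma>_def add_divide_distrib diff_divide_distrib)
      then have "rescaled_sum b J k (T - x) = muentz_sum l b (m J) (g x)"
        by (simp only: rescaled_sum_def gx muentz_sum_exp \<Lambda>_def[symmetric])
      then show ?thesis using mult_right_mono[OF 1, of "norm (rescaled_sum b J k (T - x)) powr r"]
        by (simp add: \<phi>_def mult_ac)
    qed
    define G where "G = (\<lambda>s. norm (rescaled_sum b J k s) powr r)"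
    have contG: "continuous_on X G" for X
      unfolding G_def rescaled_sum_def using r by (intro continuous_on_powr' continuous_intros) auto
    have [measurable]: "G \<in> borel_measurable borel" using contG by (rule borel_measurable_continuous_onI)
    have "ennreal (integral {0..T} G) = (\<integral>\<^sup>+s. ennreal (G s) * indicator {0..T} s \<partial>lborel)"
    proof -
      have "(\<integral>\<^sup>+s. ennreal (G s * indicator {0..T} s) \<partial>lborel) = ennreal (integral {0..T} G)"
        by (subst mult.commute, rule nn_integral_has_integral_lebesgue)
          (auto simp: G_def[symmetric] intro!: integrable_integral integrable_continuous_interval contG, simp add: G_def)
      then show ?thesis unfolding ennreal_mult_indicator by simp
    qed
    also have "\<dots> = (\<integral>\<^sup>+x. ennreal (G (T - x)) * indicator {0..T} (T - x) \<partial>lborel)"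
      by (subst nn_integral_real_affine[where c = "- 1" and t = T]) auto
    also have "\<dots> = (\<integral>\<^sup>+x. ennreal (G (T - x)) * indicator {0..T} x \<partial>lborel)"
      by (intro nn_integral_cong) (auto simp: indicator_def)
    finally have Geq: "ennreal (integral {0..T} G) = (\<integral>\<^sup>+x. ennreal (G (T - x)) * indicator {0..T} x \<partial>lborel)" .
    have "ennreal (c * \<Lambda> powr (- \<alpha>) * integral {0..T} G) =
        (\<integral>\<^sup>+x. ennreal (c * \<Lambda> powr (- \<alpha>)) * (ennreal (G (T - x)) * indicator {0..T} x) \<partial>lborel)"
      using c by (subst nn_integral_cmult) (auto simp: Geq[symmetric] ennreal_mult')
    also have "\<dots> \<le> (\<integral>\<^sup>+x. ennreal (\<phi> (g x) * (g x / \<Lambda>)) * indicator {0..T} x \<partial>lborel)"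
    proof (intro nn_integral_mono)
      fix x
      show "ennreal (c * \<Lambda> powr (- \<alpha>)) * (ennreal (G (T - x)) * indicator {0..T} x)
          \<le> ennreal (\<phi> (g x) * (g x / \<Lambda>)) * indicator {0..T} x"
        using lower[of x] c by (auto simp: indicator_def G_def ennreal_mult'[symmetric] intro!: ennreal_leI)
    qed
    also have "\<dots> = (\<integral>\<^sup>+t. ennreal (\<phi> t) * indicator {g 0..g T} t \<partial>lborel)" by (rule subst[symmetric])
    finally have main: "ennreal (c * \<Lambda> powr (- \<alpha>) * integral {0..T} G) \<le> (\<integral>\<^sup>+t. ennreal (\<phi> t) * indicator {g 0..g T} t \<partial>lborel)" .
    have IG: "integral {0..T} G \<ge> 0"
      by (intro integral_nonneg integrable_continuous_interval contG) (simp add: G_def)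
    have "ennreal (scale k powr (- \<alpha>) * integral {0..T} G) = ennreal (1 / c) * ennreal (c * \<Lambda> powr (- \<alpha>) * integral {0..T} G)"
      using c IG by (subst ennreal_mult[symmetric]) (auto simp: \<Lambda>_def)
    also have "\<dots> \<le> ennreal (1 / c) * (\<integral>\<^sup>+t. ennreal (\<phi> t) * indicator {g 0..g T} t \<partial>lborel)"
      by (intro mult_left_mono main) auto
    finally show "ennreal (scale k powr (- \<alpha>) * integral {0..T} (\<lambda>s. norm (rescaled_sum b J k s) powr r))
      \<le> ennreal (1 / c) * (\<integral>\<^sup>+t. ennreal (norm (muentz_sum l b (m J) t) powr r * (1 - t) powr (\<alpha> - 1)) *
          indicator {exp (- (1 + T) / scale k)..exp (- 1 / scale k)} t \<partial>lborel)"
      by (simp add: G_def \<phi>_def g_def \<Lambda>_def)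
  qed
qed

text \<open>The scales are lacunary, so the windows of the different clusters overlap boundedly often.\<close>

lemma sum_indicator_windows_le:
  assumes T: "T \<ge> 1" and t: "0 < t"
  shows "(\<Sum>k<J. indicator {exp (- (1 + T) / scale k)..exp (- 1 / scale k)} t :: real) \<le> (1 + T) * (2 / (1 - 1 / q))"
proof -
  let ?W = "\<lambda>k. {exp (- (1 + T) / scale k)..exp (- 1 / scale k)}"
  have q': "1 - 1 / q > 0" using q by simp
  show ?thesis
  proof (cases "t < 1")
    case False
    have notin: "t \<notin> ?W k" for k
    proof
      assume "t \<in> ?W k"
      then have "t \<le> exp (- 1 / scale k)" by simp
      also have "\<dots> < 1" by simp
      finally show False using False by simp
    qed
    have "(\<Sum>k<J. indicator (?W k) t :: real) = 0" by (intro sum.neutral ballI indicator_simps notin)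
    moreover have "(1 + T) * (2 / (1 - 1 / q)) \<ge> 0" using T q' by (intro mult_nonneg_nonneg) auto
    ultimately show ?thesis by linarith
  next
    case True
    define \<sigma> where "\<sigma> = - ln t"
    have \<sigma>: "\<sigma> > 0" "t = exp (- \<sigma>)" using t True by (auto simp: \<sigma>_def)
    have "indicator (?W k) t \<le> (1 + T) * min ((scale k / (1 / \<sigma>)) powr 1) ((1 / \<sigma> / scale k) powr 1)" for k
    proof (cases "t \<in> ?W k")
      case True
      then have "- (1 + T) / scale k \<le> - \<sigma>" "- \<sigma> \<le> - 1 / scale k" by (simp_all add: \<sigma>(2))
      then have u: "1 \<le> scale k * \<sigma>" "scale k * \<sigma> \<le> 1 + T"
        using scale_pos(1)[of k] by (simp_all add: field_simps)
      have a: "1 \<le> (1 + T) * (scale k * \<sigma>)" using u T mult_mono[of 1 "1 + T" 1 "scale k * \<sigma>"] by simp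
      have b: "1 \<le> (1 + T) * (1 / (scale k * \<sigma>))" using u T by (simp add: le_divide_eq)
      have "1 \<le> (1 + T) * min (scale k * \<sigma>) (1 / (scale k * \<sigma>))" using a b by (simp add: min_def)
      then show ?thesis using True \<sigma> by (simp add: mult.commute)
    qed (use T \<sigma> in auto)
    then have "(\<Sum>k<J. indicator (?W k) t) \<le> (\<Sum>k<J. (1 + T) * min ((scale k / (1 / \<sigma>)) powr 1) ((1 / \<sigma> / scale k) powr 1))"
      by (rule sum_mono)
    also have "\<dots> \<le> (1 + T) * (2 / (1 - (1 / q) powr 1))"
      unfolding sum_distrib_left[symmetric] using T \<sigma> q
      by (intro mult_left_mono lacunary_sum_bound[OF lacunary_scale]) auto
    finally show ?thesis using q by simp
  qed
qed

lemma sum_window_integrals_le: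
  assumes \<alpha>: "\<alpha> > 0" and r: "r > 1" and T: "T \<ge> 1"
  shows "\<exists>C>0. \<forall>b J R. R \<ge> 0 \<longrightarrow> (\<integral>\<^sup>+t. ennreal (norm (muentz_sum l b (m J) t) powr r) \<partial>nu (\<alpha> - 1)) \<le> ennreal R \<longrightarrow>
    (\<Sum>k<J. scale k powr (- \<alpha>) * integral {0..T} (\<lambda>s. norm (rescaled_sum b J k s) powr r)) \<le> C * R"
proof -
  obtain C where C: "C > 0" "\<And>b J k. ennreal (scale k powr (- \<alpha>) * integral {0..T} (\<lambda>s. norm (rescaled_sum b J k s) powr r))
    \<le> ennreal C * (\<integral>\<^sup>+t. ennreal (norm (muentz_sum l b (m J) t) powr r * (1 - t) powr (\<alpha> - 1)) *
        indicator {exp (- (1 + T) / scale k)..exp (- 1 / scale k)} t \<partial>lborel)"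
    using window_integral_le[OF assms] by blast
  define B where "B = (1 + T) * (2 / (1 - 1 / q))"
  have B: "B > 0" using T q by (simp add: B_def)
  show ?thesis
  proof (intro exI[of _ "C * B"] conjI allI impI)
    show "C * B > 0" using C B by simp
    fix b J R assume R: "R \<ge> 0" and le: "(\<integral>\<^sup>+t. ennreal (norm (muentz_sum l b (m J) t) powr r) \<partial>nu (\<alpha> - 1)) \<le> ennreal R"
    define \<phi> where "\<phi> = (\<lambda>t. norm (muentz_sum l b (m J) t) powr r * (1 - t) powr (\<alpha> - 1))"
    have [measurable]: "\<phi> \<in> borel_measurable borel" unfolding \<phi>_def by measurable
    define W where "W = (\<lambda>k. {exp (- (1 + T) / scale k)..exp (- 1 / scale k)})"
    have [measurable]: "W k \<in> sets borel" for k by (simp add: W_def)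
    have I: "integral {0..T} (\<lambda>s. norm (rescaled_sum b J k s) powr r) \<ge> 0" for k
      unfolding rescaled_sum_def using r by (intro integral_nonneg integrable_continuous_interval continuous_on_powr' continuous_intros) auto
    have "ennreal (\<Sum>k<J. scale k powr (- \<alpha>) * integral {0..T} (\<lambda>s. norm (rescaled_sum b J k s) powr r)) =
      (\<Sum>k<J. ennreal (scale k powr (- \<alpha>) * integral {0..T} (\<lambda>s. norm (rescaled_sum b J k s) powr r)))"
      using I by (intro sum_ennreal[symmetric]) auto
    also have "\<dots> \<le> (\<Sum>k<J. ennreal C * (\<integral>\<^sup>+t. ennreal (\<phi> t) * indicator (W k) t \<partial>lborel))"
      unfolding \<phi>_def W_def by (intro sum_mono C)
    also have "\<dots> = ennreal C * (\<integral>\<^sup>+t. (\<Sum>k<J. ennreal (\<phi> t) * indicator (W k) t) \<partial>lborel)"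
      by (subst nn_integral_sum) (auto simp: sum_distrib_left)
    also have "(\<integral>\<^sup>+t. (\<Sum>k<J. ennreal (\<phi> t) * indicator (W k) t) \<partial>lborel)
        \<le> (\<integral>\<^sup>+t. ennreal B * (ennreal ((1 - t) powr (\<alpha> - 1)) * ennreal (norm (muentz_sum l b (m J) t) powr r) * indicator {0..1} t) \<partial>lborel)"
    proof (intro nn_integral_mono)
      fix t
      show "(\<Sum>k<J. ennreal (\<phi> t) * indicator (W k) t)
         \<le> ennreal B * (ennreal ((1 - t) powr (\<alpha> - 1)) * ennreal (norm (muentz_sum l b (m J) t) powr r) * indicator {0..1} t)"
      proof (cases "0 < t \<and> t \<le> 1")
        case True
        have "(\<Sum>k<J. ennreal (\<phi> t) * indicator (W k) t) = ennreal (\<phi> t) * ennreal (\<Sum>k<J. indicator (W k) t)"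
          by (subst sum_ennreal[symmetric]) (simp_all add: sum_distrib_left ennreal_indicator del: sum_ennreal)
        also have "\<dots> \<le> ennreal (\<phi> t) * ennreal B"
          using sum_indicator_windows_le[OF T, of t J] True unfolding W_def B_def
          by (intro mult_left_mono ennreal_leI) auto
        finally show ?thesis using True by (simp add: \<phi>_def ennreal_mult'' mult_ac)
      next
        case False
        have W01: "W k \<subseteq> {0<..1}" for k
        proof
          fix x assume "x \<in> W k"
          then have "exp (- (1 + T) / scale k) \<le> x" "x \<le> exp (- 1 / scale k)" by (auto simp: W_def)
          moreover have "0 < exp (- (1 + T) / scale k)" "exp (- 1 / scale k) \<le> 1" by auto
          ultimately have "0 < x" "x \<le> 1" by linarith+
          then show "x \<in> {0<..1}" by simp
        qed
        have "t \<notin> W k" for k using W01[of k] False by auto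
        then show ?thesis by simp
      qed
    qed
    also have "\<dots> = ennreal B * (\<integral>\<^sup>+t. ennreal (norm (muentz_sum l b (m J) t) powr r) \<partial>nu (\<alpha> - 1))"
      by (subst nn_integral_cmult, simp, subst nn_integral_nu) auto
    also have "\<dots> \<le> ennreal B * ennreal R" by (intro mult_left_mono le) auto
    finally have "ennreal (\<Sum>k<J. scale k powr (- \<alpha>) * integral {0..T} (\<lambda>s. norm (rescaled_sum b J k s) powr r))
        \<le> ennreal C * (ennreal B * ennreal R)" by (simp add: mult_left_mono)
    also have "\<dots> = ennreal (C * B * R)" using C B R by (simp add: ennreal_mult mult.assoc)
    finally show "(\<Sum>k<J. scale k powr (- \<alpha>) * integral {0..T} (\<lambda>s. norm (rescaled_sum b J k s) powr r)) \<le> C * B * R"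
      using C B R by (subst (asm) ennreal_le_iff) auto
  qed
qed


text \<open>In the inequality of \<open>cluster_norm_le_local_mean\<close> with \<open>\<epsilon> = 1 / 16\<close>, the operator norm of the remainder in the
weighted sequence space is at most \<open>4 / 16\<close> by the Schur test. After the \<open>r\<close>-th power, with its factor
\<open>2 powr r\<close>, at most one half of the left-hand side occurs on the right. The left-hand side is a finite sum
and the remainder can be subtracted.\<close>

lemma sum_cluster_norm_le:
  assumes \<alpha>: "\<alpha> > 0" and r: "r > 1"
  shows "\<exists>C>0. \<forall>b J R. R \<ge> 0 \<longrightarrow> (\<integral>\<^sup>+t. ennreal (norm (muentz_sum l b (m J) t) powr r) \<partial>nu (\<alpha> - 1)) \<le> ennreal R \<longrightarrow>
    (\<Sum>k<J. (scale k powr (- (\<alpha> / r)) * cluster_norm b k) powr r) \<le> C * R"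
proof -
  define a where "a = \<alpha> / r"
  have a: "a > 0" "a * r = \<alpha>" using \<alpha> r by (auto simp: a_def)
  obtain C T where C: "C > 0" "T \<ge> 1" and main: "\<And>b J k. k < J \<Longrightarrow>
      cluster_norm b k \<le> C * integral {0..T} (\<lambda>s. norm (rescaled_sum b J k s))
        + 1 / 16 * (\<Sum>j<J. (1 / 2) ^ ((j - k) + (k - j)) * ratio k j powr a * cluster_norm b j)"
    using cluster_norm_le_local_mean[of "1 / 16" a] a by auto
  obtain C' where C': "C' > 0" "\<And>b J R. R \<ge> 0 \<Longrightarrow>
      (\<integral>\<^sup>+t. ennreal (norm (muentz_sum l b (m J) t) powr r) \<partial>nu (\<alpha> - 1)) \<le> ennreal R \<Longrightarrow>
      (\<Sum>k<J. scale k powr (- \<alpha>) * integral {0..T} (\<lambda>s. norm (rescaled_sum b J k s) powr r)) \<le> C' * R"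
    using sum_window_integrals_le[OF \<alpha> r C(2)] by blast
  define C'' where "C'' = 2 * 2 powr r * (C powr r * T powr (r - 1)) * C'"
  show ?thesis
  proof (intro exI[of _ C''] conjI allI impI)
    show "C'' > 0" using C C' by (simp add: C''_def)
    fix b J R assume R: "R \<ge> 0" and le: "(\<integral>\<^sup>+t. ennreal (norm (muentz_sum l b (m J) t) powr r) \<partial>nu (\<alpha> - 1)) \<le> ennreal R"
    define x where "x = (\<lambda>k. scale k powr (- a) * cluster_norm b k)"
    define y where "y = (\<lambda>k. scale k powr (- a) * (C * integral {0..T} (\<lambda>s. norm (rescaled_sum b J k s))))"
    define A where "A = (\<lambda>k j. (1 / 2 :: real) ^ ((j - k) + (k - j)))"
    have cont: "continuous_on X (rescaled_sum b J k)" for X k unfolding rescaled_sum_def by (intro continuous_intros)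
    have x0: "x k \<ge> 0" for k unfolding x_def using cluster_norm_nonneg by simp
    have y0: "y k \<ge> 0" for k unfolding y_def using C
      by (intro mult_nonneg_nonneg integral_nonneg integrable_continuous_interval continuous_intros cont) auto
    have xy: "x k \<le> y k + 1 / 16 * (\<Sum>j<J. A k j * x j)" if "k < J" for k
    proof -
      have "x k \<le> scale k powr (- a) * (C * integral {0..T} (\<lambda>s. norm (rescaled_sum b J k s))
        + 1 / 16 * (\<Sum>j<J. (1 / 2) ^ ((j - k) + (k - j)) * ratio k j powr a * cluster_norm b j))"
        unfolding x_def by (intro mult_left_mono main that) auto
      also have "\<dots> = y k + 1 / 16 * (\<Sum>j<J. A k j * (scale k powr (- a) * ratio k j powr a) * cluster_norm b j)"
        by (simp add: y_def A_def distrib_left sum_distrib_left mult_ac)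
      also have "\<dots> \<le> y k + 1 / 16 * (\<Sum>j<J. A k j * scale j powr (- a) * cluster_norm b j)"
      proof (intro add_left_mono mult_left_mono sum_mono mult_right_mono cluster_norm_nonneg)
        fix j
        have "ratio k j powr a \<le> (scale k / scale j) powr a"
          using a ratio_bounds[of k j] by (intro powr_mono2) (auto simp: ratio_def)
        then have "scale k powr (- a) * ratio k j powr a \<le> scale k powr (- a) * (scale k / scale j) powr a"
          by (intro mult_left_mono) auto
        also have "\<dots> = scale j powr (- a)" by (simp add: powr_divide powr_minus field_simps)
        finally show "scale k powr (- a) * ratio k j powr a \<le> scale j powr (- a)" .
      qed (auto simp: A_def)
      finally show ?thesis by (simp add: x_def mult.assoc)
    qed
    have Ax0: "(\<Sum>j<J. A k j * x j) \<ge> 0" for k by (intro sum_nonneg mult_nonneg_nonneg x0) (auto simp: A_def)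
    have "(\<Sum>k<J. x k powr r) \<le> (\<Sum>k<J. 2 powr r * (y k powr r + (1 / 16) powr r * (\<Sum>j<J. A k j * x j) powr r))"
    proof (rule sum_mono)
      fix k assume "k \<in> {..<J}"
      then have "x k powr r \<le> (y k + 1 / 16 * (\<Sum>j<J. A k j * x j)) powr r"
        using xy[of k] x0 r by (intro powr_mono2) auto
      also have "\<dots> \<le> 2 powr r * (y k powr r + (1 / 16 * (\<Sum>j<J. A k j * x j)) powr r)"
        using y0 Ax0 r by (intro powr_add_le) auto
      also have "(1 / 16 * (\<Sum>j<J. A k j * x j)) powr r = (1 / 16) powr r * (\<Sum>j<J. A k j * x j) powr r"
        using Ax0 by (intro powr_mult)
      finally show "x k powr r \<le> 2 powr r * (y k powr r + (1 / 16) powr r * (\<Sum>j<J. A k j * x j) powr r)" .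
    qed
    also have "\<dots> = 2 powr r * (\<Sum>k<J. y k powr r) + 2 powr r * (1 / 16) powr r * (\<Sum>k<J. (\<Sum>j<J. A k j * x j) powr r)"
      by (simp add: sum.distrib sum_distrib_left distrib_left mult_ac)
    also have "(\<Sum>k<J. (\<Sum>j<J. A k j * x j) powr r) \<le> 4 powr r * (\<Sum>j<J. x j powr r)"
    proof (rule Schur_test_sum[OF _ _ r])
      show "(\<Sum>j<J. A k j) \<le> 4" for k unfolding A_def by (intro sum_half_power_distance) auto
      show "(\<Sum>k<J. A k j) \<le> 4" for j
        unfolding A_def using sum_half_power_distance[of "{..<J}" j] by (simp add: add.commute)
    qed (auto simp: A_def x0)
    also have "2 powr r * (1 / 16) powr r * (4 powr r * (\<Sum>j<J. x j powr r)) = (1 / 2) powr r * (\<Sum>j<J. x j powr r)"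
      by (simp add: powr_mult[symmetric] mult.assoc[symmetric])
    also have "(1 / 2) powr r * (\<Sum>j<J. x j powr r) \<le> (1 / 2) powr 1 * (\<Sum>j<J. x j powr r)"
      using r by (intro mult_right_mono powr_mono' sum_nonneg) auto
    finally have half: "(\<Sum>k<J. x k powr r) \<le> 2 * 2 powr r * (\<Sum>k<J. y k powr r)"
      by simp
    have yle: "y k powr r \<le> (C powr r * T powr (r - 1)) * (scale k powr (- \<alpha>) * integral {0..T} (\<lambda>s. norm (rescaled_sum b J k s) powr r))" for k
    proof -
      define I where "I = integral {0..T} (\<lambda>s. norm (rescaled_sum b J k s))"
      have I0: "I \<ge> 0" unfolding I_def
        by (intro integral_nonneg integrable_continuous_interval continuous_intros cont) auto
      have "I powr r \<le> T powr (r - 1) * integral {0..T} (\<lambda>s. norm (rescaled_sum b J k s) powr r)"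
        unfolding I_def using C r by (intro integral_powr_le continuous_intros cont) auto
      then have "scale k powr (- \<alpha>) * C powr r * I powr r \<le> scale k powr (- \<alpha>) * C powr r * (T powr (r - 1) * integral {0..T} (\<lambda>s. norm (rescaled_sum b J k s) powr r))"
        by (intro mult_left_mono) auto
      moreover have "y k powr r = scale k powr (- \<alpha>) * C powr r * I powr r"
        using C I0 a by (simp add: y_def I_def[symmetric] powr_mult powr_powr)
      ultimately show ?thesis by (simp add: mult_ac)
    qed
    have "(\<Sum>k<J. y k powr r) \<le> (C powr r * T powr (r - 1)) * (\<Sum>k<J. scale k powr (- \<alpha>) * integral {0..T} (\<lambda>s. norm (rescaled_sum b J k s) powr r))"
      unfolding sum_distrib_left by (intro sum_mono yle)
    also have "\<dots> \<le> (C powr r * T powr (r - 1)) * (C' * R)"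
      by (intro mult_left_mono C' R le) auto
    finally have "2 * 2 powr r * (\<Sum>k<J. y k powr r) \<le> 2 * 2 powr r * ((C powr r * T powr (r - 1)) * (C' * R))"
      by (intro mult_left_mono) auto
    with half have "(\<Sum>k<J. x k powr r) \<le> 2 * 2 powr r * ((C powr r * T powr (r - 1)) * (C' * R))"
      by (rule order_trans)
    then have "(\<Sum>k<J. x k powr r) \<le> C'' * R" by (simp add: C''_def mult_ac)
    then show "(\<Sum>k<J. (scale k powr (- (\<alpha> / r)) * cluster_norm b k) powr r) \<le> C'' * R"
      by (simp add: x_def a_def)
  qed
qed

text \<open>Differences remove all other exponents of the cluster. The bound depends on the exponents, which is harmless, as it
is only used to extract convergent subsequences.\<close>

lemma coefficient_le_cluster_norm:
  assumes inj: "inj l" and i: "i \<in> cluster k"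
  shows "\<exists>E\<ge>0. \<forall>b. norm (b i) \<le> E * cluster_norm b k"
proof -
  define u where "u = (\<lambda>i. l i * (1 / scale k))"
  define \<theta>s where "\<theta>s = map u (filter (\<lambda>j. j \<noteq> i) [m k..<m (Suc k)])"
  define w where "w = exp (- l i * (1 / scale k)) * (\<Prod>\<theta>\<leftarrow>\<theta>s. exp (- u i * 1) - exp (- \<theta> * 1))"
  have \<theta>s_pos: "\<forall>\<theta>\<in>set \<theta>s. \<theta> \<ge> 0" using l_pos by (auto simp: \<theta>s_def u_def less_imp_le)
  have "w \<noteq> 0"
    using inj by (auto simp: w_def \<theta>s_def u_def prod_list_zero_iff inj_eq)
  have "norm (b i) \<le> 2 ^ length \<theta>s / \<bar>w\<bar> * cluster_norm b k" for b
  proof -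
    define e where "e = (\<lambda>j. b j * complex_of_real (exp (- l j * (1 / scale k))) *
        complex_of_real (\<Prod>\<theta>\<leftarrow>\<theta>s. exp (- u j * 1) - exp (- \<theta> * 1)))"
    have zero: "e j = 0" if "j \<in> cluster k" "j \<noteq> i" for j
      using that by (auto simp: e_def \<theta>s_def prod_list_zero_iff cluster_def)
    have "diffs 1 \<theta>s (cluster_part b k) 0 = (\<Sum>j\<in>cluster k. e j)"
      unfolding cluster_part_esum diffs_esum by (simp add: esum_def e_def u_def)
    also have "\<dots> = (\<Sum>j\<in>{i}. e j)" using i zero by (intro sum.mono_neutral_right) (auto simp: cluster_def)
    also have "\<dots> = b i * complex_of_real w" by (simp add: e_def w_def mult.assoc)
    finally have "norm (b i) * \<bar>w\<bar> = norm (diffs 1 \<theta>s (cluster_part b k) 0)" by (simp add: norm_mult)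
    also have "\<dots> \<le> 2 ^ length \<theta>s * cluster_norm b k * wt decay (growth k) 0"
      using growth_bounds[of k] decay_nonneg \<theta>s_pos by (intro diffs_wt_bound cluster_part_bound) auto
    also have "wt decay (growth k) 0 = 1" by (simp add: wt_def)
    finally show ?thesis using \<open>w \<noteq> 0\<close> by (simp add: field_simps)
  qed
  then show ?thesis by (intro exI[of _ "2 ^ length \<theta>s / \<bar>w\<bar>"]) auto
qed

text \<open>Rates of decay for the cluster sums. The first cluster is a single power, which has the exact rate \<open>l 0\<close>.\<close>

definition rate :: "nat \<Rightarrow> real" where
  "rate k = (if k = 0 then l 0 else decay * scale k)"

lemma decay_eq: "decay * q = (1 + q) / 2" "decay \<le> 1"
  using q by (auto simp: decay_def field_simps)

lemma rate_bounds: "decay * scale k \<le> rate k" "rate k \<le> scale k"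
proof -
  have "scale 0 = l 0" by (simp add: scale_def m_0)
  moreover have "decay * scale k \<le> scale k" using mult_right_mono[OF decay_eq(2), of "scale k"] by simp
  ultimately show "decay * scale k \<le> rate k" "rate k \<le> scale k"
    by (cases "k = 0"; simp add: rate_def)+
qed

lemma lacunary_rate: "lacunary ((1 + q) / 2) rate"
  unfolding lacunary_def
proof safe
  fix k
  show "0 < rate k" using rate_bounds(1)[of k] mult_pos_pos[OF c scale_pos(1)[of k]] by linarith
  have qs: "q * scale k \<le> scale (Suc k)" using lacunary_scale by (simp add: lacunary_def)
  have r': "rate (Suc k) = decay * scale (Suc k)" by (simp add: rate_def)
  show "(1 + q) / 2 * rate k \<le> rate (Suc k)"
  proof (cases "k = 0")
    case True
    have "(1 + q) / 2 * rate k \<le> (1 + q) / 2 * scale k" using q rate_bounds by (intro mult_left_mono) auto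
    also have "\<dots> = decay * (q * scale k)" by (simp add: decay_eq(1)[symmetric])
    also have "\<dots> \<le> decay * scale (Suc k)" using qs decay_nonneg by (intro mult_left_mono) auto
    finally show ?thesis by (simp add: r')
  next
    case False
    have "(1 + q) / 2 * rate k \<le> q * rate k" using q \<open>0 < rate k\<close> by (intro mult_right_mono) auto
    also have "\<dots> = decay * (q * scale k)" using False by (simp add: rate_def)
    also have "\<dots> \<le> decay * scale (Suc k)" using qs decay_nonneg by (intro mult_left_mono) auto
    finally show ?thesis by (simp add: r')
  qed
qed

lemma esum_cluster_rate_bound:
  assumes "\<sigma> \<ge> 0"
  shows "norm (esum (cluster k) b l \<sigma>) \<le> exp (D * (1 + q)) * cluster_norm b k * exp (- rate k * \<sigma>)"
proof (cases "k = 0")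
  case True
  have cluster0: "cluster 0 = {0}" using m_0 m_1 by (auto simp: cluster_def)
  have "norm (esum (cluster 0) b l 0) \<le> exp (D * (1 + q)) * cluster_norm b 0"
    using esum_cluster_bound[of 0 0 b] by simp
  then have "norm (b 0) \<le> exp (D * (1 + q)) * cluster_norm b 0" by (simp add: cluster0 esum_def)
  then show ?thesis using True by (simp add: cluster0 esum_def rate_def norm_mult mult_right_mono)
next
  case False
  then show ?thesis using esum_cluster_bound[OF assms, of k b] by (simp add: rate_def)
qed

lemma n_le_m: "n \<le> m n"
  using m_mono by (simp add: strict_mono_imp_increasing)

text \<open>The outcome of the analysis of exponential sums: a Muentz polynomial has a majorant \<open>\<Sum>j. M j * t powr rate j\<close> with
nonnegative coefficients, and their weighted sum is controlled by the \<open>L\<^sup>r\<close> norm of the polynomial.\<close>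

lemma block_estimate:
  assumes \<alpha>: "\<alpha> > 0" and r: "r > 1" and inj: "inj l"
  obtains N C M where "C > 0"
    and "\<And>b j. 0 \<le> M b j" and "\<And>b j. M b j \<le> C * (\<Sum>i<N j. norm (b i))"
    and "\<And>b n \<sigma>. (\<And>i. i \<ge> n \<Longrightarrow> b i = 0) \<Longrightarrow> \<sigma> \<ge> 0 \<Longrightarrow>
      norm (esum {..<n} b l \<sigma>) \<le> (\<Sum>j<n. M b j * exp (- rate j * \<sigma>))"
    and "\<And>b n R. (\<And>i. i \<ge> n \<Longrightarrow> b i = 0) \<Longrightarrow> R \<ge> 0 \<Longrightarrow>
      (\<integral>\<^sup>+t. ennreal (norm (muentz_sum l b n t) powr r) \<partial>nu (\<alpha> - 1)) \<le> ennreal R \<Longrightarrow>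
      (\<Sum>j<n. (rate j powr (- (\<alpha> / r)) * M b j) powr r) \<le> C * R"
    and "\<And>i. \<exists>k E. k \<le> i \<and> 0 \<le> E \<and> (\<forall>b. norm (b i) \<le> E * M b k)"
proof -
  define C0 where "C0 = exp (D * (1 + q))"
  have C0: "C0 > 0" by (simp add: C0_def)
  define M where "M = (\<lambda>b j. C0 * cluster_norm b j)"
  obtain C1 where C1: "C1 > 0" "\<And>b J R. R \<ge> 0 \<Longrightarrow>
      (\<integral>\<^sup>+t. ennreal (norm (muentz_sum l b (m J) t) powr r) \<partial>nu (\<alpha> - 1)) \<le> ennreal R \<Longrightarrow>
      (\<Sum>k<J. (scale k powr (- (\<alpha> / r)) * cluster_norm b k) powr r) \<le> C1 * R"
    using sum_cluster_norm_le[OF \<alpha> r] by blast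
  define C2 where "C2 = (decay powr (- (\<alpha> / r)) * C0) powr r"
  have C2: "C2 > 0" using c C0 by (simp add: C2_def)
  have ext: "(\<Sum>i<m n. b i * g i) = (\<Sum>i<n. b i * g i)" if "\<And>i. i \<ge> n \<Longrightarrow> b i = 0"
    for b g :: "nat \<Rightarrow> complex" and n
    using that n_le_m[of n] by (intro sum.mono_neutral_right) auto
  show ?thesis
  proof (rule that)
    show "C0 + C1 * C2 > 0" using C0 C1 C2 by (simp add: add_pos_pos)
    show "0 \<le> M b j" for b j using cluster_norm_nonneg C0 by (simp add: M_def)
    show "M b j \<le> (C0 + C1 * C2) * (\<Sum>i<m (Suc j). norm (b i))" for b j
    proof -
      have "cluster_norm b j \<le> (\<Sum>i\<in>cluster j. norm (b i))" by (rule cluster_norm_le_sum)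
      also have "\<dots> \<le> (\<Sum>i<m (Suc j). norm (b i))" by (intro sum_mono2) (auto simp: cluster_def)
      finally show ?thesis unfolding M_def using C0 C1 C2 cluster_norm_nonneg by (intro mult_mono) auto
    qed
    show "norm (esum {..<n} b l \<sigma>) \<le> (\<Sum>j<n. M b j * exp (- rate j * \<sigma>))"
      if "\<And>i. i \<ge> n \<Longrightarrow> b i = 0" "\<sigma> \<ge> 0" for b n \<sigma>
    proof -
      have "esum {..<n} b l \<sigma> = esum {..<m n} b l \<sigma>"
        unfolding esum_def by (rule ext[symmetric]) (rule that)
      also have "\<dots> = (\<Sum>j<n. esum (cluster j) b l \<sigma>)" by (rule esum_cluster_sum)
      also have "norm \<dots> \<le> (\<Sum>j<n. M b j * exp (- rate j * \<sigma>))"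
        unfolding M_def C0_def by (intro sum_norm_le esum_cluster_rate_bound that)
      finally show ?thesis .
    qed
    show "(\<Sum>j<n. (rate j powr (- (\<alpha> / r)) * M b j) powr r) \<le> (C0 + C1 * C2) * R"
      if b: "\<And>i. i \<ge> n \<Longrightarrow> b i = 0" and R: "R \<ge> 0"
      and le: "(\<integral>\<^sup>+t. ennreal (norm (muentz_sum l b n t) powr r) \<partial>nu (\<alpha> - 1)) \<le> ennreal R" for b n R
    proof -
      have "muentz_sum l b (m n) = muentz_sum l b n" unfolding muentz_sum_def by (intro HOL.ext ext b)
      then have "(\<Sum>k<n. (scale k powr (- (\<alpha> / r)) * cluster_norm b k) powr r) \<le> C1 * R"
        using le R by (intro C1) auto
      moreover have "(\<Sum>j<n. (rate j powr (- (\<alpha> / r)) * M b j) powr r)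
          \<le> (\<Sum>j<n. C2 * (scale j powr (- (\<alpha> / r)) * cluster_norm b j) powr r)"
      proof (rule sum_mono)
        fix j
        have "rate j powr (- (\<alpha> / r)) \<le> (decay * scale j) powr (- (\<alpha> / r))"
          using rate_bounds(1)[of j] c \<alpha> r by (intro powr_mono2') auto
        also have "\<dots> = decay powr (- (\<alpha> / r)) * scale j powr (- (\<alpha> / r))" using c by (intro powr_mult)
        finally have "rate j powr (- (\<alpha> / r)) * M b j \<le> (decay powr (- (\<alpha> / r)) * C0) * (scale j powr (- (\<alpha> / r)) * cluster_norm b j)"
        proof -
          assume le: "rate j powr (- (\<alpha> / r)) \<le> decay powr (- (\<alpha> / r)) * scale j powr (- (\<alpha> / r))"
          have "rate j powr (- (\<alpha> / r)) * M b j \<le> (decay powr (- (\<alpha> / r)) * scale j powr (- (\<alpha> / r))) * M b j"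
            by (rule mult_right_mono[OF le]) (use C0 cluster_norm_nonneg[of b j] in \<open>simp add: M_def\<close>)
          then show ?thesis by (simp add: M_def mult_ac)
        qed
        then have "(rate j powr (- (\<alpha> / r)) * M b j) powr r \<le> ((decay powr (- (\<alpha> / r)) * C0) * (scale j powr (- (\<alpha> / r)) * cluster_norm b j)) powr r"
          unfolding M_def using C0 cluster_norm_nonneg[of b j] r by (intro powr_mono2) auto
        also have "\<dots> = C2 * (scale j powr (- (\<alpha> / r)) * cluster_norm b j) powr r"
          unfolding C2_def by (rule powr_mult)
        finally show "(rate j powr (- (\<alpha> / r)) * M b j) powr r \<le> C2 * (scale j powr (- (\<alpha> / r)) * cluster_norm b j) powr r" .
      qed
      ultimately have "(\<Sum>j<n. (rate j powr (- (\<alpha> / r)) * M b j) powr r) \<le> C2 * (C1 * R)"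
        unfolding sum_distrib_left[symmetric] using C2 by (meson mult_left_mono less_imp_le order_trans)
      also have "\<dots> \<le> (C0 + C1 * C2) * R" using C0 R by (simp add: algebra_simps)
      finally show ?thesis .
    qed
    show "\<exists>k E. k \<le> i \<and> 0 \<le> E \<and> (\<forall>b. norm (b i) \<le> E * M b k)" for i
    proof -
      have "i \<in> (\<Union>j<Suc i. cluster j)" using n_le_m[of "Suc i"] by (auto simp: UN_cluster)
      then obtain k where k: "k \<le> i" "i \<in> cluster k" by (auto simp: less_Suc_eq_le)
      obtain E where E: "E \<ge> 0" "\<And>b. norm (b i) \<le> E * cluster_norm b k"
        using coefficient_le_cluster_norm[OF inj k(2)] by blast
      have "norm (b i) \<le> E / C0 * M b k" for b using E(2)[of b] C0 by (simp add: M_def)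
      then show ?thesis using k E C0 by (intro exI[of _ k] exI[of _ "E / C0"]) auto
    qed
  qed
qed

end

section \<open>Quasi-lacunary sequences split into clusters\<close>

text \<open>A new cluster begins wherever the ratio of neighbours is at least \<open>q'\<close>. If there were no such place among \<open>K\<close>
neighbours, their total ratio would be less than \<open>q' ^ K \<le> q\<close>. The bound \<open>q' \<le> l 1 / l 0\<close> makes \<open>l 0\<close> a cluster
of its own.\<close>

lemma clusters_exist:
  fixes l :: "nat \<Rightarrow> real"
  assumes l: "strict_mono l" "\<And>i. 0 < l i" and K: "K \<ge> 1" and q: "q > 1" and lac: "\<And>i. q * l i \<le> l (i + K)"
  shows "\<exists>m q' D. clusters l m K q' D"
proof -
  \<comment> \<open>\<open>q' ^ K \<le> q\<close> forces a gap among any \<open>K\<close> neighbours, \<open>q' \<le> l 1 / l 0\<close> a gap after \<open>l 0\<close>.\<close>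
  define q' where "q' = min (q powr (1 / real K)) (l 1 / l 0)"
  have "l 0 < l 1" using l by (simp add: strict_mono_less)
  then have q'1: "q' > 1" using q K l(2)[of 0] by (auto simp: q'_def)
  have q'K: "q' ^ K \<le> q"
  proof -
    have "q' ^ K \<le> (q powr (1 / real K)) ^ K" using q'1 by (intro power_mono) (auto simp: q'_def)
    also have "\<dots> = q" using K q by (simp add: powr_realpow[symmetric] powr_powr)
    finally show ?thesis .
  qed
  have ex: "\<exists>j>i. j \<le> i + K \<and> q' * l (j - 1) \<le> l j" for i
  proof (rule ccontr)
    assume "\<not> ?thesis"
    then have no: "l j < q' * l (j - 1)" if "i < j" "j \<le> i + K" for j using that by force
    have "l (i + Suc d) < q' ^ Suc d * l i" if "Suc d \<le> K" for d using that
    proof (induction d)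
      case 0 then show ?case using no[of "Suc i"] by simp
    next
      case (Suc d)
      have "l (i + Suc (Suc d)) < q' * l (i + Suc d)" using no[of "i + Suc (Suc d)"] Suc.prems by simp
      also have "\<dots> < q' * (q' ^ Suc d * l i)" using Suc q'1 by (intro mult_strict_left_mono) auto
      finally show ?case by simp
    qed
    from this[of "K - 1"] have "l (i + K) < q' ^ K * l i" using K by simp
    also have "\<dots> \<le> q * l i" using q'K l(2)[of i] by (intro mult_right_mono) auto
    finally show False using lac[of i] by simp
  qed
  define nxt where "nxt = (\<lambda>i. LEAST j. i < j \<and> q' * l (j - 1) \<le> l j)"
  have nxt: "i < nxt i" "q' * l (nxt i - 1) \<le> l (nxt i)" "nxt i \<le> i + K" for i
  proof -
    obtain j where j: "i < j" "j \<le> i + K" "q' * l (j - 1) \<le> l j" using ex by blast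
    have "i < nxt i \<and> q' * l (nxt i - 1) \<le> l (nxt i)" unfolding nxt_def by (rule LeastI[of _ j]) (use j in auto)
    moreover have "nxt i \<le> j" unfolding nxt_def by (rule Least_le) (use j in auto)
    ultimately show "i < nxt i" "q' * l (nxt i - 1) \<le> l (nxt i)" "nxt i \<le> i + K" using j by auto
  qed
  have within: "l (i + d) \<le> q' ^ d * l i" if "i + d < nxt i" for i d using that
  proof (induction d)
    case (Suc d)
    have "\<not> (i < i + Suc d \<and> q' * l (i + Suc d - 1) \<le> l (i + Suc d))"
      using Suc.prems unfolding nxt_def by (intro not_less_Least) auto
    then have "l (i + Suc d) \<le> q' * l (i + d)" by simp
    also have "\<dots> \<le> q' * (q' ^ d * l i)" using Suc q'1 by (intro mult_left_mono) auto
    finally show ?case by simp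
  qed simp
  define m where "m = (\<lambda>k. (nxt ^^ k) 0)"
  have mS: "m (Suc k) = nxt (m k)" for k by (simp add: m_def)
  have "clusters l m K q' (q' ^ K)"
  proof
    show "l i \<le> l j" if "i \<le> j" for i j using l that by (simp add: strict_mono_less_eq)
    show "m 0 = 0" by (simp add: m_def)
    have "nxt 0 = 1"
      unfolding nxt_def by (rule Least_equality) (use l(2)[of 0] in \<open>auto simp: q'_def min_def field_simps\<close>)
    then show "m (Suc 0) = Suc 0" by (simp add: m_def)
    show "strict_mono m" by (simp add: strict_mono_Suc_iff mS nxt)
    show "l (m (Suc k) - 1) \<le> q' ^ K * l (m k)" for k
    proof -
      define d where "d = nxt (m k) - 1 - m k"
      have d: "m k + d = nxt (m k) - 1" "d \<le> K" using nxt[of "m k"] by (auto simp: d_def)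
      have "l (m k + d) \<le> q' ^ d * l (m k)" using d nxt(1)[of "m k"] by (intro within) simp
      also have "\<dots> \<le> q' ^ K * l (m k)"
        using d q'1 l(2)[of "m k"] by (intro mult_right_mono power_increasing) auto
      finally show ?thesis by (simp add: mS d)
    qed
    show "1 \<le> q' ^ K" using q'1 by simp
  qed (use l q'1 nxt in \<open>auto simp: mS\<close>)
  then show ?thesis by blast
qed

text \<open>The maxima of consecutive blocks have ratio greater than \<open>q\<close>, and from any index it takes at most \<open>2 * N\<close> steps
to reach the maximum of the block after the one to which the index belongs. The finitely many exceptional indices are taken care of by enlarging \<open>K\<close>.\<close>

lemma quasi_lacunary_ratio:
  assumes l: "strict_mono l" "\<And>i. 0 < l i" and ql: "quasi_lacunary l n"
  obtains K q where "K \<ge> 1" "q > 1" "\<And>i. q * l i \<le> l (i + K)"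
proof -
  from ql obtain N q where n0: "n 0 = - 1" and n: "strict_mono n" and N: "\<And>k. card (block l n k) \<le> N"
    and q: "q > 1" and ev: "\<forall>\<^sub>F k in sequentially. lacunary_part l n (Suc k) / lacunary_part l n k > q"
    unfolding quasi_lacunary_def by blast
  obtain k1 where k1: "\<And>k. k \<ge> k1 \<Longrightarrow> lacunary_part l n (Suc k) / lacunary_part l n k > q"
    using ev unfolding eventually_sequentially by blast
  define k0 where "k0 = Suc k1"
  have npos: "n (Suc k) \<ge> 0" for k
  proof -
    have "n 0 < n (Suc k)" using n by (simp add: strict_mono_less)
    then show ?thesis using n0 by simp
  qed
  have nm1: "n k \<ge> - 1" for k using npos n0 by (cases k) (auto intro: order_trans[of _ 0])
  have step: "n (Suc k) \<le> n k + int N" for k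
  proof -
    have "{j. n k + 1 \<le> int j \<and> int j \<le> n (Suc k)} = {nat (n k + 1)..nat (n (Suc k))}"
      using nm1[of k] npos[of k] by (auto simp: nat_le_iff le_nat_iff)
    then have "card (block l n k) = card {nat (n k + 1)..nat (n (Suc k))}"
      unfolding block_def using inj_on_subset[OF strict_mono_on_imp_inj_on[OF l(1)] subset_UNIV]
      by (simp add: card_image)
    also have "\<dots> = nat (n (Suc k) + 1) - nat (n k + 1)" using npos[of k] by simp
    finally have "int (nat (n (Suc k) + 1) - nat (n k + 1)) \<le> int N" using N[of k] by linarith
    then show ?thesis using nm1[of k] npos[of k] by linarith
  qed
  define e where "e = (\<lambda>k. nat (n (Suc k)))"
  have e_mono: "strict_mono e" unfolding strict_mono_Suc_iff
  proof
    fix k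
    have "n (Suc k) < n (Suc (Suc k))" using n by (simp add: strict_mono_less)
    then show "e k < e (Suc k)" unfolding e_def using npos[of k] by linarith
  qed
  have e_step: "e (Suc k) \<le> e k + N" for k using step[of "Suc k"] npos[of k] npos[of "Suc k"] by (simp add: e_def)
  have e_lac: "q * l (e k) \<le> l (e (Suc k))" if "k \<ge> k1" for k
    using k1[of "Suc k"] that l(2)[of "e k"] by (simp add: lacunary_part_def e_def field_simps less_imp_le)
  define K where "K = 2 * N + e (Suc k1) + 1"
  have "q * l i \<le> l (i + K)" for i
  proof (cases "i \<le> e k1")
    case True
    have "q * l i \<le> q * l (e k1)" using True q l by (simp add: strict_mono_less_eq)
    also have "\<dots> \<le> l (e (Suc k1))" by (rule e_lac) simp
    also have "\<dots> \<le> l (i + K)" using l by (simp add: strict_mono_less_eq K_def)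
    finally show ?thesis .
  next
    case False
    define k where "k = (LEAST k. i \<le> e k)"
    have "i \<le> e i" using e_mono by (simp add: strict_mono_imp_increasing)
    then have k: "i \<le> e k" unfolding k_def by (rule LeastI)
    have "k > k1" using k False e_mono by (metis leI order_trans strict_mono_less_eq)
    then obtain k' where k': "k = Suc k'" "k' \<ge> k1" by (cases k) auto
    have "\<not> i \<le> e k'" using k' unfolding k_def by (intro not_less_Least) (simp add: k_def[symmetric])
    then have "e (Suc k) \<le> i + 2 * N" using e_step[of k'] e_step[of k] k' by simp
    have "q * l i \<le> q * l (e k)" using k q l by (simp add: strict_mono_less_eq)
    also have "\<dots> \<le> l (e (Suc k))" using \<open>k > k1\<close> by (intro e_lac) simp
    also have "\<dots> \<le> l (i + K)" using l \<open>e (Suc k) \<le> i + 2 * N\<close> by (simp add: strict_mono_less_eq K_def)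
    finally show ?thesis .
  qed
  then show ?thesis using that[of K q] q by (simp add: K_def)
qed

lemma lacunary_part_tail:
  assumes l: "strict_mono l" "\<And>i. 0 < l i" and ql: "quasi_lacunary l n" and sg: "subgeometric l n"
  obtains k0 q Q where "q > 1" "lacunary q (\<lambda>k. lacunary_part l n (k + k0))"
    "\<And>k. lacunary_part l n (Suc k + k0) \<le> Q * lacunary_part l n (k + k0)"
proof -
  obtain q where q: "q > 1" and ev: "\<forall>\<^sub>F k in sequentially. lacunary_part l n (Suc k) / lacunary_part l n k > q"
    using ql unfolding quasi_lacunary_def by blast
  obtain Q where Q: "Q > 1" and ev': "\<forall>\<^sub>F k in sequentially. lacunary_part l n (Suc k) / lacunary_part l n k \<le> Q"
    using sg unfolding subgeometric_def by blast
  obtain k0 where k0: "\<And>k. k \<ge> k0 \<Longrightarrow> lacunary_part l n (Suc k) / lacunary_part l n k > q \<and>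
      lacunary_part l n (Suc k) / lacunary_part l n k \<le> Q"
    using eventually_conj[OF ev ev'] unfolding eventually_sequentially by blast
  have pos: "lacunary_part l n k > 0" for k using l by (simp add: lacunary_part_def)
  show ?thesis
  proof (rule that[of q k0 Q])
    show "lacunary q (\<lambda>k. lacunary_part l n (k + k0))"
      unfolding lacunary_def using k0 pos by (auto simp: less_divide_eq less_imp_le)
    show "lacunary_part l n (Suc k + k0) \<le> Q * lacunary_part l n (k + k0)" for k
      using k0[of "k + k0"] pos[of "k + k0"] by (simp add: divide_le_eq)
  qed (use q in auto)
qed

section \<open>A majorant that is constant on shells\<close>

text \<open>Compare \<open>t powr \<theta>\<close> with \<open>exp (- \<theta> * (1 - t))\<close> and integrate over a half line, which gives a Gamma integral.\<close>

lemma nu_moment_le: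
  assumes \<alpha>: "\<alpha> > 0"
  shows "\<exists>C>0. \<forall>\<theta>>0. (\<integral>\<^sup>+t. ennreal (t powr \<theta>) \<partial>nu (\<alpha> - 1)) \<le> ennreal (C * \<theta> powr (- \<alpha>))"
proof (intro exI[of _ "Gamma \<alpha>"] conjI allI impI)
  show "Gamma \<alpha> > 0" using \<alpha> by (simp add: Gamma_real_pos)
  fix \<theta> :: real assume \<theta>: "\<theta> > 0"
  define h where "h = (\<lambda>v::real. indicator {0..} v * v powr (\<alpha> - 1) / exp v)"
  have [measurable]: "h \<in> borel_measurable borel" unfolding h_def by measurable
  have h0: "h v \<ge> 0" for v by (simp add: h_def)
  have "(\<integral>\<^sup>+t. ennreal (t powr \<theta>) \<partial>nu (\<alpha> - 1)) =
      (\<integral>\<^sup>+t. ennreal ((1 - t) powr (\<alpha> - 1)) * ennreal (t powr \<theta>) * indicator {0..1} t \<partial>lborel)"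
    by (rule nn_integral_nu) simp
  also have "\<dots> \<le> (\<integral>\<^sup>+t. ennreal (\<theta> powr (1 - \<alpha>) * h (\<theta> * (1 - t))) \<partial>lborel)"
  proof (intro nn_integral_mono)
    fix t :: real
    show "ennreal ((1 - t) powr (\<alpha> - 1)) * ennreal (t powr \<theta>) * indicator {0..1} t
      \<le> ennreal (\<theta> powr (1 - \<alpha>) * h (\<theta> * (1 - t)))"
    proof (cases "t \<in> {0..1}")
      case True
      have "t powr \<theta> \<le> exp (- (\<theta> * (1 - t)))"
      proof (cases "t = 0")
        case False
        then have "ln t \<le> t - 1" using True by (intro ln_le_minus_one) auto
        then have "\<theta> * ln t \<le> \<theta> * (t - 1)" using \<theta> by (intro mult_left_mono) auto
        then show ?thesis using False by (simp add: powr_def algebra_simps)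
      qed simp
      then have "(1 - t) powr (\<alpha> - 1) * t powr \<theta> \<le> (1 - t) powr (\<alpha> - 1) * exp (- (\<theta> * (1 - t)))"
        by (intro mult_left_mono) auto
      also have "\<dots> = \<theta> powr (1 - \<alpha>) * h (\<theta> * (1 - t))"
      proof -
        have "\<theta> powr (1 - \<alpha>) * \<theta> powr (\<alpha> - 1) = 1" using \<theta> by (simp add: powr_add[symmetric])
        then have "\<theta> powr (1 - \<alpha>) * (\<theta> powr (\<alpha> - 1) * (1 - t) powr (\<alpha> - 1)) = (1 - t) powr (\<alpha> - 1)"
          by (simp add: mult.assoc[symmetric])
        moreover have "h (\<theta> * (1 - t)) = \<theta> powr (\<alpha> - 1) * (1 - t) powr (\<alpha> - 1) * exp (- (\<theta> * (1 - t)))"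
          using True \<theta> by (simp add: h_def powr_mult exp_minus divide_inverse)
        ultimately show ?thesis by (simp add: mult.assoc[symmetric])
      qed
      finally show ?thesis using True by (simp add: ennreal_mult'[symmetric] ennreal_leI)
    qed simp
  qed
  also have "\<dots> = ennreal (\<theta> powr (1 - \<alpha>)) * (\<integral>\<^sup>+t. ennreal (h (\<theta> * (1 - t))) \<partial>lborel)"
    by (simp add: ennreal_mult' h0 nn_integral_cmult)
  also have "(\<integral>\<^sup>+t. ennreal (h (\<theta> * (1 - t))) \<partial>lborel) = ennreal (1 / \<theta>) * (\<integral>\<^sup>+v. ennreal (h v) \<partial>lborel)"
    using \<theta> by (subst nn_integral_real_affine[where c = "- (1 / \<theta>)" and t = 1]) auto
  also have "(\<integral>\<^sup>+v. ennreal (h v) \<partial>lborel) = ennreal (Gamma \<alpha>)"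
    unfolding h_def using \<alpha> by (rule Gamma_conv_nn_integral_real[symmetric])
  also have "ennreal (\<theta> powr (1 - \<alpha>)) * (ennreal (1 / \<theta>) * ennreal (Gamma \<alpha>)) = ennreal (\<theta> powr (1 - \<alpha>) * (1 / \<theta> * Gamma \<alpha>))"
    using \<theta> \<alpha> Gamma_real_pos[OF \<alpha>] by (simp add: ennreal_mult[symmetric])
  also have "\<theta> powr (1 - \<alpha>) * (1 / \<theta> * Gamma \<alpha>) = Gamma \<alpha> * \<theta> powr (- \<alpha>)"
    using \<theta> by (simp add: powr_diff powr_minus field_simps)
  finally show "(\<integral>\<^sup>+t. ennreal (t powr \<theta>) \<partial>nu (\<alpha> - 1)) \<le> ennreal (Gamma \<alpha> * \<theta> powr (- \<alpha>))" .
qed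

lemma suminf_ennreal_ge_const:
  assumes "\<And>k. ennreal c \<le> f k" "c > 0"
  shows "(\<Sum>k. f k) = (\<infinity> :: ennreal)"
proof (rule ccontr)
  assume "(\<Sum>k. f k) \<noteq> \<infinity>"
  then obtain z where z: "(\<Sum>k. f k) = ennreal z" "z \<ge> 0" by (metis ennreal_cases infinity_ennreal_def)
  obtain n :: nat where n: "z < real n * c" using reals_Archimedean3[OF assms(2)] by blast
  have "ennreal (real n * c) = (\<Sum>k<n. ennreal c)" using assms by (simp add: ennreal_mult ennreal_of_nat_eq_real_of_nat)
  also have "\<dots> \<le> (\<Sum>k<n. f k)" by (intro sum_mono assms)
  also have "\<dots> \<le> (\<Sum>k. f k)" by (intro sum_le_suminf) auto
  finally show False using n z assms by (simp add: ennreal_le_iff)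
qed

lemma lacunary_unbounded:
  assumes "lacunary q x" "q > 1"
  shows "\<exists>k. B < x k"
proof -
  have x0: "x 0 > 0" using assms by (simp add: lacunary_def)
  obtain k where k: "B / x 0 < q ^ k" using real_arch_pow[OF assms(2)] by blast
  then have "B < q ^ (k - 0) * x 0" using x0 by (simp add: field_simps)
  also have "\<dots> \<le> x k" using assms by (intro lacunary_power) auto
  finally show ?thesis by blast
qed

text \<open>The value of \<open>\<Sum>j. M j * t powr y j\<close> at \<open>t = exp (- 1 / x (k + 1))\<close>, the largest one on the \<open>k\<close>-th shell.\<close>

definition envelope :: "(nat \<Rightarrow> real) \<Rightarrow> (nat \<Rightarrow> real) \<Rightarrow> (nat \<Rightarrow> real) \<Rightarrow> nat \<Rightarrow> nat \<Rightarrow> real" where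
  "envelope x y M n k = (\<Sum>j<n. M j * exp (- y j / x (Suc k)))"

lemma envelope_nonneg: "(\<And>j. 0 \<le> M j) \<Longrightarrow> envelope x y M n k \<ge> 0"
  unfolding envelope_def by (intro sum_nonneg mult_nonneg_nonneg) auto

text \<open>On the shell of index \<open>k\<close> a single term of the series suffices. The first summand on the right takes care of
\<open>t \<le> exp (- 1 / x 0)\<close>, where \<open>t powr y 0\<close> can be factored out. At \<open>t = 1\<close> the series diverges, unless all
coefficients vanish.\<close>

lemma powr_sum_le_envelope:
  assumes x: "lacunary q x" "q > 1" and y: "lacunary q' y" "q' > 1" and M: "\<And>j. 0 \<le> M j" and \<rho>: "\<rho> > 0"
    and t: "t \<in> {0..1}"
  shows "ennreal ((\<Sum>j<n. M j * t powr y j) powr \<rho>) \<le>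
    ennreal (exp (\<rho> * y 0 / x 0) * envelope x y M n 0 powr \<rho>) * ennreal (t powr (\<rho> * y 0)) +
    (\<Sum>k. ennreal (exp \<rho> * envelope x y M n k powr \<rho>) * ennreal (t powr (\<rho> * x k)))"
    (is "?L \<le> ?A + (\<Sum>k. ?B k)")
proof -
  let ?F = "envelope x y M n"
  let ?S = "\<Sum>j<n. M j * t powr y j"
  have xm: "strict_mono x" and ym: "strict_mono y" using x y by (auto intro: lacunary_strict_mono)
  have xpos: "x k > 0" and ypos: "y k > 0" for k using x y by (auto simp: lacunary_def)
  have F0: "?F k \<ge> 0" for k using M by (rule envelope_nonneg)
  have S0: "?S \<ge> 0" using M by (intro sum_nonneg) auto
  consider "t = 0" | "t = 1" | "0 < t" "t < 1" "- ln t \<ge> 1 / x 0" | "0 < t" "t < 1" "- ln t < 1 / x 0"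
    using t by fastforce
  then show ?thesis
  proof cases
    case 1 then show ?thesis by simp
  next
    case 2
    show ?thesis
    proof (cases "?F 0 = 0")
      case True
      have "\<forall>j\<in>{..<n}. M j * exp (- y j / x (Suc 0)) = 0"
        using True M unfolding envelope_def by (subst (asm) sum_nonneg_eq_0_iff) auto
      then have "?S = 0" by (intro sum.neutral) auto
      then show ?thesis by simp
    next
      case False
      then have pos: "?F 0 > 0" using F0[of 0] by simp
      have "(\<Sum>k. ?B k) = \<infinity>"
      proof (rule suminf_ennreal_ge_const)
        show "exp \<rho> * ?F 0 powr \<rho> > 0" using pos by simp
        fix k
        have "?F 0 \<le> ?F k" unfolding envelope_def
        proof (intro sum_mono mult_left_mono M)
          fix j
          have "x (Suc 0) \<le> x (Suc k)" using xm by (simp add: strict_mono_less_eq)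
          then have "y j / x (Suc k) \<le> y j / x (Suc 0)" using ypos[of j] xpos by (intro divide_left_mono) (auto intro: less_imp_le)
          then show "exp (- y j / x (Suc 0)) \<le> exp (- y j / x (Suc k))" by simp
        qed
        then show "ennreal (exp \<rho> * ?F 0 powr \<rho>) \<le> ?B k"
          using 2 F0[of 0] \<rho> by (auto intro!: ennreal_leI powr_mono2)
      qed
      then show ?thesis by simp
    qed
  next
    case 3
    define \<sigma> where "\<sigma> = - ln t"
    have t: "t = exp (- \<sigma>)" using 3 by (simp add: \<sigma>_def)
    have tp: "t powr v = exp (- \<sigma> * v)" for v by (simp add: t exp_powr_real)
    have "?S \<le> exp (y 0 / x 0) * t powr y 0 * ?F 0"
      unfolding envelope_def sum_distrib_left
    proof (rule sum_mono)
      fix j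
      have y0: "y 0 \<le> y j" using ym by (simp add: strict_mono_less_eq)
      have "(y j - y 0) * (1 / x 0) \<le> (y j - y 0) * \<sigma>" using y0 3 by (intro mult_left_mono) (auto simp: \<sigma>_def)
      moreover have "y j / x (Suc 0) \<le> y j / x 0"
        using ypos[of j] xpos xm by (intro divide_left_mono) (auto simp: strict_mono_less_eq intro: less_imp_le)
      ultimately have "- \<sigma> * y j \<le> y 0 / x 0 + - \<sigma> * y 0 + - y j / x (Suc 0)"
        by (simp add: algebra_simps diff_divide_distrib)
      then have "t powr y j \<le> exp (y 0 / x 0) * t powr y 0 * exp (- y j / x (Suc 0))"
        unfolding tp exp_add[symmetric] exp_le_cancel_iff .
      then have "M j * t powr y j \<le> M j * (exp (y 0 / x 0) * t powr y 0 * exp (- y j / x (Suc 0)))"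
        using M by (rule mult_left_mono)
      then show "M j * t powr y j \<le> exp (y 0 / x 0) * t powr y 0 * (M j * exp (- y j / x (Suc 0)))"
        by (simp add: mult_ac)
    qed
    then have "?S powr \<rho> \<le> (exp (y 0 / x 0) * t powr y 0 * ?F 0) powr \<rho>"
      using S0 \<rho> by (intro powr_mono2) auto
    also have "\<dots> = exp (\<rho> * y 0 / x 0) * ?F 0 powr \<rho> * t powr (\<rho> * y 0)"
      by (simp add: powr_mult powr_powr exp_powr_real mult_ac)
    finally have "?L \<le> ?A" by (simp add: ennreal_mult'[symmetric] ennreal_leI)
    then show ?thesis by (rule order_trans) simp
  next
    case 4
    define \<sigma> where "\<sigma> = - ln t"
    have \<sigma>: "\<sigma> > 0" "\<sigma> < 1 / x 0" using 4 by (auto simp: \<sigma>_def)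
    have t: "t = exp (- \<sigma>)" using 4 by (simp add: \<sigma>_def)
    have tp: "t powr v = exp (- \<sigma> * v)" for v by (simp add: t exp_powr_real)
    define k where "k = (LEAST k. 1 / \<sigma> < x (Suc k))"
    obtain k' where "1 / \<sigma> < x k'" using lacunary_unbounded[OF x] by blast
    also have "x k' < x (Suc k')" using xm by (simp add: strict_mono_less)
    finally have k: "1 / \<sigma> < x (Suc k)" unfolding k_def by (rule LeastI)
    have k2: "x k \<le> 1 / \<sigma>"
    proof (cases k)
      case 0 then show ?thesis using \<sigma> xpos[of 0] by (simp add: field_simps)
    next
      case (Suc k'')
      then have "\<not> 1 / \<sigma> < x (Suc k'')" unfolding k_def by (intro not_less_Least) (simp add: k_def[symmetric])
      then show ?thesis using Suc by simp
    qed
    have "?S \<le> ?F k"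
      unfolding envelope_def
    proof (intro sum_mono mult_left_mono M)
      fix j
      have "1 / x (Suc k) \<le> \<sigma>" using k \<sigma> xpos[of "Suc k"] by (simp add: field_simps)
      then have "y j * (1 / x (Suc k)) \<le> y j * \<sigma>" using ypos[of j] by (intro mult_left_mono) auto
      then show "t powr y j \<le> exp (- y j / x (Suc k))" unfolding tp by (simp add: mult.commute)
    qed
    then have "?S powr \<rho> \<le> ?F k powr \<rho>" using S0 \<rho> by (intro powr_mono2) auto
    also have "\<dots> \<le> ?F k powr \<rho> * (exp \<rho> * t powr (\<rho> * x k))"
    proof -
      have "\<sigma> * x k \<le> 1" using k2 \<sigma> by (simp add: field_simps)
      then have "\<rho> * (\<sigma> * x k) \<le> \<rho> * 1" using \<rho> by (intro mult_left_mono) auto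
      then have "1 \<le> exp \<rho> * t powr (\<rho> * x k)"
        unfolding tp exp_add[symmetric] by (simp add: algebra_simps)
      then show ?thesis by (simp add: mult_le_cancel_left1)
    qed
    finally have "?L \<le> ?B k" by (simp add: ennreal_mult'[symmetric] ennreal_leI mult_ac)
    also have "?B k = (\<Sum>i\<in>{k}. ?B i)" by simp
    also have "\<dots> \<le> (\<Sum>k. ?B k)" by (intro sum_le_suminf) auto
    finally show ?thesis by (rule order_trans) simp
  qed
qed

lemma nn_integral_powr_sum_le_envelope:
  assumes x: "lacunary q x" "q > 1" and y: "lacunary q' y" "q' > 1" and M: "\<And>j. 0 \<le> M j" and \<rho>: "\<rho> > 0"
    and m: "sets m = sets (restrict_space borel {0..1})"
  shows "(\<integral>\<^sup>+t. ennreal ((\<Sum>j<n. M j * t powr y j) powr \<rho>) \<partial>m) \<le>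
    ennreal (exp (\<rho> * y 0 / x 0) * envelope x y M n 0 powr \<rho>) * (\<integral>\<^sup>+t. ennreal (t powr (\<rho> * y 0)) \<partial>m) +
    (\<Sum>k. ennreal (exp \<rho> * envelope x y M n k powr \<rho>) * (\<integral>\<^sup>+t. ennreal (t powr (\<rho> * x k)) \<partial>m))"
proof -
  have sp: "space m = {0..1}" using sets_eq_imp_space_eq[OF m] by (simp add: space_restrict_space)
  have meas: "f \<in> borel_measurable m" if "f \<in> borel_measurable borel" for f :: "real \<Rightarrow> ennreal"
    unfolding measurable_cong_sets[OF m refl] using that by (rule measurable_restrict_space1)
  have pm: "(\<lambda>t. ennreal (t powr v)) \<in> borel_measurable m" for v by (intro meas) measurable
  have cm: "(\<lambda>t. ennreal w * ennreal (t powr v)) \<in> borel_measurable m" for w v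
    using pm[of v] by measurable
  have "(\<integral>\<^sup>+t. ennreal ((\<Sum>j<n. M j * t powr y j) powr \<rho>) \<partial>m) \<le>
    (\<integral>\<^sup>+t. ennreal (exp (\<rho> * y 0 / x 0) * envelope x y M n 0 powr \<rho>) * ennreal (t powr (\<rho> * y 0)) +
    (\<Sum>k. ennreal (exp \<rho> * envelope x y M n k powr \<rho>) * ennreal (t powr (\<rho> * x k))) \<partial>m)"
    by (intro nn_integral_mono powr_sum_le_envelope[OF x y M \<rho>]) (simp add: sp)
  also have "\<dots> = ennreal (exp (\<rho> * y 0 / x 0) * envelope x y M n 0 powr \<rho>) * (\<integral>\<^sup>+t. ennreal (t powr (\<rho> * y 0)) \<partial>m) +
    (\<Sum>k. ennreal (exp \<rho> * envelope x y M n k powr \<rho>) * (\<integral>\<^sup>+t. ennreal (t powr (\<rho> * x k)) \<partial>m))"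
  proof (subst nn_integral_add)
    note [measurable] = pm
    show "(\<lambda>t. ennreal (exp (\<rho> * y 0 / x 0) * envelope x y M n 0 powr \<rho>) * ennreal (t powr (\<rho> * y 0))) \<in> borel_measurable m"
      "(\<lambda>t. \<Sum>k. ennreal (exp \<rho> * envelope x y M n k powr \<rho>) * ennreal (t powr (\<rho> * x k))) \<in> borel_measurable m"
      by measurable
  qed (simp only: nn_integral_suminf[OF cm] nn_integral_cmult[OF pm])
  finally show ?thesis .
qed

text \<open>Schur test for the kernel \<open>(y j / x k) powr a * exp (- y j / x (k + 1))\<close>. The bound \<open>x (k + 1) \<le> Q * x k\<close> lets it be
replaced by a function of \<open>y j / x k\<close>; otherwise the terms with \<open>x k < y j \<approx> x (k + 1)\<close> could be large.\<close>

lemma sum_envelope_le: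
  assumes x: "lacunary q x" "q > 1" and y: "lacunary q' y" "q' > 1" and Q: "\<And>k. x (Suc k) \<le> Q * x k"
    and a: "a > 0" and r: "r > 1"
  shows "\<exists>C>0. \<forall>M n n'. (\<forall>j. 0 \<le> M j) \<longrightarrow>
    (\<Sum>k<n'. (x k powr (- a) * envelope x y M n k) powr r) \<le> C * (\<Sum>j<n. (y j powr (- a) * M j) powr r)"
proof -
  have xpos: "x k > 0" and ypos: "y k > 0" for k using x y by (auto simp: lacunary_def)
  have Q0: "Q > 0" using Q[of 0] xpos[of 0] xpos[of 1] by (metis One_nat_def less_le_trans zero_less_mult_pos2)
  obtain C where C: "C > 0" "\<And>u. u > 0 \<Longrightarrow> u powr a * exp (- (1 / Q) * u) \<le> C * min (u powr a) ((1 / u) powr a)"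
    using exp_kernel_bound[OF a, of "1 / Q"] Q0 by auto
  define d where "d = C * max (2 / (1 - (1 / q') powr a)) (2 / (1 - (1 / q) powr a))"
  have frac: "2 / (1 - (1 / s) powr a) > 0" if "s > 1" for s :: real
    using powr_less_mono2[of a "1 / s" 1] a that by simp
  have d: "d > 0" using C frac[OF x(2)] by (auto simp: d_def less_max_iff_disj)
  define A where "A = (\<lambda>k j. (y j / x k) powr a * exp (- y j / x (Suc k)))"
  have A0: "A k j \<ge> 0" for k j by (simp add: A_def)
  have A: "A k j \<le> C * min ((y j / x k) powr a) ((x k / y j) powr a)" for k j
  proof -
    have "1 / Q * (y j / x k) \<le> y j / x (Suc k)"
      using Q[of k] Q0 xpos[of k] xpos[of "Suc k"] ypos[of j] by (simp add: frac_le)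
    then have "A k j \<le> (y j / x k) powr a * exp (- (1 / Q) * (y j / x k))"
      unfolding A_def by (intro mult_left_mono) auto
    also have "\<dots> \<le> C * min ((y j / x k) powr a) ((1 / (y j / x k)) powr a)"
      using xpos ypos by (intro C) auto
    finally show ?thesis by simp
  qed
  show ?thesis
  proof (intro exI[of _ "d powr r"] conjI allI impI)
    show "d powr r > 0" using d by simp
    fix M :: "nat \<Rightarrow> real" and n n' assume M: "\<forall>j. 0 \<le> M j"
    have "x k powr (- a) * envelope x y M n k = (\<Sum>j<n. A k j * (y j powr (- a) * M j))" for k
      unfolding envelope_def A_def sum_distrib_left
    proof (intro sum.cong refl)
      fix j
      show "x k powr (- a) * (M j * exp (- y j / x (Suc k))) =
          (y j / x k) powr a * exp (- y j / x (Suc k)) * (y j powr (- a) * M j)"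
      proof -
        have "y j powr a * y j powr (- a) = 1" using ypos[of j] by (simp add: powr_add[symmetric])
        moreover have "(y j / x k) powr a = y j powr a * x k powr (- a)"
          using xpos[of k] ypos[of j] by (simp add: powr_divide powr_minus_divide)
        then have "(y j / x k) powr a * exp (- y j / x (Suc k)) * (y j powr (- a) * M j) =
            (y j powr a * y j powr (- a)) * (x k powr (- a) * (M j * exp (- y j / x (Suc k))))"
          by (simp only: mult_ac)
        ultimately show ?thesis by (simp only: mult_1)
      qed
    qed
    moreover have "(\<Sum>k<n'. (\<Sum>j<n. A k j * (y j powr (- a) * M j)) powr r) \<le> d powr r * (\<Sum>j<n. (y j powr (- a) * M j) powr r)"
    proof (rule Schur_test_sum[OF _ _ r])
      show "(\<Sum>j<n. A k j) \<le> d" for k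
      proof -
        have "(\<Sum>j<n. A k j) \<le> C * (\<Sum>j<n. min ((y j / x k) powr a) ((x k / y j) powr a))"
          unfolding sum_distrib_left by (intro sum_mono A)
        also have "\<dots> \<le> C * (2 / (1 - (1 / q') powr a))"
          using C xpos by (intro mult_left_mono lacunary_sum_bound[OF y a]) auto
        also have "\<dots> \<le> d" unfolding d_def using C by (intro mult_left_mono) auto
        finally show ?thesis .
      qed
      show "(\<Sum>k<n'. A k j) \<le> d" for j
      proof -
        have "(\<Sum>k<n'. A k j) \<le> C * (\<Sum>k<n'. min ((x k / y j) powr a) ((y j / x k) powr a))"
          unfolding sum_distrib_left using A by (intro sum_mono) (simp add: min.commute)
        also have "\<dots> \<le> C * (2 / (1 - (1 / q) powr a))"
          using C ypos by (intro mult_left_mono lacunary_sum_bound[OF x a]) auto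
        also have "\<dots> \<le> d" unfolding d_def using C by (intro mult_left_mono) auto
        finally show ?thesis .
      qed
    qed (use d A0 M in \<open>auto simp: less_imp_le\<close>)
    ultimately show "(\<Sum>k<n'. (x k powr (- a) * envelope x y M n k) powr r) \<le> d powr r * (\<Sum>j<n. (y j powr (- a) * M j) powr r)"
      by simp
  qed
qed

lemma ennpowr_less_top_iff: "ennpowr x s < \<infinity> \<longleftrightarrow> x < \<infinity>"
  by (auto simp: ennpowr_def less_top)

lemma ennpowr_ennreal: "T \<ge> 0 \<Longrightarrow> ennpowr (ennreal T) s = ennreal (T powr s)"
  by (simp add: ennpowr_def)

lemma muentz_sum_extend:
  assumes "\<And>i. i \<ge> n \<Longrightarrow> b i = 0" "n \<le> n'"
  shows "muentz_sum l b n' = muentz_sum l b n"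
  unfolding muentz_sum_def using assms by (intro ext sum.mono_neutral_right) auto

section \<open>Muentz polynomials and the embedding inequality\<close>

lemma muentz_space_iff:
  "f \<in> muentz_space l \<longleftrightarrow> (\<exists>b n. (\<forall>i\<ge>n. b i = 0) \<and> f = muentz_sum l b n)"
proof
  assume "f \<in> muentz_space l"
  then obtain K a where f: "f = (\<lambda>t. \<Sum>k\<le>K. a k * complex_of_real (t powr l k))"
    unfolding muentz_space_def by auto
  let ?b = "\<lambda>i. if i \<le> K then a i else 0"
  have "f = muentz_sum l ?b (Suc K)"
    unfolding f muentz_sum_def by (intro ext sum.cong) auto
  then show "\<exists>b n. (\<forall>i\<ge>n. b i = 0) \<and> f = muentz_sum l b n"
    by (intro exI[of _ ?b] exI[of _ "Suc K"]) auto
next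
  assume "\<exists>b n. (\<forall>i\<ge>n. b i = 0) \<and> f = muentz_sum l b n"
  then obtain b n where b: "\<And>i. i \<ge> n \<Longrightarrow> b i = 0" and f: "f = muentz_sum l b n" by blast
  have "f = muentz_sum l b (Suc n)" unfolding f using b by (intro muentz_sum_extend[symmetric]) auto
  then show "f \<in> muentz_space l"
    unfolding muentz_space_def muentz_sum_def lessThan_Suc_atMost by blast
qed

lemma muentz_space_add:
  assumes "f \<in> muentz_space l" "g \<in> muentz_space l"
  shows "(\<lambda>t. f t + g t) \<in> muentz_space l"
proof -
  obtain b n where b: "\<And>i. i \<ge> n \<Longrightarrow> b i = 0" "f = muentz_sum l b n"
    using assms(1) unfolding muentz_space_iff by blast
  obtain b' n' where b': "\<And>i. i \<ge> n' \<Longrightarrow> b' i = 0" "g = muentz_sum l b' n'"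
    using assms(2) unfolding muentz_space_iff by blast
  have "(\<lambda>t. f t + g t) = muentz_sum l (\<lambda>i. b i + b' i) (max n n')"
    using muentz_sum_extend[of n b "max n n'" l] muentz_sum_extend[of n' b' "max n n'" l] b b'
    by (simp add: muentz_sum_def fun_eq_iff sum.distrib distrib_right)
  then show ?thesis unfolding muentz_space_iff using b(1) b'(1)
    by (intro exI[of _ "\<lambda>i. b i + b' i"] exI[of _ "max n n'"]) auto
qed

lemma muentz_space_monomial: "(\<lambda>t. c * complex_of_real (t powr l i)) \<in> muentz_space l"
  unfolding muentz_space_iff
  by (intro exI[of _ "\<lambda>j. if j = i then c else 0"] exI[of _ "Suc i"]) (auto simp: muentz_sum_def fun_eq_iff)

lemma muentz_space_sum:
  fixes n :: nat
  shows
  "(\<lambda>t. \<Sum>k<n. c k * complex_of_real (t powr l (i k))) \<in> muentz_space l"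
proof (induction n)
  case 0
  show ?case using muentz_space_monomial[of 0 l 0] by simp
next
  case (Suc n)
  show ?case using muentz_space_add[OF Suc muentz_space_monomial] by simp
qed

lemma muentz_space_measurable: "f \<in> muentz_space l \<Longrightarrow> f \<in> borel_measurable borel"
  unfolding muentz_space_iff by auto

lemma borel_measurable_unit_interval:
  assumes "sets m = sets (restrict_space borel {0..1::real})" "f \<in> borel_measurable borel"
  shows "f \<in> borel_measurable m"
  unfolding measurable_cong_sets[OF assms(1) refl] using assms(2) by (rule measurable_restrict_space1)

lemma space_unit_interval:
  "sets m = sets (restrict_space borel {0..1::real}) \<Longrightarrow> space m = {0..1}"
  using sets_eq_imp_space_eq[of m "restrict_space borel {0..1}"] by (simp add: space_restrict_space)

text \<open>The embedding inequality for \<open>p\<close>-th and \<open>r\<close>-th powers, with a finite bound \<open>R\<close> in place of the integral over \<open>nu\<close>.\<close>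

lemma muentz_embedding_iff:
  fixes r p \<beta> :: real
  assumes p: "p \<ge> 1" and \<beta>: "0 < \<beta>" and r: "r = p / \<beta>"
  shows "muentz_embedding l \<alpha> r p \<mu> \<longleftrightarrow> (\<exists>C>0. \<forall>f\<in>muentz_space l. \<forall>R\<ge>0.
     (\<integral>\<^sup>+t. ennreal (norm (f t) powr r) \<partial>nu (\<alpha> - 1)) \<le> ennreal R \<longrightarrow>
     (\<integral>\<^sup>+t. ennreal (norm (f t) powr p) \<partial>\<mu>) \<le> ennreal (C * R powr \<beta>))"
proof -
  have r0: "r > 0" "r * \<beta> = p" using p \<beta> r by auto
  show ?thesis
  proof
    assume "muentz_embedding l \<alpha> r p \<mu>"
    then obtain C where C: "C > 0" "\<And>f. f \<in> muentz_space l \<Longrightarrow> Lp_norm \<mu> p f \<le> ennreal C * Lp_norm (nu (\<alpha> - 1)) r f"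
      unfolding muentz_embedding_def by blast
    show "\<exists>C>0. \<forall>f\<in>muentz_space l. \<forall>R\<ge>0.
     (\<integral>\<^sup>+t. ennreal (norm (f t) powr r) \<partial>nu (\<alpha> - 1)) \<le> ennreal R \<longrightarrow>
     (\<integral>\<^sup>+t. ennreal (norm (f t) powr p) \<partial>\<mu>) \<le> ennreal (C * R powr \<beta>)"
    proof (intro exI[of _ "C powr p"] conjI ballI allI impI)
      show "C powr p > 0" using C by simp
      fix f R assume f: "f \<in> muentz_space l" and R: "(R::real) \<ge> 0"
        and le: "(\<integral>\<^sup>+t. ennreal (norm (f t) powr r) \<partial>nu (\<alpha> - 1)) \<le> ennreal R"
      have "Lp_norm (nu (\<alpha> - 1)) r f \<le> ennreal (R powr (1 / r))"
        using le r0 R by (subst Lp_norm_le_iff) (auto simp: powr_powr)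
      then have "ennreal C * Lp_norm (nu (\<alpha> - 1)) r f \<le> ennreal C * ennreal (R powr (1 / r))"
        by (intro mult_left_mono) auto
      also have "\<dots> = ennreal (C * R powr (1 / r))" using C(1) by (simp add: ennreal_mult)
      finally have "Lp_norm \<mu> p f \<le> ennreal (C * R powr (1 / r))"
        using C(2)[OF f] order_trans by blast
      then have "(\<integral>\<^sup>+t. ennreal (norm (f t) powr p) \<partial>\<mu>) \<le> ennreal ((C * R powr (1 / r)) powr p)"
        using p C by (subst (asm) Lp_norm_le_iff) auto
      also have "(C * R powr (1 / r)) powr p = C powr p * R powr \<beta>"
        using C r0 p \<beta> by (simp add: powr_mult powr_powr r)
      finally show "(\<integral>\<^sup>+t. ennreal (norm (f t) powr p) \<partial>\<mu>) \<le> ennreal (C powr p * R powr \<beta>)" .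
    qed
  next
    assume "\<exists>C>0. \<forall>f\<in>muentz_space l. \<forall>R\<ge>0.
     (\<integral>\<^sup>+t. ennreal (norm (f t) powr r) \<partial>nu (\<alpha> - 1)) \<le> ennreal R \<longrightarrow>
     (\<integral>\<^sup>+t. ennreal (norm (f t) powr p) \<partial>\<mu>) \<le> ennreal (C * R powr \<beta>)"
    then obtain C where C: "C > 0" "\<And>f R. f \<in> muentz_space l \<Longrightarrow> R \<ge> 0 \<Longrightarrow>
     (\<integral>\<^sup>+t. ennreal (norm (f t) powr r) \<partial>nu (\<alpha> - 1)) \<le> ennreal R \<Longrightarrow>
     (\<integral>\<^sup>+t. ennreal (norm (f t) powr p) \<partial>\<mu>) \<le> ennreal (C * R powr \<beta>)" by blast
    have "Lp_norm \<mu> p f \<le> ennreal (C powr (1 / p)) * Lp_norm (nu (\<alpha> - 1)) r f" if f: "f \<in> muentz_space l" for f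
    proof (cases "(\<integral>\<^sup>+t. ennreal (norm (f t) powr r) \<partial>nu (\<alpha> - 1))")
      case top
      then show ?thesis using C by (simp add: Lp_norm_def ennpowr_def ennreal_mult_top)
    next
      case (real R)
      have L: "Lp_norm (nu (\<alpha> - 1)) r f = ennreal (R powr (1 / r))"
        unfolding Lp_norm_def real(2) using real(1) by (rule ennpowr_ennreal)
      have "(\<integral>\<^sup>+t. ennreal (norm (f t) powr p) \<partial>\<mu>) \<le> ennreal (C * R powr \<beta>)"
        using f real by (intro C) auto
      also have "C * R powr \<beta> = (C powr (1 / p) * R powr (1 / r)) powr p"
        using C r0 p \<beta> by (simp add: powr_mult powr_powr r)
      finally have "Lp_norm \<mu> p f \<le> ennreal (C powr (1 / p) * R powr (1 / r))"
        using p C by (subst Lp_norm_le_iff) auto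
      then show ?thesis using C by (simp add: L ennreal_mult)
    qed
    then show "muentz_embedding l \<alpha> r p \<mu>"
      unfolding muentz_embedding_def using C by (intro exI[of _ "C powr (1 / p)"]) auto
  qed
qed

text \<open>The conclusion of \<open>block_estimate\<close> in the variable \<open>t\<close>.\<close>

lemma muentz_blocks:
  assumes l: "muentz_sequence l" and ql: "quasi_lacunary l n" and \<alpha>: "\<alpha> > 0" and r: "r > 1"
  obtains q y N C M where "q > 1" "lacunary q y" "y 0 = l 0" "C > 0"
    and "\<And>b j. 0 \<le> M b j" and "\<And>b j. M b j \<le> C * (\<Sum>i<N j. norm (b i :: complex))"
    and "\<And>b n t. (\<And>i. i \<ge> n \<Longrightarrow> b i = 0) \<Longrightarrow> t \<in> {0..1} \<Longrightarrow>
      norm (muentz_sum l b n t) \<le> (\<Sum>j<n. M b j * t powr y j)"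
    and "\<And>b n R. (\<And>i. i \<ge> n \<Longrightarrow> b i = 0) \<Longrightarrow> R \<ge> 0 \<Longrightarrow>
      (\<integral>\<^sup>+t. ennreal (norm (muentz_sum l b n t) powr r) \<partial>nu (\<alpha> - 1)) \<le> ennreal R \<Longrightarrow>
      (\<Sum>j<n. (y j powr (- (\<alpha> / r)) * M b j) powr r) \<le> C * R"
    and "\<And>i. \<exists>k E. k \<le> i \<and> 0 \<le> E \<and> (\<forall>b. norm (b i) \<le> E * M b k)"
proof -
  have sm: "strict_mono l" and lpos: "\<And>i. 0 < l i" using l by (auto simp: muentz_sequence_def)
  obtain K q0 where "K \<ge> 1" "q0 > 1" "\<And>i. q0 * l i \<le> l (i + K)"
    using quasi_lacunary_ratio[OF sm lpos ql] by blast
  then obtain m q D where "clusters l m K q D" using clusters_exist[OF sm lpos] by blast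
  then interpret clusters l m K q D .
  have inj: "inj l" using sm by (rule strict_mono_on_imp_inj_on)
  show ?thesis
  proof (rule block_estimate[OF \<alpha> r inj])
    fix N C M
    assume *: "C > 0" "\<And>b j. 0 \<le> M b j" "\<And>b j. M b j \<le> C * (\<Sum>i<N j. norm (b i))"
      "\<And>b n \<sigma>. (\<And>i. i \<ge> n \<Longrightarrow> b i = 0) \<Longrightarrow> \<sigma> \<ge> 0 \<Longrightarrow>
        norm (esum {..<n} b l \<sigma>) \<le> (\<Sum>j<n. M b j * exp (- rate j * \<sigma>))"
      "\<And>b n R. (\<And>i. i \<ge> n \<Longrightarrow> b i = 0) \<Longrightarrow> R \<ge> 0 \<Longrightarrow>
        (\<integral>\<^sup>+t. ennreal (norm (muentz_sum l b n t) powr r) \<partial>nu (\<alpha> - 1)) \<le> ennreal R \<Longrightarrow>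
        (\<Sum>j<n. (rate j powr (- (\<alpha> / r)) * M b j) powr r) \<le> C * R"
      "\<And>i. \<exists>k E. k \<le> i \<and> 0 \<le> E \<and> (\<forall>b. norm (b i) \<le> E * M b k)"
    show ?thesis
    proof (rule that[of "(1 + q) / 2" rate C M N])
      show "(1 + q) / 2 > 1" using q by simp
      show "rate 0 = l 0" by (simp add: rate_def)
      fix b :: "nat \<Rightarrow> complex" and n :: nat and t :: real assume b: "\<And>i. i \<ge> n \<Longrightarrow> b i = 0" and t: "t \<in> {0..1}"
      show "norm (muentz_sum l b n t) \<le> (\<Sum>j<n. M b j * t powr rate j)"
      proof (cases "t = 0")
        case True
        then show ?thesis using *(2) by (simp add: muentz_sum_def)
      next
        case False
        define \<sigma> where "\<sigma> = - ln t"
        have \<sigma>: "\<sigma> \<ge> 0" "t = exp (- \<sigma>)" using False t by (auto simp: \<sigma>_def)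
        have "norm (muentz_sum l b n t) \<le> (\<Sum>j<n. M b j * exp (- rate j * \<sigma>))"
          unfolding \<sigma>(2) muentz_sum_exp by (intro *(4) b \<sigma>(1))
        then show ?thesis by (simp add: \<sigma>(2) exp_powr_real mult.commute)
      qed
    qed (fact * lacunary_rate)+
  qed
qed

section \<open>Integrals of positive Muentz sums\<close>

lemma suminf_ennreal_le_of_partial_sums:
  fixes f g :: "nat \<Rightarrow> real"
  assumes "\<And>k. f k \<ge> 0" "B \<ge> 0" "\<And>n. (\<Sum>k<n. f k) \<le> B"
  shows "(\<Sum>k. ennreal (f k)) \<le> ennreal B"
proof (rule suminf_le_const)
  show "(\<Sum>k<n. ennreal (f k)) \<le> ennreal B" for n
    using assms by (subst sum_ennreal) (auto intro: ennreal_leI)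
qed simp

text \<open>Hoelder's inequality for \<open>\<Sum>k. F k powr p * T k\<close>, where \<open>F\<close> is the envelope. It is applied to the tail \<open>k \<ge> k1\<close> only;
the embedding needs \<open>k1 = 0\<close>, compactness needs that the last summand is small for large \<open>k1\<close>.\<close>

lemma integral_majorant_le:
  fixes x y T :: "nat \<Rightarrow> real"
  assumes x: "lacunary q x" "q > 1" and Q: "\<And>k. x (Suc k) \<le> Q * x k"
    and y: "lacunary q' y" "q' > 1"
    and \<mu>: "sets \<mu> = sets (restrict_space borel {0..1})"
    and p: "p \<ge> 1" and \<beta>: "0 < \<beta>" "\<beta> < 1" and r: "r = p / \<beta>" and \<alpha>: "\<alpha> > 0"
    and T0: "(\<integral>\<^sup>+t. ennreal (t powr (p * y 0)) \<partial>\<mu>) = ennreal T0" "T0 \<ge> 0"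
    and T: "\<And>k. (\<integral>\<^sup>+t. ennreal (t powr (p * x k)) \<partial>\<mu>) = ennreal (T k)" "\<And>k. T k \<ge> 0"
    and c: "\<And>k. c k = x k powr (\<beta> * \<alpha> / (1 - \<beta>)) * T k powr (1 / (1 - \<beta>))" and sc: "summable c"
  shows "\<exists>B>0. \<forall>M n X k1. (\<forall>j. 0 \<le> M j) \<longrightarrow> X \<ge> 0 \<longrightarrow> (\<Sum>j<n. (y j powr (- (\<alpha> / r)) * M j) powr r) \<le> X \<longrightarrow>
    envelope x y M n 0 powr p \<le> B * X powr \<beta> \<and>
    (\<integral>\<^sup>+t. ennreal ((\<Sum>j<n. M j * t powr y j) powr p) \<partial>\<mu>) \<le>
      ennreal (B * (envelope x y M n 0 powr p + (\<Sum>k<k1. envelope x y M n k powr p * T k)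
        + X powr \<beta> * (\<Sum>k. c (k + k1)) powr (1 - \<beta>)))"
proof -
  define a where "a = \<alpha> / r"
  have r1: "r > 1" using p \<beta> by (simp add: r less_divide_eq)
  have a: "a > 0" "a * p = \<alpha> * \<beta>" "r * \<beta> = p" "p / r = \<beta>" using \<alpha> r1 p \<beta> by (auto simp: a_def r)
  have xpos: "x k > 0" for k using x by (auto simp: lacunary_def)
  have c0: "c k \<ge> 0" for k by (simp add: c)
  obtain C where C: "C > 0" "\<And>M n n'. (\<forall>j. 0 \<le> M j) \<Longrightarrow>
    (\<Sum>k<n'. (x k powr (- a) * envelope x y M n k) powr r) \<le> C * (\<Sum>j<n. (y j powr (- a) * M j) powr r)"
    using sum_envelope_le[OF x y Q a(1) r1] by blast
  define B0 where "B0 = x 0 powr (a * p) * C powr \<beta>"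
  define B where "B = B0 + exp (p * y 0 / x 0) * T0 + exp p + exp p * C powr \<beta>"
  have B0: "B0 > 0" using xpos[of 0] C by (simp add: B0_def)
  have B: "B0 \<le> B" "exp (p * y 0 / x 0) * T0 \<le> B" "exp p \<le> B" "exp p * C powr \<beta> \<le> B" "B > 0"
    using B0 T0 C by (auto simp: B_def add_pos_nonneg)
  show ?thesis
  proof (intro exI[of _ B] conjI allI impI B)
    fix M :: "nat \<Rightarrow> real" and n k1 :: nat and X :: real assume M': "\<forall>j. 0 \<le> M j" and X: "X \<ge> 0"
      and le: "(\<Sum>j<n. (y j powr (- (\<alpha> / r)) * M j) powr r) \<le> X"
    have M: "0 \<le> M j" for j using M' by blast
    define F where "F = envelope x y M n"
    have F0: "F k \<ge> 0" for k unfolding F_def using M by (rule envelope_nonneg)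
    have Fsum: "(\<Sum>k<n'. (x k powr (- a) * F k) powr r) \<le> C * X" for n'
      unfolding F_def
      by (rule order_trans[OF C(2)[OF M'] mult_left_mono[OF le[folded a_def]]]) (use C(1) in simp)
    have CX: "C * X \<ge> 0" using C X by simp
    show "envelope x y M n 0 powr p \<le> B * X powr \<beta>"
    proof -
      have "(x 0 powr (- a) * F 0) powr r \<le> C * X" using Fsum[of 1] by simp
      then have "((x 0 powr (- a) * F 0) powr r) powr \<beta> \<le> (C * X) powr \<beta>"
        using \<beta> by (intro powr_mono2) auto
      moreover have "((x 0 powr (- a) * F 0) powr r) powr \<beta> = x 0 powr (- (a * p)) * F 0 powr p"
      proof -
        have "((x 0 powr (- a) * F 0) powr r) powr \<beta> = (x 0 powr (- a) * F 0) powr p"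
          by (simp only: powr_powr a(3))
        then show ?thesis using F0[of 0] by (simp add: powr_powr powr_mult)
      qed
      ultimately have "x 0 powr (a * p) * (x 0 powr (- (a * p)) * F 0 powr p) \<le> x 0 powr (a * p) * (C * X) powr \<beta>"
        by (intro mult_left_mono) auto
      moreover have "x 0 powr (a * p) * x 0 powr (- (a * p)) = 1"
        using xpos[of 0] by (simp add: powr_add[symmetric])
      ultimately have "F 0 powr p \<le> B0 * X powr \<beta>"
        using C X by (simp add: B0_def powr_mult mult.assoc[symmetric])
      also have "\<dots> \<le> B * X powr \<beta>" using B by (intro mult_right_mono) auto
      finally show ?thesis by (simp add: F_def)
    qed
    have ss: "summable (\<lambda>k. c (k + k1))" using sc by (simp add: summable_iff_shift)
    define \<delta> where "\<delta> = (\<Sum>k. c (k + k1))"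
    have \<delta>: "\<delta> \<ge> 0" unfolding \<delta>_def using c0 by (intro suminf_nonneg ss) auto
    have tail: "(\<Sum>k\<in>{k1..<n'}. F k powr p * T k) \<le> (C * X) powr \<beta> * \<delta> powr (1 - \<beta>)" for n'
    proof -
      have "(\<Sum>k\<in>{k1..<n'}. F k powr p * T k) =
          (\<Sum>k\<in>{k1..<n'}. (x k powr (- a) * F k) powr p * (x k powr (a * p) * T k))"
      proof (intro sum.cong refl)
        fix k
        have "x k powr (- (a * p)) * x k powr (a * p) = 1" using xpos[of k] by (simp add: powr_add[symmetric])
        moreover have "(x k powr (- a) * F k) powr p * (x k powr (a * p) * T k) =
            (x k powr (- (a * p)) * x k powr (a * p)) * (F k powr p * T k)"
          using F0[of k] by (simp add: powr_mult powr_powr mult_ac)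
        ultimately show "F k powr p * T k = (x k powr (- a) * F k) powr p * (x k powr (a * p) * T k)"
          by (simp only: mult_1)
      qed
      also have "\<dots> \<le> (\<Sum>k\<in>{k1..<n'}. ((x k powr (- a) * F k) powr p) powr (1 / \<beta>)) powr (1 / (1 / \<beta>)) *
          (\<Sum>k\<in>{k1..<n'}. (x k powr (a * p) * T k) powr (1 / (1 - \<beta>))) powr (1 / (1 / (1 - \<beta>)))"
        using \<beta> T(2) by (intro Holder_inequality_sum) (auto simp: less_divide_eq)
      also have "(\<Sum>k\<in>{k1..<n'}. ((x k powr (- a) * F k) powr p) powr (1 / \<beta>)) = (\<Sum>k\<in>{k1..<n'}. (x k powr (- a) * F k) powr r)"
        by (simp add: powr_powr r)
      also have "(\<Sum>k\<in>{k1..<n'}. (x k powr (a * p) * T k) powr (1 / (1 - \<beta>))) = (\<Sum>k\<in>{k1..<n'}. c k)"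
        using T(2) a by (intro sum.cong) (auto simp: c powr_mult powr_powr mult_ac)
      also have "(\<Sum>k\<in>{k1..<n'}. (x k powr (- a) * F k) powr r) powr (1 / (1 / \<beta>)) * (\<Sum>k\<in>{k1..<n'}. c k) powr (1 / (1 / (1 - \<beta>)))
          \<le> (C * X) powr \<beta> * \<delta> powr (1 - \<beta>)"
      proof (intro mult_mono)
        have "(\<Sum>k\<in>{k1..<n'}. (x k powr (- a) * F k) powr r) \<le> (\<Sum>k<n'. (x k powr (- a) * F k) powr r)"
          by (intro sum_mono2) auto
        also have "\<dots> \<le> C * X" by (rule Fsum)
        finally show "(\<Sum>k\<in>{k1..<n'}. (x k powr (- a) * F k) powr r) powr (1 / (1 / \<beta>)) \<le> (C * X) powr \<beta>"
          using \<beta> by (simp, intro powr_mono2 sum_nonneg) auto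
        have "(\<Sum>k\<in>{k1..<n'}. c k) = (\<Sum>k<n' - k1. c (k + k1))"
          by (rule sum.reindex_bij_witness[of _ "\<lambda>k. k + k1" "\<lambda>k. k - k1"]) auto
        also have "\<dots> \<le> \<delta>" unfolding \<delta>_def using c0 by (intro sum_le_suminf ss) auto
        finally show "(\<Sum>k\<in>{k1..<n'}. c k) powr (1 / (1 / (1 - \<beta>))) \<le> \<delta> powr (1 - \<beta>)"
          using \<beta> c0 by (simp, intro powr_mono2 sum_nonneg) auto
      qed auto
      finally show ?thesis .
    qed
    define H where "H = (\<Sum>k<k1. F k powr p * T k)"
    have H0: "H \<ge> 0" unfolding H_def using T(2) by (intro sum_nonneg) auto
    have "(\<Sum>k. ennreal (F k powr p * T k)) \<le> ennreal (H + (C * X) powr \<beta> * \<delta> powr (1 - \<beta>))"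
    proof (rule suminf_ennreal_le_of_partial_sums)
      fix n'
      have "(\<Sum>k<n'. F k powr p * T k) \<le> (\<Sum>k<max n' k1. F k powr p * T k)"
        using T(2) by (intro sum_mono2) auto
      also have "{..<max n' k1} = {..<k1} \<union> {k1..<max n' k1}" by auto
      also have "(\<Sum>k\<in>{..<k1} \<union> {k1..<max n' k1}. F k powr p * T k) = H + (\<Sum>k\<in>{k1..<max n' k1}. F k powr p * T k)"
        unfolding H_def by (intro sum.union_disjoint) auto
      also have "\<dots> \<le> H + (C * X) powr \<beta> * \<delta> powr (1 - \<beta>)" using tail by simp
      finally show "(\<Sum>k<n'. F k powr p * T k) \<le> H + (C * X) powr \<beta> * \<delta> powr (1 - \<beta>)" .
    qed (use T(2) H0 in auto)
    then have S: "(\<Sum>k. ennreal (exp p * F k powr p) * ennreal (T k)) \<le> ennreal (exp p * (H + (C * X) powr \<beta> * \<delta> powr (1 - \<beta>)))"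
    proof -
      assume le: "(\<Sum>k. ennreal (F k powr p * T k)) \<le> ennreal (H + (C * X) powr \<beta> * \<delta> powr (1 - \<beta>))"
      have "(\<Sum>k. ennreal (exp p * F k powr p) * ennreal (T k)) = (\<Sum>k. ennreal (exp p) * ennreal (F k powr p * T k))"
        using T(2) by (intro suminf_cong) (simp add: ennreal_mult[symmetric] mult.assoc)
      also have "\<dots> = ennreal (exp p) * (\<Sum>k. ennreal (F k powr p * T k))" by simp
      also have "\<dots> \<le> ennreal (exp p) * ennreal (H + (C * X) powr \<beta> * \<delta> powr (1 - \<beta>))"
        by (intro mult_left_mono le) auto
      finally show ?thesis using H0 by (simp add: ennreal_mult)
    qed
    have "(\<integral>\<^sup>+t. ennreal ((\<Sum>j<n. M j * t powr y j) powr p) \<partial>\<mu>) \<le>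
      ennreal (exp (p * y 0 / x 0) * F 0 powr p) * ennreal T0 + (\<Sum>k. ennreal (exp p * F k powr p) * ennreal (T k))"
      unfolding F_def T0(1)[symmetric] T(1)[symmetric]
      using p by (intro nn_integral_powr_sum_le_envelope[OF x y M _ \<mu>]) auto
    also have "\<dots> \<le> ennreal (exp (p * y 0 / x 0) * F 0 powr p) * ennreal T0 + ennreal (exp p * (H + (C * X) powr \<beta> * \<delta> powr (1 - \<beta>)))"
      by (intro add_left_mono S)
    also have "\<dots> = ennreal (exp (p * y 0 / x 0) * T0 * F 0 powr p + (exp p * H + exp p * C powr \<beta> * (X powr \<beta> * \<delta> powr (1 - \<beta>))))"
      using T0 H0 C X by (simp add: ennreal_mult[symmetric] ennreal_plus[symmetric] powr_mult distrib_left mult_ac del: ennreal_plus)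
    also have "\<dots> \<le> ennreal (B * F 0 powr p + (B * H + B * (X powr \<beta> * \<delta> powr (1 - \<beta>))))"
      using B H0 by (intro ennreal_leI add_mono mult_right_mono) auto
    also have "B * F 0 powr p + (B * H + B * (X powr \<beta> * \<delta> powr (1 - \<beta>))) = B * (F 0 powr p + H + X powr \<beta> * \<delta> powr (1 - \<beta>))"
      by (simp add: distrib_left)
    finally show "(\<integral>\<^sup>+t. ennreal ((\<Sum>j<n. M j * t powr y j) powr p) \<partial>\<mu>) \<le>
      ennreal (B * (envelope x y M n 0 powr p + (\<Sum>k<k1. envelope x y M n k powr p * T k)
        + X powr \<beta> * (\<Sum>k. c (k + k1)) powr (1 - \<beta>)))"
      by (simp add: F_def H_def \<delta>_def)
  qed
qed

lemma nu_integral_lacunary_le: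
  assumes x: "lacunary q x" "q > 1" and Q: "\<And>k. x (Suc k) \<le> Q * x k" and \<alpha>: "\<alpha> > 0" and r: "r > 1"
  shows "\<exists>C>0. \<forall>M n. (\<forall>j. 0 \<le> M j) \<longrightarrow> (\<integral>\<^sup>+t. ennreal ((\<Sum>j<n. M j * t powr x j) powr r) \<partial>nu (\<alpha> - 1)) \<le>
    ennreal (C * (\<Sum>j<n. (x j powr (- (\<alpha> / r)) * M j) powr r))"
proof -
  define a where "a = \<alpha> / r"
  have a: "a > 0" "a * r = \<alpha>" using \<alpha> r by (auto simp: a_def)
  have xpos: "x k > 0" for k using x by (auto simp: lacunary_def)
  obtain C where C: "C > 0" "\<And>M n n'. (\<forall>j. 0 \<le> M j) \<Longrightarrow>
    (\<Sum>k<n'. (x k powr (- a) * envelope x x M n k) powr r) \<le> C * (\<Sum>j<n. (x j powr (- a) * M j) powr r)"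
    using sum_envelope_le[OF x x Q a(1) r] by blast
  obtain G where G: "G > 0" "\<And>v. v > 0 \<Longrightarrow> (\<integral>\<^sup>+t. ennreal (t powr v) \<partial>nu (\<alpha> - 1)) \<le> ennreal (G * v powr (- \<alpha>))"
    using nu_moment_le[OF \<alpha>] by blast
  define D where "D = G * r powr (- \<alpha>)"
  have D: "D > 0" using G r by (simp add: D_def)
  have moment: "(\<integral>\<^sup>+t. ennreal (t powr (r * x k)) \<partial>nu (\<alpha> - 1)) \<le> ennreal (D * (x k powr (- a)) powr r)" for k
    using G(2)[of "r * x k"] r xpos[of k] a by (simp add: D_def powr_mult powr_powr mult.assoc)
  define C' where "C' = (exp (r * x 0 / x 0) + exp r) * D * C"
  have snu: "sets (nu (\<alpha> - 1)) = sets (restrict_space borel {0..1})"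
    unfolding nu_def by (simp add: sets_restrict_space)
  show ?thesis
  proof (intro exI[of _ C'] conjI allI impI)
    show "C' > 0" using C D by (simp add: C'_def add_pos_pos)
    fix M :: "nat \<Rightarrow> real" and n :: nat assume M': "\<forall>j. 0 \<le> M j"
    have M: "0 \<le> M j" for j using M' by blast
    define F where "F = envelope x x M n"
    define X where "X = (\<Sum>j<n. (x j powr (- a) * M j) powr r)"
    have X: "X \<ge> 0" unfolding X_def by (intro sum_nonneg) auto
    have F0: "F k \<ge> 0" for k unfolding F_def using M by (rule envelope_nonneg)
    have Fsum: "(\<Sum>k<n'. (x k powr (- a) * F k) powr r) \<le> C * X" for n'
      unfolding F_def X_def using M' by (rule C(2))
    have eq: "F k powr r * (x k powr (- a)) powr r = (x k powr (- a) * F k) powr r" for k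
      using F0[of k] by (simp add: powr_mult)
    have tm: "ennreal (w * F k powr r) * (\<integral>\<^sup>+t. ennreal (t powr (r * x k)) \<partial>nu (\<alpha> - 1))
        \<le> ennreal (w * D) * ennreal ((x k powr (- a) * F k) powr r)" if "w > 0" for w k
    proof -
      have "ennreal (w * F k powr r) * (\<integral>\<^sup>+t. ennreal (t powr (r * x k)) \<partial>nu (\<alpha> - 1))
        \<le> ennreal (w * F k powr r) * ennreal (D * (x k powr (- a)) powr r)"
        by (intro mult_left_mono moment) auto
      also have "\<dots> = ennreal (w * D) * ennreal ((x k powr (- a) * F k) powr r)"
      proof -
        have "w * F k powr r * (D * (x k powr (- a)) powr r) = w * D * (x k powr (- a) * F k) powr r"
          unfolding eq[symmetric] by (simp only: mult_ac)
        then show ?thesis using that D by (simp only: ennreal_mult[symmetric] mult_nonneg_nonneg less_imp_le powr_ge_zero)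
      qed
      finally show ?thesis .
    qed
    have "(\<integral>\<^sup>+t. ennreal ((\<Sum>j<n. M j * t powr x j) powr r) \<partial>nu (\<alpha> - 1)) \<le>
      ennreal (exp (r * x 0 / x 0) * F 0 powr r) * (\<integral>\<^sup>+t. ennreal (t powr (r * x 0)) \<partial>nu (\<alpha> - 1)) +
      (\<Sum>k. ennreal (exp r * F k powr r) * (\<integral>\<^sup>+t. ennreal (t powr (r * x k)) \<partial>nu (\<alpha> - 1)))"
      unfolding F_def using r by (intro nn_integral_powr_sum_le_envelope[OF x x M _ snu]) auto
    also have "\<dots> \<le> ennreal (exp (r * x 0 / x 0) * D) * ennreal ((x 0 powr (- a) * F 0) powr r) +
       (\<Sum>k. ennreal (exp r * D) * ennreal ((x k powr (- a) * F k) powr r))"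
      by (intro add_mono suminf_le tm) auto
    also have "\<dots> = ennreal (exp (r * x 0 / x 0) * D) * ennreal ((x 0 powr (- a) * F 0) powr r) +
       ennreal (exp r * D) * (\<Sum>k. ennreal ((x k powr (- a) * F k) powr r))" by simp
    also have "\<dots> \<le> ennreal (exp (r * x 0 / x 0) * D) * ennreal (C * X) + ennreal (exp r * D) * ennreal (C * X)"
      using Fsum[of 1] C X by (intro add_mono mult_left_mono suminf_ennreal_le_of_partial_sums Fsum) (auto intro: ennreal_leI)
    also have "\<dots> = ennreal (C' * X)"
      using C D X by (simp add: ennreal_mult[symmetric] ennreal_plus[symmetric] C'_def algebra_simps del: ennreal_plus)
    finally show "(\<integral>\<^sup>+t. ennreal ((\<Sum>j<n. M j * t powr x j) powr r) \<partial>nu (\<alpha> - 1)) \<le>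
      ennreal (C' * (\<Sum>j<n. (x j powr (- (\<alpha> / r)) * M j) powr r))"
      by (simp add: X_def a_def)
  qed
qed

section \<open>Necessity of the summability condition\<close>

lemma powr_sum_ge_sum_powr:
  fixes u :: "'a \<Rightarrow> real"
  assumes "p \<ge> 1" "finite S" "\<And>i. i \<in> S \<Longrightarrow> u i \<ge> 0"
  shows "(\<Sum>i\<in>S. u i powr p) \<le> (\<Sum>i\<in>S. u i) powr p"
proof -
  define s where "s = (\<Sum>i\<in>S. u i)"
  have s: "s \<ge> 0" unfolding s_def using assms by (intro sum_nonneg) auto
  have "(\<Sum>i\<in>S. u i powr p) \<le> (\<Sum>i\<in>S. u i * s powr (p - 1))"
  proof (rule sum_mono)
    fix i assume i: "i \<in> S"
    have "u i \<le> s" unfolding s_def using assms i by (intro member_le_sum) auto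
    then have "u i * u i powr (p - 1) \<le> u i * s powr (p - 1)"
      using assms i by (intro mult_left_mono powr_mono2) auto
    then show "u i powr p \<le> u i * s powr (p - 1)"
      using powr_mult_base[of "u i" "p - 1"] assms i by simp
  qed
  also have "\<dots> = s powr p"
    using powr_mult_base[OF s, of "p - 1"] by (simp add: sum_distrib_right[symmetric] s_def[symmetric])
  finally show ?thesis by (simp add: s_def)
qed

lemma embedding_imp_moment_finite:
  assumes emb: "\<And>f R. f \<in> muentz_space l \<Longrightarrow> R \<ge> 0 \<Longrightarrow>
     (\<integral>\<^sup>+t. ennreal (norm (f t) powr r) \<partial>nu (\<alpha> - 1)) \<le> ennreal R \<Longrightarrow>
     (\<integral>\<^sup>+t. ennreal (norm (f t) powr p) \<partial>\<mu>) \<le> ennreal (C * R powr \<beta>)"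
    and l: "l i > 0" and \<alpha>: "\<alpha> > 0" and r: "r > 0"
  shows "(\<integral>\<^sup>+t. ennreal (t powr (p * l i)) \<partial>\<mu>) < \<infinity>"
proof -
  obtain G where G: "G > 0" "\<And>v. v > 0 \<Longrightarrow> (\<integral>\<^sup>+t. ennreal (t powr v) \<partial>nu (\<alpha> - 1)) \<le> ennreal (G * v powr (- \<alpha>))"
    using nu_moment_le[OF \<alpha>] by blast
  let ?f = "\<lambda>t. 1 * complex_of_real (t powr l i)"
  have f: "?f \<in> muentz_space l" by (rule muentz_space_monomial)
  have n: "norm (?f t) powr v = t powr (v * l i)" for t v by (simp add: powr_powr mult.commute)
  have "(\<integral>\<^sup>+t. ennreal (norm (?f t) powr r) \<partial>nu (\<alpha> - 1)) \<le> ennreal (G * (r * l i) powr (- \<alpha>))"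
    unfolding n using l r by (intro G) simp
  then have "(\<integral>\<^sup>+t. ennreal (norm (?f t) powr p) \<partial>\<mu>) \<le> ennreal (C * (G * (r * l i) powr (- \<alpha>)) powr \<beta>)"
    using G(1) by (intro emb f) auto
  then show ?thesis unfolding n by (rule le_less_trans) simp
qed

text \<open>With \<open>b k powr p = x k powr (\<alpha> * \<beta> / (1 - \<beta>)) * T k powr (\<beta> / (1 - \<beta>))\<close>, both \<open>b k powr p * T k\<close> and
\<open>(x k powr (- \<alpha> / r) * b k) powr r\<close> are equal to \<open>c k\<close>. The embedding, tested on \<open>\<Sum>k<n. b k * t powr x k\<close>, bounds
the partial sum \<open>S\<close> of \<open>c\<close> by a multiple of \<open>S powr \<beta>\<close>; since \<open>\<beta> < 1\<close>, \<open>S\<close> is bounded.\<close>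

lemma embedding_imp_summable:
  assumes emb: "\<And>f R. f \<in> muentz_space l \<Longrightarrow> R \<ge> 0 \<Longrightarrow>
     (\<integral>\<^sup>+t. ennreal (norm (f t) powr r) \<partial>nu (\<alpha> - 1)) \<le> ennreal R \<Longrightarrow>
     (\<integral>\<^sup>+t. ennreal (norm (f t) powr p) \<partial>\<mu>) \<le> ennreal (Ce * R powr \<beta>)" and Ce: "Ce > 0"
    and x: "lacunary q x" "q > 1" and Q: "\<And>k. x (Suc k) \<le> Q * x k" and xl: "\<And>k. x k = l (idx k)"
    and \<mu>: "sets \<mu> = sets (restrict_space borel {0..1})"
    and p: "p \<ge> 1" and \<beta>: "0 < \<beta>" "\<beta> < 1" and r: "r = p / \<beta>" and \<alpha>: "\<alpha> > 0"
    and T: "\<And>k. (\<integral>\<^sup>+t. ennreal (t powr (p * x k)) \<partial>\<mu>) = ennreal (T k)" "\<And>k. T k \<ge> 0"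
    and c: "\<And>k. c k = x k powr (\<beta> * \<alpha> / (1 - \<beta>)) * T k powr (1 / (1 - \<beta>))"
  shows "summable c"
proof -
  have r1: "r > 1" using p \<beta> by (simp add: r less_divide_eq)
  have xpos: "x k > 0" for k using x by (auto simp: lacunary_def)
  have c0: "c k \<ge> 0" for k by (simp add: c)
  obtain C where C: "C > 0" "\<And>M n. (\<forall>j. 0 \<le> M j) \<Longrightarrow> (\<integral>\<^sup>+t. ennreal ((\<Sum>j<n. M j * t powr x j) powr r) \<partial>nu (\<alpha> - 1)) \<le>
    ennreal (C * (\<Sum>j<n. (x j powr (- (\<alpha> / r)) * M j) powr r))"
    using nu_integral_lacunary_le[OF x Q \<alpha> r1] by blast
  define \<gamma> where "\<gamma> = \<alpha> * \<beta> / (1 - \<beta>)"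
  define \<tau> where "\<tau> = \<beta> / (1 - \<beta>)"
  \<comment> \<open>the case of equality in Hoelder's inequality\<close>
  define b where "b = (\<lambda>k. (x k powr \<gamma> * T k powr \<tau>) powr (1 / p))"
  have b0: "b k \<ge> 0" for k by (simp add: b_def)
  have bp: "b k powr p = x k powr \<gamma> * T k powr \<tau>" for k
    using p by (simp add: b_def powr_powr)
  have bT: "b k powr p * T k = c k" for k
  proof -
    have "\<tau> + 1 = 1 / (1 - \<beta>)" using \<beta> by (simp add: \<tau>_def field_simps)
    then have "T k powr \<tau> * T k = T k powr (1 / (1 - \<beta>))"
      using powr_mult_base[OF T(2)[of k], of \<tau>] by (simp add: mult.commute add.commute)
    then show ?thesis unfolding bp c \<gamma>_def by (simp add: mult.assoc mult.commute[of \<alpha>])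
  qed
  have br: "(x k powr (- (\<alpha> / r)) * b k) powr r = c k" for k
  proof -
    have "(x k powr (- (\<alpha> / r)) * b k) powr r = x k powr (- \<alpha>) * (b k powr p) powr (1 / \<beta>)"
      using r1 b0[of k] p \<beta> by (simp add: powr_mult powr_powr r)
    also have "\<dots> = (x k powr (- \<alpha>) * x k powr (\<gamma> / \<beta>)) * T k powr (\<tau> / \<beta>)"
      unfolding bp by (simp add: powr_mult powr_powr)
    also have "x k powr (- \<alpha>) * x k powr (\<gamma> / \<beta>) = x k powr (\<beta> * \<alpha> / (1 - \<beta>))"
    proof -
      have "\<gamma> / \<beta> = \<alpha> / (1 - \<beta>)" using \<beta> by (simp add: \<gamma>_def)
      moreover have "- \<alpha> + \<alpha> / (1 - \<beta>) = \<beta> * \<alpha> / (1 - \<beta>)" using \<beta> by (simp add: field_simps)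
      ultimately show ?thesis by (simp add: powr_add[symmetric])
    qed
    also have "\<tau> / \<beta> = 1 / (1 - \<beta>)" using \<beta> by (simp add: \<tau>_def)
    finally show ?thesis by (simp add: c)
  qed
  define B where "B = Ce * C powr \<beta>"
  have B: "B > 0" using Ce C by (simp add: B_def)
  have bound: "(\<Sum>k<n. c k) \<le> B powr (1 / (1 - \<beta>))" for n
  proof -
    define S where "S = (\<Sum>k<n. c k)"
    have S: "S \<ge> 0" unfolding S_def using c0 by (intro sum_nonneg) auto
    let ?g = "\<lambda>t. \<Sum>k<n. b k * t powr x k"
    let ?f = "\<lambda>t. \<Sum>k<n. complex_of_real (b k) * complex_of_real (t powr l (idx k))"
    have f: "?f \<in> muentz_space l" by (rule muentz_space_sum)
    have "?f t = complex_of_real (?g t)" for t by (simp add: xl)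
    moreover have g0: "?g t \<ge> 0" for t using b0 by (intro sum_nonneg) auto
    ultimately have nf: "norm (?f t) = ?g t" for t by (metis abs_of_nonneg norm_of_real)
    have "(\<integral>\<^sup>+t. ennreal (norm (?f t) powr r) \<partial>nu (\<alpha> - 1)) \<le> ennreal (C * S)"
      unfolding nf S_def using C(2)[of b n] b0 by (simp only: br) simp
    then have "(\<integral>\<^sup>+t. ennreal (norm (?f t) powr p) \<partial>\<mu>) \<le> ennreal (Ce * (C * S) powr \<beta>)"
      using C S by (intro emb f) auto
    moreover have "ennreal S \<le> (\<integral>\<^sup>+t. ennreal (norm (?f t) powr p) \<partial>\<mu>)"
    proof -
      have pm: "(\<lambda>t. ennreal (t powr v)) \<in> borel_measurable \<mu>" for v
        by (intro borel_measurable_unit_interval[OF \<mu>]) simp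
      have cm: "(\<lambda>t. ennreal w * ennreal (t powr v)) \<in> borel_measurable \<mu>" for w v
        using pm[of v] by measurable
      have "ennreal S = (\<Sum>k<n. ennreal (b k powr p) * ennreal (T k))"
      proof -
        have "ennreal (b k powr p) * ennreal (T k) = ennreal (c k)" for k
          unfolding bT[symmetric] using T(2) by (simp add: ennreal_mult)
        then show ?thesis unfolding S_def using c0 by simp
      qed
      also have "\<dots> = (\<Sum>k<n. \<integral>\<^sup>+t. ennreal (b k powr p) * ennreal (t powr (p * x k)) \<partial>\<mu>)"
        by (simp only: nn_integral_cmult[OF pm] T(1))
      also have "\<dots> = (\<integral>\<^sup>+t. (\<Sum>k<n. ennreal (b k powr p) * ennreal (t powr (p * x k))) \<partial>\<mu>)"
        by (intro nn_integral_sum[symmetric] cm)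
      also have "\<dots> \<le> (\<integral>\<^sup>+t. ennreal (norm (?f t) powr p) \<partial>\<mu>)"
      proof (intro nn_integral_mono)
        fix t
        have "(\<Sum>k<n. b k powr p * t powr (p * x k)) = (\<Sum>k<n. (b k * t powr x k) powr p)"
          using b0 by (simp add: powr_mult powr_powr mult.commute)
        also have "\<dots> \<le> ?g t powr p" using b0 p by (intro powr_sum_ge_sum_powr) auto
        finally show "(\<Sum>k<n. ennreal (b k powr p) * ennreal (t powr (p * x k))) \<le> ennreal (norm (?f t) powr p)"
          unfolding nf using b0 by (simp add: ennreal_mult[symmetric] ennreal_leI)
      qed
      finally show ?thesis .
    qed
    ultimately have "ennreal S \<le> ennreal (Ce * (C * S) powr \<beta>)" by (rule order_trans[rotated])
    then have SB: "S \<le> B * S powr \<beta>"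
      using Ce C S by (subst (asm) ennreal_le_iff) (auto simp: B_def powr_mult mult.assoc)
    show ?thesis
    proof (cases "S = 0")
      case False
      then have "S powr (1 - \<beta>) * S powr \<beta> \<le> B * S powr \<beta>" using S SB by (simp add: powr_add[symmetric])
      then have "S powr (1 - \<beta>) \<le> B" using False S by (simp add: mult_le_cancel_right)
      then have "(S powr (1 - \<beta>)) powr (1 / (1 - \<beta>)) \<le> B powr (1 / (1 - \<beta>))"
        using \<beta> by (intro powr_mono2) auto
      then show ?thesis using S \<beta> by (simp add: powr_powr S_def[symmetric])
    qed (simp add: S_def[symmetric])
  qed
  show ?thesis
    by (rule summableI_nonneg_bounded[OF c0 bound])
qed

section \<open>Relative compactness by subsequences\<close>

lemma (in Metric_space) compactin_closure_of_sequentially: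
  assumes S: "S \<subseteq> M"
    and seq: "\<And>\<sigma>::nat \<Rightarrow> 'a. range \<sigma> \<subseteq> S \<Longrightarrow> \<exists>l r. l \<in> M \<and> strict_mono r \<and> limitin mtopology (\<sigma> \<circ> r) l sequentially"
  shows "compactin mtopology (mtopology closure_of S)"
  unfolding compactin_sequentially
proof (intro conjI allI impI)
  show sub: "mtopology closure_of S \<subseteq> M" using closure_of_subset_topspace by fastforce
  fix \<sigma> :: "nat \<Rightarrow> 'a" assume \<sigma>: "range \<sigma> \<subseteq> mtopology closure_of S"
  have "\<exists>y\<in>S. d (\<sigma> n) y < inverse (real (Suc n))" for n
  proof -
    have "\<sigma> n \<in> mtopology closure_of S" using \<sigma> by auto
    then have "\<forall>e>0. \<exists>y\<in>S. d (\<sigma> n) y < e" by (auto simp: metric_closure_of)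
    moreover have "inverse (real (Suc n)) > 0" by simp
    ultimately show ?thesis by blast
  qed
  then obtain \<tau> where \<tau>: "\<And>n. \<tau> n \<in> S" "\<And>n. d (\<sigma> n) (\<tau> n) < inverse (real (Suc n))" by metis
  have "range \<tau> \<subseteq> S" using \<tau> by auto
  then obtain z r where z: "z \<in> M" "strict_mono r" "limitin mtopology (\<tau> \<circ> r) z sequentially"
    using seq by blast
  have \<sigma>M: "\<sigma> n \<in> M" for n using \<sigma> sub by auto
  have \<tau>M: "\<tau> n \<in> M" for n using \<tau> S by auto
  have lim: "limitin mtopology (\<sigma> \<circ> r) z sequentially"
    unfolding limitin_metric
  proof (intro conjI allI impI z)
    fix e :: real assume e: "e > 0"
    have "\<forall>e>0. \<forall>\<^sub>F n in sequentially. \<tau> (r n) \<in> M \<and> d (\<tau> (r n)) z < e"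
      using z(3) by (simp add: limitin_metric o_def)
    then have "\<forall>\<^sub>F n in sequentially. \<tau> (r n) \<in> M \<and> d (\<tau> (r n)) z < e / 2"
      using e half_gt_zero by blast
    moreover have "\<forall>\<^sub>F n in sequentially. inverse (real (Suc n)) < e / 2"
      using half_gt_zero[OF e] Archimedean_eventually_inverse by blast
    ultimately show "\<forall>\<^sub>F n in sequentially. (\<sigma> \<circ> r) n \<in> M \<and> d ((\<sigma> \<circ> r) n) z < e"
    proof eventually_elim
      case (elim n)
      have "n \<le> r n" using z(2) by (rule strict_mono_imp_increasing)
      then have "inverse (real (Suc (r n))) \<le> inverse (real (Suc n))" by (simp add: divide_simps)
      then have "d (\<sigma> (r n)) (\<tau> (r n)) < e / 2" using \<tau>(2)[of "r n"] elim by linarith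
      then show ?case using triangle[OF \<sigma>M \<tau>M z(1), of "r n" "r n"] elim \<sigma>M by (auto simp: o_def)
    qed
  qed
  have "z \<in> mtopology closure_of S"
  proof (rule limitin_closedin[OF lim])
    show "\<forall>\<^sub>F n in sequentially. (\<sigma> \<circ> r) n \<in> mtopology closure_of S"
      using \<sigma> by (intro always_eventually) auto
  qed auto
  then show "\<exists>l r. l \<in> mtopology closure_of S \<and> strict_mono r \<and> limitin mtopology (\<sigma> \<circ> r) l sequentially"
    using z lim by blast
qed

section \<open>Convergence of Muentz polynomials with convergent coefficients\<close>

lemma summable_lacunary_exp:
  assumes y: "lacunary q y" "q > 1" and a: "a > 0" and z: "z > 0"
  shows "summable (\<lambda>j. y j powr a * exp (- y j / z))"
proof -
  have ypos: "y k > 0" for k using y by (auto simp: lacunary_def)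
  obtain C where C: "C > 0" "\<And>u. u > 0 \<Longrightarrow> u powr a * exp (- 1 * u) \<le> C * min (u powr a) ((1 / u) powr a)"
    using exp_kernel_bound[OF a, of 1] by auto
  have "(\<Sum>j<n. y j powr a * exp (- y j / z)) \<le> z powr a * C * (2 / (1 - (1 / q) powr a))" for n
  proof -
    have "(\<Sum>j<n. y j powr a * exp (- y j / z)) \<le> (\<Sum>j<n. z powr a * C * min ((y j / z) powr a) ((z / y j) powr a))"
    proof (rule sum_mono)
      fix j
      have "y j powr a * exp (- y j / z) = z powr a * ((y j / z) powr a * exp (- 1 * (y j / z)))"
        using z ypos[of j] by (simp add: powr_divide)
      also have "\<dots> \<le> z powr a * (C * min ((y j / z) powr a) ((1 / (y j / z)) powr a))"
        using z ypos[of j] by (intro mult_left_mono C) auto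
      finally show "y j powr a * exp (- y j / z) \<le> z powr a * C * min ((y j / z) powr a) ((z / y j) powr a)"
        by (simp add: mult.assoc)
    qed
    also have "\<dots> \<le> z powr a * C * (2 / (1 - (1 / q) powr a))"
      unfolding sum_distrib_left[symmetric] using C z
      by (intro mult_left_mono lacunary_sum_bound[OF y a]) auto
    finally show ?thesis .
  qed
  then show ?thesis by (intro summableI_nonneg_bounded) auto
qed

text \<open>Dominated convergence for \<open>\<Sum>j. M j * exp (- y j / z)\<close>, in the form needed for sums of varying length.\<close>

lemma sum_exp_small:
  assumes y: "lacunary q y" "q > 1" and a: "a > 0" and z: "z > 0" and W: "W > 0" and \<epsilon>: "\<epsilon> > 0"
  shows "\<exists>J. \<exists>\<delta>>0. \<forall>M n. (\<forall>j. 0 \<le> M j \<and> M j \<le> y j powr a * W) \<longrightarrow> (\<forall>j<J. M j \<le> \<delta>) \<longrightarrow>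
    (\<Sum>j<n. M j * exp (- y j / z)) \<le> \<epsilon>"
proof -
  have ypos: "y k > 0" for k using y by (auto simp: lacunary_def)
  let ?s = "\<lambda>j. y j powr a * exp (- y j / z)"
  have s: "summable ?s" by (rule summable_lacunary_exp[OF y a z])
  have "(\<lambda>J. \<Sum>j. ?s (j + J)) \<longlonglongrightarrow> 0" by (rule suminf_exist_split2[OF s])
  then have "\<forall>\<^sub>F J in sequentially. (\<Sum>j. ?s (j + J)) < \<epsilon> / (2 * W)"
    using \<epsilon> W by (intro order_tendstoD) auto
  then obtain J where J: "(\<Sum>j. ?s (j + J)) < \<epsilon> / (2 * W)" unfolding eventually_sequentially by blast
  define nJ where "nJ = real J + 1"
  have "nJ > 0" by (simp add: nJ_def)
  define \<delta> where "\<delta> = \<epsilon> / 2 / nJ"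
  have \<delta>: "\<delta> > 0" using \<epsilon> \<open>nJ > 0\<close> by (simp add: \<delta>_def)
  have "(\<Sum>j<n. M j * exp (- y j / z)) \<le> \<epsilon>"
    if M: "\<forall>j. 0 \<le> M j \<and> M j \<le> y j powr a * W" and small: "\<forall>j<J. M j \<le> \<delta>" for M n
  proof -
    have "(\<Sum>j<n. M j * exp (- y j / z)) \<le> (\<Sum>j<J + n. M j * exp (- y j / z))"
      using M by (intro sum_mono2) auto
    also have "\<dots> = (\<Sum>j<J. M j * exp (- y j / z)) + (\<Sum>j<n. M (j + J) * exp (- y (j + J) / z))"
      by (induction n) (simp_all add: add.commute)
    also have "(\<Sum>j<J. M j * exp (- y j / z)) \<le> (\<Sum>j<J. \<delta> * 1)"
      using M small ypos z \<delta> by (intro sum_mono mult_mono) (auto simp: less_imp_le)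
    also have "\<dots> \<le> \<epsilon> / 2"
    proof -
      have "real J * \<delta> \<le> (real J + 1) * \<delta>" using \<delta> by (intro mult_right_mono) auto
      also have "\<dots> = \<epsilon> / 2" using \<open>nJ > 0\<close> by (simp add: \<delta>_def nJ_def[symmetric])
      finally show ?thesis by simp
    qed
    also have "(\<Sum>j<n. M (j + J) * exp (- y (j + J) / z)) \<le> (\<Sum>j<n. W * ?s (j + J))"
    proof (rule sum_mono)
      fix j
      have "M (j + J) * exp (- y (j + J) / z) \<le> (y (j + J) powr a * W) * exp (- y (j + J) / z)"
        using M by (intro mult_right_mono) auto
      then show "M (j + J) * exp (- y (j + J) / z) \<le> W * ?s (j + J)" by (simp add: mult_ac)
    qed
    also have "\<dots> \<le> W * (\<Sum>j. ?s (j + J))"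
      unfolding sum_distrib_left[symmetric] using W s
      by (intro mult_left_mono sum_le_suminf summable_ignore_initial_segment[OF s]) auto
    also have "\<dots> \<le> W * (\<epsilon> / (2 * W))" using J W by (intro mult_left_mono) auto
    also have "\<dots> = \<epsilon> / 2" using W by simp
    finally show ?thesis by simp
  qed
  then show ?thesis using \<delta> by blast
qed

lemma sets_nu: "sets (nu a) = sets (restrict_space borel {0..1})"
  unfolding nu_def by (simp add: sets_restrict_space)

text \<open>A mass at \<open>t = 1\<close> would bound all moments, and hence the terms of the series, away from \<open>0\<close>.\<close>

lemma singleton_one_null:
  assumes x: "lacunary q x" "q > 1"
    and \<mu>: "sets \<mu> = sets (restrict_space borel {0..1})"
    and g: "\<gamma> \<ge> 0" and t: "\<tau> > 0"
    and T: "\<And>k. (\<integral>\<^sup>+t. ennreal (t powr (v k)) \<partial>\<mu>) = ennreal (T k)" "\<And>k. T k \<ge> 0"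
    and c: "\<And>k. c k = x k powr \<gamma> * T k powr \<tau>" and sc: "summable c"
  shows "emeasure \<mu> {1} = 0"
proof -
  have xpos: "x k > 0" and xm: "strict_mono x" for k
    using lacunary_pos[OF x(1)] lacunary_strict_mono[OF x] by auto
  have one: "{1} \<in> sets \<mu>" unfolding \<mu> by (auto simp: sets_restrict_space intro!: image_eqI[of _ _ "{1}"])
  have le: "emeasure \<mu> {1} \<le> ennreal (T k)" for k
  proof -
    have "emeasure \<mu> {1} = (\<integral>\<^sup>+t. indicator {1} t \<partial>\<mu>)" using one by simp
    also have "\<dots> \<le> (\<integral>\<^sup>+t. ennreal (t powr (v k)) \<partial>\<mu>)"
      by (intro nn_integral_mono) (auto simp: indicator_def)
    finally show ?thesis by (simp add: T)
  qed
  have "emeasure \<mu> {1} < \<infinity>" using le[of 0] by (rule le_less_trans) simp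
  then obtain s where s: "emeasure \<mu> {1} = ennreal s" "s \<ge> 0"
    by (metis ennreal_cases infinity_ennreal_def less_irrefl)
  have "s = 0"
  proof (rule ccontr)
    assume "s \<noteq> 0"
    then have "s > 0" using s by simp
    define e where "e = x 0 powr \<gamma> * s powr \<tau>"
    have e: "e > 0" using \<open>s > 0\<close> xpos[of 0] by (simp add: e_def)
    have "c k \<ge> e" for k
    proof -
      have "s \<le> T k" using le[of k] s T(2)[of k] by (simp add: ennreal_le_iff)
      moreover have "x 0 \<le> x k" using xm by (simp add: strict_mono_less_eq)
      ultimately show ?thesis unfolding c e_def using g t s xpos[of 0]
        by (intro mult_mono powr_mono2) auto
    qed
    moreover have "\<forall>\<^sub>F k in sequentially. c k < e"
      using summable_LIMSEQ_zero[OF sc] e by (rule order_tendstoD)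
    ultimately show False unfolding eventually_sequentially using not_le by blast
  qed
  then show ?thesis using s by simp
qed

section \<open>Sufficiency of the summability condition and compactness\<close>

text \<open>The summability condition, with a tail \<open>x\<close> of the lacunary part for which the growth conditions hold from the
start. The moment of the smallest exponent \<open>l 0\<close> is finite as well; it accounts for the part of \<open>\<mu>\<close> near \<open>0\<close>.\<close>

locale carleson_data =
  fixes l :: "nat \<Rightarrow> real" and n :: "nat \<Rightarrow> int" and x T c :: "nat \<Rightarrow> real" and q Q \<alpha> \<beta> p r T0 :: real
    and \<mu> :: "real measure"
  assumes ms: "muentz_sequence l" and ql: "quasi_lacunary l n"
    and x: "lacunary q x" "q > 1" and Q: "\<And>k. x (Suc k) \<le> Q * x k"
    and \<mu>: "sets \<mu> = sets (restrict_space borel {0..1})"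
    and p: "p \<ge> 1" and \<beta>: "0 < \<beta>" "\<beta> < 1" and r: "r = p / \<beta>" and \<alpha>: "\<alpha> > 0"
    and T0: "(\<integral>\<^sup>+t. ennreal (t powr (p * l 0)) \<partial>\<mu>) = ennreal T0" "T0 \<ge> 0"
    and T: "\<And>k. (\<integral>\<^sup>+t. ennreal (t powr (p * x k)) \<partial>\<mu>) = ennreal (T k)" "\<And>k. T k \<ge> 0"
    and c: "\<And>k. c k = x k powr (\<beta> * \<alpha> / (1 - \<beta>)) * T k powr (1 / (1 - \<beta>))" and sc: "summable c"
begin

lemma r1: "r > 1"
  using p \<beta> by (simp add: r less_divide_eq)

lemma measurable_\<mu>: "f \<in> borel_measurable borel \<Longrightarrow> f \<in> borel_measurable \<mu>"
  by (rule borel_measurable_unit_interval[OF \<mu>])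

lemma space_\<mu>: "space \<mu> = {0..1}"
  by (rule space_unit_interval[OF \<mu>])

lemma embedding:
  "\<exists>C>0. \<forall>f\<in>muentz_space l. \<forall>R\<ge>0.
     (\<integral>\<^sup>+t. ennreal (norm (f t) powr r) \<partial>nu (\<alpha> - 1)) \<le> ennreal R \<longrightarrow>
     (\<integral>\<^sup>+t. ennreal (norm (f t) powr p) \<partial>\<mu>) \<le> ennreal (C * R powr \<beta>)"
proof (rule muentz_blocks[OF ms ql \<alpha> r1])
  fix q' y N C and M :: "(nat \<Rightarrow> complex) \<Rightarrow> nat \<Rightarrow> real"
  assume y: "q' > 1" "lacunary q' y" and y0: "y 0 = l 0" and C: "C > 0"
    and M0: "\<And>b j. 0 \<le> M b j" and "\<And>b j. M b j \<le> C * (\<Sum>i<N j. norm (b i))"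
    and Mf: "\<And>b n t. (\<And>i. i \<ge> n \<Longrightarrow> b i = 0) \<Longrightarrow> t \<in> {0..1} \<Longrightarrow>
      norm (muentz_sum l b n t) \<le> (\<Sum>j<n. M b j * t powr y j)"
    and MR: "\<And>b n R. (\<And>i. i \<ge> n \<Longrightarrow> b i = 0) \<Longrightarrow> R \<ge> 0 \<Longrightarrow>
      (\<integral>\<^sup>+t. ennreal (norm (muentz_sum l b n t) powr r) \<partial>nu (\<alpha> - 1)) \<le> ennreal R \<Longrightarrow>
      (\<Sum>j<n. (y j powr (- (\<alpha> / r)) * M b j) powr r) \<le> C * R"
  obtain B where B: "B > 0" "\<And>M n X k1. (\<forall>j. 0 \<le> M j) \<Longrightarrow> X \<ge> 0 \<Longrightarrow> (\<Sum>j<n. (y j powr (- (\<alpha> / r)) * M j) powr r) \<le> X \<Longrightarrow>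
    envelope x y M n 0 powr p \<le> B * X powr \<beta> \<and>
    (\<integral>\<^sup>+t. ennreal ((\<Sum>j<n. M j * t powr y j) powr p) \<partial>\<mu>) \<le>
      ennreal (B * (envelope x y M n 0 powr p + (\<Sum>k<k1. envelope x y M n k powr p * T k)
        + X powr \<beta> * (\<Sum>k. c (k + k1)) powr (1 - \<beta>)))"
    using integral_majorant_le[OF x Q y(2,1) \<mu> p \<beta> r \<alpha> T0[folded y0] T c sc] by blast
  define \<delta> where "\<delta> = (\<Sum>k. c (k + 0)) powr (1 - \<beta>)"
  have \<delta>: "\<delta> \<ge> 0" by (simp add: \<delta>_def)
  define C' where "C' = B * (B + \<delta>) * C powr \<beta>"
  show ?thesis
  proof (intro exI[of _ C'] conjI ballI allI impI)
    show "C' > 0" using B C \<delta> by (simp add: C'_def add_pos_nonneg)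
    fix f R assume f: "f \<in> muentz_space l" and R: "(R::real) \<ge> 0"
      and le: "(\<integral>\<^sup>+t. ennreal (norm (f t) powr r) \<partial>nu (\<alpha> - 1)) \<le> ennreal R"
    obtain b m where b: "\<And>i. i \<ge> m \<Longrightarrow> b i = 0" and fb: "f = muentz_sum l b m"
      using f unfolding muentz_space_iff by blast
    define X where "X = C * R"
    have X: "X \<ge> 0" using C R by (simp add: X_def)
    have MX: "(\<Sum>j<m. (y j powr (- (\<alpha> / r)) * M b j) powr r) \<le> X"
      unfolding X_def using b R le[unfolded fb] by (rule MR)
    have F0: "envelope x y (M b) m 0 powr p \<le> B * X powr \<beta>"
      using B(2)[OF _ X MX] M0 by blast
    have "(\<integral>\<^sup>+t. ennreal (norm (f t) powr p) \<partial>\<mu>) \<le> (\<integral>\<^sup>+t. ennreal ((\<Sum>j<m. M b j * t powr y j) powr p) \<partial>\<mu>)"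
    proof (intro nn_integral_mono ennreal_leI powr_mono2)
      fix t assume "t \<in> space \<mu>"
      then show "norm (f t) \<le> (\<Sum>j<m. M b j * t powr y j)"
        unfolding fb space_\<mu> by (intro Mf b)
    qed (use p in auto)
    also have "\<dots> \<le> ennreal (B * (envelope x y (M b) m 0 powr p + (\<Sum>k<0. envelope x y (M b) m k powr p * T k)
        + X powr \<beta> * (\<Sum>k. c (k + 0)) powr (1 - \<beta>)))"
      using B(2)[OF _ X MX] M0 by blast
    also have "\<dots> \<le> ennreal (B * (B * X powr \<beta> + X powr \<beta> * \<delta>))"
      using F0 B(1) by (intro ennreal_leI mult_left_mono add_mono) (auto simp: \<delta>_def)
    also have "B * (B * X powr \<beta> + X powr \<beta> * \<delta>) = C' * R powr \<beta>"
      using C R by (simp add: C'_def X_def powr_mult algebra_simps)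
    finally show "(\<integral>\<^sup>+t. ennreal (norm (f t) powr p) \<partial>\<mu>) \<le> ennreal (C' * R powr \<beta>)" .
  qed
qed

lemma unit_ballD:
  assumes "f \<in> muentz_unit_ball l \<alpha> r"
  shows "f \<in> muentz_space l" "(\<integral>\<^sup>+t. ennreal (norm (f t) powr r) \<partial>nu (\<alpha> - 1)) \<le> ennreal 1" "f \<in> Lp_fun \<mu> p"
proof -
  show f: "f \<in> muentz_space l" using assms by (simp add: muentz_unit_ball_def)
  have "Lp_norm (nu (\<alpha> - 1)) r f \<le> ennreal 1" using assms by (simp add: muentz_unit_ball_def)
  then show le: "(\<integral>\<^sup>+t. ennreal (norm (f t) powr r) \<partial>nu (\<alpha> - 1)) \<le> ennreal 1"
    using r1 by (subst (asm) Lp_norm_le_iff) auto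
  obtain C where "(\<integral>\<^sup>+t. ennreal (norm (f t) powr p) \<partial>\<mu>) \<le> ennreal (C * 1 powr \<beta>)"
    using embedding f le by (meson zero_le_one)
  then have "(\<integral>\<^sup>+t. ennreal (norm (f t) powr p) \<partial>\<mu>) < \<infinity>" by (rule le_less_trans) simp
  then show "f \<in> Lp_fun \<mu> p"
    unfolding Lp_fun_def Lp_norm_def ennpowr_less_top_iff
    using measurable_\<mu>[OF muentz_space_measurable[OF f]] by simp
qed

text \<open>The majorants of the differences \<open>g i - g i'\<close> have uniformly bounded weighted norms, and each of their coefficients
tends to \<open>0\<close>. By \<open>sum_exp_small\<close> every value of the envelope tends to \<open>0\<close>; the remaining terms of the series are
uniformly small by \<open>integral_majorant_le\<close> for large \<open>k1\<close>.\<close>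

lemma convergent_coefficients_imp_small:
  fixes b :: "nat \<Rightarrow> nat \<Rightarrow> complex" and w :: "nat \<Rightarrow> nat"
  assumes b0: "\<And>i m. m \<ge> w i \<Longrightarrow> b i m = 0"
    and bR: "\<And>i. (\<integral>\<^sup>+t. ennreal (norm (muentz_sum l (b i) (w i) t) powr r) \<partial>nu (\<alpha> - 1)) \<le> ennreal 1"
    and lim: "\<And>m. (\<lambda>i. b i m) \<longlonglongrightarrow> L m"
  defines "g \<equiv> (\<lambda>i. muentz_sum l (b i) (w i))"
  shows "\<And>\<epsilon>. \<epsilon> > 0 \<Longrightarrow> \<exists>I. \<forall>i\<ge>I. \<forall>i'\<ge>I. (\<integral>\<^sup>+t. ennreal (norm (g i t - g i' t) powr p) \<partial>\<mu>) \<le> ennreal \<epsilon>"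
    and "\<And>t. t \<in> {0..<1} \<Longrightarrow> Cauchy (\<lambda>i. g i t)"
proof -
  have "(\<forall>\<epsilon>>0. \<exists>I. \<forall>i\<ge>I. \<forall>i'\<ge>I. (\<integral>\<^sup>+t. ennreal (norm (g i t - g i' t) powr p) \<partial>\<mu>) \<le> ennreal \<epsilon>) \<and>
    (\<forall>t\<in>{0..<1}. Cauchy (\<lambda>i. g i t))"
  proof (rule muentz_blocks[OF ms ql \<alpha> r1])
    fix q' y N C and M :: "(nat \<Rightarrow> complex) \<Rightarrow> nat \<Rightarrow> real"
    assume y: "q' > 1" "lacunary q' y" and y0: "y 0 = l 0" and C: "C > 0"
      and M0: "\<And>b j. 0 \<le> M b j" and MN: "\<And>b j. M b j \<le> C * (\<Sum>i<N j. norm (b i))"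
      and Mf: "\<And>b n t. (\<And>i. i \<ge> n \<Longrightarrow> b i = 0) \<Longrightarrow> t \<in> {0..1} \<Longrightarrow>
        norm (muentz_sum l b n t) \<le> (\<Sum>j<n. M b j * t powr y j)"
      and MR: "\<And>b n R. (\<And>i. i \<ge> n \<Longrightarrow> b i = 0) \<Longrightarrow> R \<ge> 0 \<Longrightarrow>
        (\<integral>\<^sup>+t. ennreal (norm (muentz_sum l b n t) powr r) \<partial>nu (\<alpha> - 1)) \<le> ennreal R \<Longrightarrow>
        (\<Sum>j<n. (y j powr (- (\<alpha> / r)) * M b j) powr r) \<le> C * R"
    obtain B where B: "B > 0" "\<And>M n X k1. (\<forall>j. 0 \<le> M j) \<Longrightarrow> X \<ge> 0 \<Longrightarrow> (\<Sum>j<n. (y j powr (- (\<alpha> / r)) * M j) powr r) \<le> X \<Longrightarrow>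
      envelope x y M n 0 powr p \<le> B * X powr \<beta> \<and>
      (\<integral>\<^sup>+t. ennreal ((\<Sum>j<n. M j * t powr y j) powr p) \<partial>\<mu>) \<le>
        ennreal (B * (envelope x y M n 0 powr p + (\<Sum>k<k1. envelope x y M n k powr p * T k)
          + X powr \<beta> * (\<Sum>k. c (k + k1)) powr (1 - \<beta>)))"
      using integral_majorant_le[OF x Q y(2,1) \<mu> p \<beta> r \<alpha> T0[folded y0] T c sc] by blast
    define a where "a = \<alpha> / r"
    have a: "a > 0" using \<alpha> r1 by (simp add: a_def)
    have xpos: "x k > 0" and ypos: "y k > 0" for k using x y by (auto simp: lacunary_def)
    have c0: "c k \<ge> 0" for k by (simp add: c)
    define X where "X = C * (2 powr r * 2)"
    have X: "X > 0" using C by (simp add: X_def)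
    define W where "W = X powr (1 / r)"
    have W: "W > 0" using X by (simp add: W_def)
    define d where "d = (\<lambda>i i' m. b i m - b i' m)"
    define ww where "ww = (\<lambda>i i'. max (w i) (w i'))"
    have d0: "d i i' m = 0" if "m \<ge> ww i i'" for i i' m using that b0 by (simp add: d_def ww_def)
    have gd: "g i t - g i' t = muentz_sum l (d i i') (ww i i') t" for i i' t
    proof -
      have "muentz_sum l (b i) (ww i i') = g i" "muentz_sum l (b i') (ww i i') = g i'"
        unfolding g_def using b0 by (auto intro!: muentz_sum_extend simp: ww_def)
      then show ?thesis
        by (simp add: muentz_sum_def d_def left_diff_distrib sum_subtractf fun_eq_iff)
    qed
    define K where "K = (\<lambda>i i' j. if j < ww i i' then M (d i i') j else 0)"
    have K0: "0 \<le> K i i' j" for i i' j using M0 by (simp add: K_def)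
    have KS: "(\<Sum>j<ww i i'. K i i' j * h j) = (\<Sum>j<ww i i'. M (d i i') j * h j)" for i i' and h :: "nat \<Rightarrow> real"
      by (simp add: K_def)
    have dR: "(\<integral>\<^sup>+t. ennreal (norm (muentz_sum l (d i i') (ww i i') t) powr r) \<partial>nu (\<alpha> - 1)) \<le> ennreal (2 powr r * 2)" for i i'
    proof -
      have gm: "(\<lambda>t. ennreal (norm (g i t) powr r)) \<in> borel_measurable (nu (\<alpha> - 1))" for i
        by (intro borel_measurable_unit_interval[OF sets_nu]) (simp add: g_def)
      have "(\<integral>\<^sup>+t. ennreal (norm (g i t - g i' t) powr r) \<partial>nu (\<alpha> - 1)) \<le>
          (\<integral>\<^sup>+t. ennreal (2 powr r) * (ennreal (norm (g i t) powr r) + ennreal (norm (g i' t) powr r)) \<partial>nu (\<alpha> - 1))"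
      proof (intro nn_integral_mono)
        fix t
        have "norm (g i t - g i' t) powr r \<le> (norm (g i t) + norm (g i' t)) powr r"
          using r1 by (intro powr_mono2 norm_triangle_ineq4) auto
        also have "\<dots> \<le> 2 powr r * (norm (g i t) powr r + norm (g i' t) powr r)"
          using r1 by (intro powr_add_le) auto
        finally show "ennreal (norm (g i t - g i' t) powr r) \<le> ennreal (2 powr r) * (ennreal (norm (g i t) powr r) + ennreal (norm (g i' t) powr r))"
          by (simp add: ennreal_mult[symmetric] ennreal_plus[symmetric] ennreal_leI del: ennreal_plus)
      qed
      also have "\<dots> = ennreal (2 powr r) * ((\<integral>\<^sup>+t. ennreal (norm (g i t) powr r) \<partial>nu (\<alpha> - 1)) + (\<integral>\<^sup>+t. ennreal (norm (g i' t) powr r) \<partial>nu (\<alpha> - 1)))"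
        using gm[of i] gm[of i'] by (subst nn_integral_cmult, measurable) (simp add: nn_integral_add)
      also have "\<dots> \<le> ennreal (2 powr r) * (ennreal 1 + ennreal 1)"
        using bR unfolding g_def by (intro mult_left_mono add_mono) auto
      also have "\<dots> = ennreal (2 powr r * 2)"
        by (simp add: ennreal_mult)
      finally show ?thesis unfolding gd .
    qed
    have KX: "(\<Sum>j<ww i i'. (y j powr (- (\<alpha> / r)) * K i i' j) powr r) \<le> X" for i i'
    proof -
      have "(\<Sum>j<ww i i'. (y j powr (- (\<alpha> / r)) * K i i' j) powr r) = (\<Sum>j<ww i i'. (y j powr (- (\<alpha> / r)) * M (d i i') j) powr r)"
        by (simp add: K_def)
      also have "\<dots> \<le> X" unfolding X_def using d0 dR by (intro MR) auto
      finally show ?thesis .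
    qed
    have KW: "K i i' j \<le> y j powr a * W" for i i' j
    proof (cases "j < ww i i'")
      case True
      have "(y j powr (- a) * K i i' j) powr r \<le> (\<Sum>j<ww i i'. (y j powr (- a) * K i i' j) powr r)"
        using True by (intro member_le_sum) auto
      also have "\<dots> \<le> X" using KX by (simp add: a_def)
      finally have "((y j powr (- a) * K i i' j) powr r) powr (1 / r) \<le> W"
        unfolding W_def using r1 by (intro powr_mono2) auto
      then have "y j powr (- a) * K i i' j \<le> W" using r1 K0 by (simp add: powr_powr)
      then have "y j powr a * (y j powr (- a) * K i i' j) \<le> y j powr a * W" by (intro mult_left_mono) auto
      moreover have "y j powr a * y j powr (- a) = 1" using ypos[of j] by (simp add: powr_add[symmetric])
      ultimately show ?thesis by (simp add: mult.assoc[symmetric])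
    qed (use W in \<open>simp add: K_def\<close>)
    have Ksmall: "\<exists>I. \<forall>i\<ge>I. \<forall>i'\<ge>I. \<forall>j<J. K i i' j \<le> \<delta>" if \<delta>: "\<delta> > 0" for \<delta> J
    proof -
      define h where "h = (\<lambda>j i. C * (\<Sum>m<N j. norm (b i m - L m)))"
      have "h j \<longlonglongrightarrow> C * (\<Sum>m<N j. norm (L m - L m))" for j
        unfolding h_def by (intro tendsto_intros lim)
      then have "\<forall>\<^sub>F i in sequentially. h j i < \<delta> / 2" for j
        using \<delta> by (intro order_tendstoD) auto
      then have "\<forall>\<^sub>F i in sequentially. \<forall>j\<in>{..<J}. h j i < \<delta> / 2"
        by (intro eventually_ball_finite) auto
      then obtain I where I: "\<And>i j. i \<ge> I \<Longrightarrow> j < J \<Longrightarrow> h j i < \<delta> / 2"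
        unfolding eventually_sequentially by blast
      have "K i i' j \<le> \<delta>" if "i \<ge> I" "i' \<ge> I" "j < J" for i i' j
      proof -
        have "K i i' j \<le> C * (\<Sum>m<N j. norm (d i i' m))"
          using MN[of "d i i'" j] C by (auto simp: K_def intro!: mult_nonneg_nonneg sum_nonneg)
        also have "\<dots> \<le> C * (\<Sum>m<N j. norm (b i m - L m) + norm (b i' m - L m))"
        proof (intro mult_left_mono sum_mono)
          fix m
          show "norm (d i i' m) \<le> norm (b i m - L m) + norm (b i' m - L m)"
            using norm_triangle_ineq4[of "b i m - L m" "b i' m - L m"] by (simp add: d_def)
        qed (use C in auto)
        also have "\<dots> = h j i + h j i'" by (simp add: h_def sum.distrib distrib_left)
        also have "\<dots> \<le> \<delta>" using I[OF that(1,3)] I[OF that(2,3)] by simp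
        finally show ?thesis .
      qed
      then show ?thesis by blast
    qed
    have small: "\<exists>I. \<forall>i\<ge>I. \<forall>i'\<ge>I. (\<Sum>j<ww i i'. K i i' j * exp (- y j / z)) \<le> \<epsilon>"
      if zpos: "z > 0" and \<epsilon>pos: "\<epsilon> > 0" for z \<epsilon>
    proof -
      obtain J \<delta> where J: "\<delta> > 0" "\<And>M n. (\<forall>j. 0 \<le> M j \<and> M j \<le> y j powr a * W) \<Longrightarrow> (\<forall>j<J. M j \<le> \<delta>) \<Longrightarrow>
          (\<Sum>j<n. M j * exp (- y j / z)) \<le> \<epsilon>"
        using sum_exp_small[OF y(2,1) a zpos W \<epsilon>pos] by blast
      obtain I where "\<forall>i\<ge>I. \<forall>i'\<ge>I. \<forall>j<J. K i i' j \<le> \<delta>" using Ksmall[OF J(1)] by blast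
      then show ?thesis using J(2) K0 KW by (intro exI[of _ I]) blast
    qed
    have norm_le: "norm (g i t - g i' t) \<le> (\<Sum>j<ww i i'. K i i' j * t powr y j)" if "t \<in> {0..1}" for i i' t
      unfolding gd KS using d0 that by (intro Mf) auto
    have cauchy_Lp: "\<exists>I. \<forall>i\<ge>I. \<forall>i'\<ge>I. (\<integral>\<^sup>+t. ennreal (norm (g i t - g i' t) powr p) \<partial>\<mu>) \<le> ennreal \<epsilon>"
      if \<epsilon>: "\<epsilon> > 0" for \<epsilon>
    proof -
      \<comment> \<open>\<open>e1\<close> makes the tail of the series contribute at most \<open>\<epsilon> / 2\<close>, \<open>e2\<close> does the same for its first \<open>k1\<close> terms.\<close>
      define e1 where "e1 = (\<epsilon> / 2 / (B * X powr \<beta>)) powr (1 / (1 - \<beta>))"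
      have e1: "e1 > 0" using \<epsilon> B X by (simp add: e1_def)
      have "(\<lambda>k1. \<Sum>k. c (k + k1)) \<longlonglongrightarrow> 0" by (rule suminf_exist_split2[OF sc])
      then have "\<forall>\<^sub>F k1 in sequentially. (\<Sum>k. c (k + k1)) < e1" using e1 by (intro order_tendstoD) auto
      then obtain k1 where k1: "(\<Sum>k. c (k + k1)) < e1" unfolding eventually_sequentially by blast
      have ck: "(\<Sum>k. c (k + k1)) \<ge> 0" using c0 sc by (intro suminf_nonneg) (auto simp: summable_iff_shift)
      have "(\<Sum>k. c (k + k1)) powr (1 - \<beta>) \<le> e1 powr (1 - \<beta>)" using k1 ck \<beta> by (intro powr_mono2) auto
      also have "\<dots> = \<epsilon> / 2 / (B * X powr \<beta>)" using \<beta> \<epsilon> B X by (simp add: e1_def powr_powr)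
      finally have "B * X powr \<beta> * (\<Sum>k. c (k + k1)) powr (1 - \<beta>) \<le> B * X powr \<beta> * (\<epsilon> / 2 / (B * X powr \<beta>))"
        using B X by (intro mult_left_mono) auto
      also have "\<dots> = \<epsilon> / 2" using B X by simp
      finally have tail: "B * X powr \<beta> * (\<Sum>k. c (k + k1)) powr (1 - \<beta>) \<le> \<epsilon> / 2" .
      define S where "S = 1 + (\<Sum>k<k1. T k)"
      have S: "S > 0" unfolding S_def using T(2) by (intro add_pos_nonneg sum_nonneg) auto
      define e2 where "e2 = (\<epsilon> / 2 / (B * S)) powr (1 / p)"
      have e2: "e2 > 0" using \<epsilon> B S by (simp add: e2_def)
      have e2p: "e2 powr p = \<epsilon> / 2 / (B * S)" using p \<epsilon> B S by (simp add: e2_def powr_powr)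
      have "\<forall>k. \<exists>I. \<forall>i\<ge>I. \<forall>i'\<ge>I. envelope x y (K i i') (ww i i') k \<le> e2"
        unfolding envelope_def using small xpos e2 by blast
      then obtain II where II: "\<And>k i i'. i \<ge> II k \<Longrightarrow> i' \<ge> II k \<Longrightarrow> envelope x y (K i i') (ww i i') k \<le> e2"
        by metis
      define I where "I = Max (II ` {..k1})"
      have I: "II k \<le> I" if "k \<le> k1" for k unfolding I_def using that by (intro Max_ge) auto
      have "(\<integral>\<^sup>+t. ennreal (norm (g i t - g i' t) powr p) \<partial>\<mu>) \<le> ennreal \<epsilon>" if i: "i \<ge> I" "i' \<ge> I" for i i'
      proof -
        let ?F = "envelope x y (K i i') (ww i i')"
        have F: "?F k powr p \<le> e2 powr p" if "k \<le> k1" for k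
          using II[of k i i'] I[OF that] i p by (intro powr_mono2 envelope_nonneg K0) auto
        have "(\<integral>\<^sup>+t. ennreal (norm (g i t - g i' t) powr p) \<partial>\<mu>) \<le> (\<integral>\<^sup>+t. ennreal ((\<Sum>j<ww i i'. K i i' j * t powr y j) powr p) \<partial>\<mu>)"
          using p by (intro nn_integral_mono ennreal_leI powr_mono2 norm_le) (auto simp: space_\<mu>)
        also have "\<dots> \<le> ennreal (B * (?F 0 powr p + (\<Sum>k<k1. ?F k powr p * T k)
          + X powr \<beta> * (\<Sum>k. c (k + k1)) powr (1 - \<beta>)))"
          using B(2)[OF _ _ KX] X K0 by (meson less_imp_le)
        also have "\<dots> \<le> ennreal \<epsilon>"
        proof (rule ennreal_leI)
          have "?F 0 powr p + (\<Sum>k<k1. ?F k powr p * T k) \<le> e2 powr p + (\<Sum>k<k1. e2 powr p * T k)"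
            using T(2) by (intro add_mono sum_mono mult_right_mono F) auto
          also have "\<dots> = e2 powr p * S" by (simp add: S_def distrib_left sum_distrib_left)
          finally have "B * (?F 0 powr p + (\<Sum>k<k1. ?F k powr p * T k)) \<le> B * (e2 powr p * S)"
            using B by (intro mult_left_mono) auto
          also have "\<dots> = \<epsilon> / 2" unfolding e2p using B S by simp
          finally show "B * (?F 0 powr p + (\<Sum>k<k1. ?F k powr p * T k) + X powr \<beta> * (\<Sum>k. c (k + k1)) powr (1 - \<beta>)) \<le> \<epsilon>"
            using tail by (simp add: distrib_left mult.assoc)
        qed
        finally show ?thesis .
      qed
      then show ?thesis by blast
    qed
    have cauchy_pt: "Cauchy (\<lambda>i. g i t)" if t: "t \<in> {0..<1}" for t
    proof (cases "t = 0")
      case True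
      then have "(\<lambda>i. g i t) = (\<lambda>i. 0)" by (simp add: g_def muentz_sum_def fun_eq_iff)
      then show ?thesis by (simp add: Cauchy_def)
    next
      case False
      define z where "z = 1 / (- ln t)"
      have lt: "ln t < 0" using False t by simp
      then have z: "z > 0" by (simp add: z_def)
      have tz: "t powr v = exp (- v / z)" for v using False lt by (simp add: powr_def z_def)
      show ?thesis
      proof (rule CauchyI)
        fix e :: real assume e: "e > 0"
        then obtain I where I: "\<And>i i'. i \<ge> I \<Longrightarrow> i' \<ge> I \<Longrightarrow> (\<Sum>j<ww i i'. K i i' j * exp (- y j / z)) \<le> e / 2"
          using small[OF z, of "e / 2"] by auto
        have "norm (g i t - g i' t) < e" if "i \<ge> I" "i' \<ge> I" for i i'
          using norm_le[of t i i'] I[OF that] t e unfolding tz by simp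
        then show "\<exists>I. \<forall>i\<ge>I. \<forall>i'\<ge>I. norm (g i t - g i' t) < e" by blast
      qed
    qed
    show ?thesis using cauchy_Lp cauchy_pt by blast
  qed
  then show "\<And>\<epsilon>. \<epsilon> > 0 \<Longrightarrow> \<exists>I. \<forall>i\<ge>I. \<forall>i'\<ge>I. (\<integral>\<^sup>+t. ennreal (norm (g i t - g i' t) powr p) \<partial>\<mu>) \<le> ennreal \<epsilon>"
    and "\<And>t. t \<in> {0..<1} \<Longrightarrow> Cauchy (\<lambda>i. g i t)" by blast+
qed

lemma bounded_coefficients:
  "\<exists>E. \<forall>b w. (\<forall>i\<ge>w. b i = 0) \<longrightarrow>
    (\<integral>\<^sup>+t. ennreal (norm (muentz_sum l b w t) powr r) \<partial>nu (\<alpha> - 1)) \<le> ennreal 1 \<longrightarrow> norm (b m) \<le> E"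
proof (rule muentz_blocks[OF ms ql \<alpha> r1])
  fix q' y N C and M :: "(nat \<Rightarrow> complex) \<Rightarrow> nat \<Rightarrow> real"
  assume y: "q' > 1" "lacunary q' y" and C: "C > 0" and M0: "\<And>b j. 0 \<le> M b j"
    and MR: "\<And>b n R. (\<And>i. i \<ge> n \<Longrightarrow> b i = 0) \<Longrightarrow> R \<ge> 0 \<Longrightarrow>
      (\<integral>\<^sup>+t. ennreal (norm (muentz_sum l b n t) powr r) \<partial>nu (\<alpha> - 1)) \<le> ennreal R \<Longrightarrow>
      (\<Sum>j<n. (y j powr (- (\<alpha> / r)) * M b j) powr r) \<le> C * R"
    and "\<And>i. \<exists>k E. k \<le> i \<and> 0 \<le> E \<and> (\<forall>b. norm (b i) \<le> E * M b k)"
  then obtain k E where k: "k \<le> m" and E: "0 \<le> E" "\<And>b. norm (b m) \<le> E * M b k" by blast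
  have ypos: "y k > 0" using y by (auto simp: lacunary_def)
  define D where "D = E * (y k powr (\<alpha> / r) * C powr (1 / r))"
  have D: "D \<ge> 0" using E by (simp add: D_def)
  have "norm (b m) \<le> D" if b: "\<forall>i\<ge>w. b i = 0"
    and le: "(\<integral>\<^sup>+t. ennreal (norm (muentz_sum l b w t) powr r) \<partial>nu (\<alpha> - 1)) \<le> ennreal 1" for b w
  proof (cases "k < w")
    case True
    have "(y k powr (- (\<alpha> / r)) * M b k) powr r \<le> (\<Sum>j<w. (y j powr (- (\<alpha> / r)) * M b j) powr r)"
      using True by (intro member_le_sum) auto
    also have "\<dots> \<le> C * 1" using b le by (intro MR) auto
    finally have "((y k powr (- (\<alpha> / r)) * M b k) powr r) powr (1 / r) \<le> (C * 1) powr (1 / r)"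
      using r1 by (intro powr_mono2) auto
    then have "y k powr (- (\<alpha> / r)) * M b k \<le> C powr (1 / r)" using r1 M0 by (simp add: powr_powr)
    then have "y k powr (\<alpha> / r) * (y k powr (- (\<alpha> / r)) * M b k) \<le> y k powr (\<alpha> / r) * C powr (1 / r)"
      by (intro mult_left_mono) auto
    moreover have "y k powr (\<alpha> / r) * y k powr (- (\<alpha> / r)) = 1" using ypos by (simp add: powr_add[symmetric])
    ultimately have "M b k \<le> y k powr (\<alpha> / r) * C powr (1 / r)" by (simp add: mult.assoc[symmetric])
    then have "E * M b k \<le> D" unfolding D_def using E(1) by (rule mult_left_mono)
    then show ?thesis using E(2)[of b] by simp
  next
    case False
    then show ?thesis using b k D by simp
  qed
  then show ?thesis by blast
qed

text \<open>A diagonal argument gives convergence of all coefficients, and the pointwise limit is the limit in \<open>L\<^sup>p\<close> by Fatou's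
lemma.\<close>

lemma convergent_subsequence:
  assumes f: "\<And>i. f i \<in> muentz_unit_ball l \<alpha> r"
  obtains k G where "strict_mono (k :: nat \<Rightarrow> nat)" "G \<in> Lp_fun \<mu> p"
    "\<And>e. e > 0 \<Longrightarrow> \<exists>I. \<forall>i\<ge>I. Lp_norm \<mu> p (\<lambda>t. f (k i) t - G t) \<le> ennreal e"
proof -
  have "\<exists>b w. (\<forall>m\<ge>w. b m = 0) \<and> f i = muentz_sum l b w" for i
    using unit_ballD(1)[OF f] unfolding muentz_space_iff .
  then obtain b w where b0: "\<And>i m. m \<ge> w i \<Longrightarrow> b i m = 0" and fb: "\<And>i. f i = muentz_sum l (b i) (w i)"
    by metis
  obtain E where E: "\<And>m b w. (\<forall>i\<ge>w. b i = 0) \<Longrightarrow>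
    (\<integral>\<^sup>+t. ennreal (norm (muentz_sum l b w t) powr r) \<partial>nu (\<alpha> - 1)) \<le> ennreal 1 \<Longrightarrow> norm (b m) \<le> E m"
    using bounded_coefficients by metis
  have bE: "norm (b i m) \<le> E m" for i m
    using E[of "w i" "b i" m] b0 unit_ballD(2)[OF f, of i] fb by simp
  define E' where "E' = (\<lambda>m. max 1 (E m))"
  have E': "E' m > 0" "E m \<le> E' m" for m by (auto simp: E'_def less_max_iff_disj)
  have quotient_le: "norm (b i m / complex_of_real (E' m)) \<le> 1" for i m
    using bE[of i m] E'[of m] by (simp add: norm_divide divide_le_eq)
  obtain k where k: "strict_mono (k :: nat \<Rightarrow> nat)"
    "\<And>m. \<exists>L. (\<lambda>i. b (k i) m / complex_of_real (E' m)) \<longlonglongrightarrow> L"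
    by (rule function_convergent_subsequence[of UNIV "\<lambda>i m. b i m / complex_of_real (E' m)" 1])
      (use quotient_le in auto)
  then obtain L where "\<And>m. (\<lambda>i. b (k i) m / complex_of_real (E' m)) \<longlonglongrightarrow> L m" by metis
  then have "(\<lambda>i. complex_of_real (E' m) * (b (k i) m / complex_of_real (E' m))) \<longlonglongrightarrow> complex_of_real (E' m) * L m" for m
    by (intro tendsto_mult_left)
  moreover have "complex_of_real (E' m) * (z / complex_of_real (E' m)) = z" for m z using E'(1)[of m] by simp
  ultimately have lim: "(\<lambda>i. b (k i) m) \<longlonglongrightarrow> complex_of_real (E' m) * L m" for m by simp
  define g where "g = (\<lambda>i. f (k i))"
  have gb: "g = (\<lambda>i. muentz_sum l (b (k i)) (w (k i)))" by (simp add: g_def fb)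
  have gR: "(\<integral>\<^sup>+t. ennreal (norm (muentz_sum l (b (k i)) (w (k i)) t) powr r) \<partial>nu (\<alpha> - 1)) \<le> ennreal 1" for i
    using unit_ballD(2)[OF f, of "k i"] by (simp add: fb)
  have cauchy_Lp: "\<exists>I. \<forall>i\<ge>I. \<forall>i'\<ge>I. (\<integral>\<^sup>+t. ennreal (norm (g i t - g i' t) powr p) \<partial>\<mu>) \<le> ennreal \<epsilon>" if "\<epsilon> > 0" for \<epsilon>
    unfolding gb by (rule convergent_coefficients_imp_small(1)[OF _ gR lim that]) (rule b0)
  have cauchy_pt: "Cauchy (\<lambda>i. g i t)" if "t \<in> {0..<1}" for t
    unfolding gb by (rule convergent_coefficients_imp_small(2)[OF _ gR lim that]) (rule b0)
  have gm: "g i \<in> borel_measurable \<mu>" and gL: "g i \<in> Lp_fun \<mu> p" for i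
    using unit_ballD(3)[OF f, of "k i"] by (auto simp: g_def Lp_fun_def)
  define G where "G = (\<lambda>t. lim (\<lambda>i. if t < 1 then g i t else 0))"
  have conv: "(\<lambda>i. if t < 1 then g i t else 0) \<longlonglongrightarrow> G t" if "t \<in> space \<mu>" for t
  proof -
    have "convergent (\<lambda>i. if t < 1 then g i t else 0)"
      using cauchy_pt[of t] that by (cases "t < 1") (auto simp: space_\<mu> Cauchy_convergent convergent_const)
    then show ?thesis unfolding G_def by (simp add: convergent_LIMSEQ_iff)
  qed
  have Gm: "G \<in> borel_measurable \<mu>"
  proof (rule borel_measurable_LIMSEQ_metric[OF _ conv])
    fix i
    have "(\<lambda>t::real. t) \<in> borel_measurable \<mu>" by (rule measurable_\<mu>) simp
    then show "(\<lambda>t. if t < 1 then g i t else 0) \<in> borel_measurable \<mu>" using gm[of i] by measurable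
  qed
  have null: "emeasure \<mu> {1} = 0"
    by (rule singleton_one_null[OF x \<mu> _ _ T c sc]) (use \<alpha> \<beta> in auto)
  have ae: "AE t in \<mu>. t \<noteq> 1"
  proof (rule AE_I[of _ _ "{1}"])
    show "{1} \<in> sets \<mu>" unfolding \<mu> by (auto simp: sets_restrict_space intro!: image_eqI[of _ _ "{1}"])
  qed (use null in auto)
  have small: "\<exists>I. \<forall>i\<ge>I. Lp_norm \<mu> p (\<lambda>t. g i t - G t) \<le> ennreal e" if e: "e > 0" for e
  proof -
    have "e powr p > 0" using e by simp
    then obtain I where I: "\<And>i i'. i \<ge> I \<Longrightarrow> i' \<ge> I \<Longrightarrow> (\<integral>\<^sup>+t. ennreal (norm (g i t - g i' t) powr p) \<partial>\<mu>) \<le> ennreal (e powr p)"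
      using cauchy_Lp by blast
    have "Lp_norm \<mu> p (\<lambda>t. g i t - G t) \<le> ennreal e" if i: "i \<ge> I" for i
    proof -
      have "(\<integral>\<^sup>+t. ennreal (norm (g i t - G t) powr p) \<partial>\<mu>) =
          (\<integral>\<^sup>+t. liminf (\<lambda>i'. ennreal (norm (g i t - g i' t) powr p)) \<partial>\<mu>)"
      proof (rule nn_integral_cong_AE)
        show "AE t in \<mu>. ennreal (norm (g i t - G t) powr p) = liminf (\<lambda>i'. ennreal (norm (g i t - g i' t) powr p))"
          using ae AE_space
        proof eventually_elim
          case (elim t)
          then have "t < 1" by (simp add: space_\<mu>)
          then have "(\<lambda>i'. g i' t) \<longlonglongrightarrow> G t" using conv[OF elim(2)] by simp
          then have "(\<lambda>i'. ennreal (norm (g i t - g i' t) powr p)) \<longlonglongrightarrow> ennreal (norm (g i t - G t) powr p)"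
            using p by (intro tendsto_ennrealI tendsto_powr' tendsto_intros) auto
          then show ?case by (rule lim_imp_Liminf[OF sequentially_bot, symmetric])
        qed
      qed
      also have "\<dots> \<le> liminf (\<lambda>i'. \<integral>\<^sup>+t. ennreal (norm (g i t - g i' t) powr p) \<partial>\<mu>)"
        using gm by (intro nn_integral_liminf) measurable
      also have "\<dots> \<le> limsup (\<lambda>i'. \<integral>\<^sup>+t. ennreal (norm (g i t - g i' t) powr p) \<partial>\<mu>)"
        by (rule Liminf_le_Limsup) simp
      also have "\<dots> \<le> ennreal (e powr p)"
        by (rule Limsup_bounded) (use I[OF i] in \<open>auto simp: eventually_sequentially\<close>)
      finally show ?thesis using p e by (subst Lp_norm_le_iff) auto
    qed
    then show ?thesis by blast
  qed
  have "G \<in> Lp_fun \<mu> p"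
  proof -
    obtain I where I: "Lp_norm \<mu> p (\<lambda>t. g I t - G t) \<le> ennreal 1" using small[of 1] by auto
    have "Lp_norm \<mu> p (\<lambda>t. g I t + (G t - g I t)) \<le> Lp_norm \<mu> p (g I) + Lp_norm \<mu> p (\<lambda>t. G t - g I t)"
      using gm[of I] Gm by (intro Lp_norm_triangle p) auto
    also have "Lp_norm \<mu> p (\<lambda>t. G t - g I t) = Lp_norm \<mu> p (\<lambda>t. g I t - G t)" by (rule Lp_norm_minus)
    also have "Lp_norm \<mu> p (g I) + \<dots> < \<infinity>"
      using gL[of I] le_less_trans[OF I ennreal_less_top] by (simp add: Lp_fun_def)
    finally show ?thesis using Gm by (simp add: Lp_fun_def)
  qed
  then show ?thesis using that[OF k(1)] small unfolding g_def by blast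
qed

lemma compact: "muentz_embedding_compact l \<alpha> r p \<mu>"
proof -
  interpret Metric_space "Lp_space \<mu> p" "Lp_dist \<mu> p" using p by (rule Metric_space_Lp)
  define S where "S = Lp_class \<mu> p ` muentz_unit_ball l \<alpha> r"
  have in_space: "Lp_class \<mu> p f \<in> Lp_space \<mu> p" if "f \<in> Lp_fun \<mu> p" for f
    unfolding Lp_class_def Lp_space_def using that by (rule quotientI)
  have S: "S \<subseteq> Lp_space \<mu> p" unfolding S_def using in_space unit_ballD(3) by auto
  have "compactin mtopology (mtopology closure_of S)"
  proof (rule compactin_closure_of_sequentially[OF S])
    fix \<sigma> :: "nat \<Rightarrow> (real \<Rightarrow> complex) set" assume "range \<sigma> \<subseteq> S"
    then have "\<forall>i. \<exists>f. f \<in> muentz_unit_ball l \<alpha> r \<and> \<sigma> i = Lp_class \<mu> p f"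
      unfolding S_def by blast
    from choice[OF this] obtain f where f: "\<And>i. f i \<in> muentz_unit_ball l \<alpha> r" "\<And>i. \<sigma> i = Lp_class \<mu> p (f i)"
      by blast
    obtain k G where k: "strict_mono (k :: nat \<Rightarrow> nat)" and G: "G \<in> Lp_fun \<mu> p"
      and lim: "\<And>e. e > 0 \<Longrightarrow> \<exists>I. \<forall>i\<ge>I. Lp_norm \<mu> p (\<lambda>t. f (k i) t - G t) \<le> ennreal e"
    proof (rule convergent_subsequence[OF f(1)])
      fix k :: "nat \<Rightarrow> nat" and G
      assume "strict_mono k" "G \<in> Lp_fun \<mu> p"
        "\<And>e. e > 0 \<Longrightarrow> \<exists>I. \<forall>i\<ge>I. Lp_norm \<mu> p (\<lambda>t. f (k i) t - G t) \<le> ennreal e"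
      then show thesis by (rule that)
    qed
    have "limitin mtopology (\<sigma> \<circ> k) (Lp_class \<mu> p G) sequentially"
      unfolding limitin_metric
    proof (intro conjI allI impI in_space G)
      fix e :: real assume e: "e > 0"
      then obtain I where I: "\<And>i. i \<ge> I \<Longrightarrow> Lp_norm \<mu> p (\<lambda>t. f (k i) t - G t) \<le> ennreal (e / 2)"
        using lim[of "e / 2"] by auto
      have "Lp_dist \<mu> p ((\<sigma> \<circ> k) i) (Lp_class \<mu> p G) < e" if "i \<ge> I" for i
      proof -
        have "Lp_dist \<mu> p ((\<sigma> \<circ> k) i) (Lp_class \<mu> p G) = enn2real (Lp_norm \<mu> p (\<lambda>t. f (k i) t - G t))"
          using Lp_dist_class[OF unit_ballD(3)[OF f(1)] G] by (simp add: f(2))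
        also have "\<dots> \<le> enn2real (ennreal (e / 2))" using I[OF that] by (intro enn2real_mono) auto
        also have "\<dots> < e" using e by simp
        finally show ?thesis .
      qed
      then show "\<forall>\<^sub>F i in sequentially. (\<sigma> \<circ> k) i \<in> Lp_space \<mu> p \<and> Lp_dist \<mu> p ((\<sigma> \<circ> k) i) (Lp_class \<mu> p G) < e"
        unfolding eventually_sequentially using in_space[OF unit_ballD(3)[OF f(1)]] by (auto simp: f(2))
    qed
    then show "\<exists>l r. l \<in> Lp_space \<mu> p \<and> strict_mono r \<and> limitin mtopology (\<sigma> \<circ> r) l sequentially"
      using k in_space[OF G] by blast
  qed
  then show ?thesis
    unfolding muentz_embedding_compact_def relatively_compact_in_def topspace_Lp_topology[OF p]
    using S by (simp add: S_def Lp_topology_def)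
qed

end

theorem corollary1p12:
  fixes l :: "nat \<Rightarrow> real" and n :: "nat \<Rightarrow> int"
    and \<alpha> \<beta> p :: real and \<mu> :: "real measure"
  assumes "muentz_sequence l"
    and "quasi_lacunary l n" and "subgeometric l n"
    and "\<alpha> > 0" and "0 < \<beta>" and "\<beta> < 1"
    and "sets \<mu> = sets (restrict_space borel {0..1})"
    and "p \<ge> 1"
  shows "(muentz_embedding l \<alpha> (p / \<beta>) p \<mu> \<longleftrightarrow>
      (\<Sum>k. ennreal (lacunary_part l n k powr (\<beta> * \<alpha> / (1 - \<beta>))) *
            ennpowr (\<integral>\<^sup>+t. ennreal (t powr (p * lacunary_part l n k)) \<partial>\<mu>) (1 / (1 - \<beta>))) < \<infinity>)
    \<and> (muentz_embedding l \<alpha> (p / \<beta>) p \<mu> \<longrightarrow> muentz_embedding_compact l \<alpha> (p / \<beta>) p \<mu>)"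
    (is "(?emb \<longleftrightarrow> (\<Sum>k. ?s k) < \<infinity>) \<and> (?emb \<longrightarrow> ?cpt)")
proof -
  define r where "r = p / \<beta>"
  have r0: "r > 0" using assms by (simp add: r_def)
  have sm: "strict_mono l" and lpos: "\<And>i. 0 < l i" using assms(1) by (auto simp: muentz_sequence_def)
  have n0: "n 0 = - 1" using assms(2) by (simp add: quasi_lacunary_def)
  define lam where "lam = lacunary_part l n"
  have lam_pos: "lam k > 0" for k using lpos by (simp add: lam_def lacunary_part_def)
  have lam_0: "lam 0 = l 0" by (simp add: lam_def lacunary_part_def n0)
  define J where "J = (\<lambda>k. \<integral>\<^sup>+t. ennreal (t powr (p * lam k)) \<partial>\<mu>)"
  define T where "T = (\<lambda>k. enn2real (J k))"
  define c where "c = (\<lambda>k. lam k powr (\<beta> * \<alpha> / (1 - \<beta>)) * T k powr (1 / (1 - \<beta>)))"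
  have s_eq: "?s k = ennreal (lam k powr (\<beta> * \<alpha> / (1 - \<beta>))) * ennpowr (J k) (1 / (1 - \<beta>))" for k
    by (simp add: lam_def J_def)
  have T0: "T k \<ge> 0" for k by (simp add: T_def)
  have s_fin: "?s k = ennreal (c k)" and J_T: "J k = ennreal (T k)" if "J k < \<infinity>" for k
  proof -
    show J: "J k = ennreal (T k)" unfolding T_def using that by (simp add: ennreal_enn2real)
    show "?s k = ennreal (c k)"
      unfolding s_eq J ennpowr_ennreal[OF T0] c_def by (rule ennreal_mult[symmetric]) simp_all
  qed
  have c0: "c k \<ge> 0" for k by (simp add: c_def)
  obtain k0 q Q where q: "q > 1" and lac: "lacunary q (\<lambda>k. lam (k + k0))"
    and Q: "\<And>k. lam (Suc k + k0) \<le> Q * lam (k + k0)"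
  proof (rule lacunary_part_tail[OF sm lpos assms(2,3), folded lam_def])
    fix k0 q Q
    assume "q > 1" "lacunary q (\<lambda>k. lam (k + k0))" "\<And>k. lam (Suc k + k0) \<le> Q * lam (k + k0)"
    then show thesis by (rule that)
  qed
  have data: "carleson_data l n (\<lambda>k. lam (k + k0)) (\<lambda>k. T (k + k0)) (\<lambda>k. c (k + k0)) q Q \<alpha> \<beta> p r (T 0) \<mu>"
    if "\<And>k. J k < \<infinity>" "summable c"
  proof
    show "(\<integral>\<^sup>+t. ennreal (t powr (p * l 0)) \<partial>\<mu>) = ennreal (T 0)"
      using J_T[OF that(1), of 0] by (simp add: J_def lam_0)
    show "(\<integral>\<^sup>+t. ennreal (t powr (p * lam (k + k0))) \<partial>\<mu>) = ennreal (T (k + k0))" for k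
      using J_T[OF that(1), of "k + k0"] by (simp add: J_def)
    show "summable (\<lambda>k. c (k + k0))" using that(2) by (simp add: summable_iff_shift)
  qed (rule assms lac q Q T0 r_def | simp add: c_def)+
  have suff: "(\<forall>k. J k < \<infinity>) \<and> summable c" if fin: "(\<Sum>k. ?s k) < \<infinity>"
  proof -
    have "?s k < \<infinity>" for k
    proof -
      have "?s k = (\<Sum>i\<in>{k}. ?s i)" by simp
      also have "\<dots> \<le> (\<Sum>i. ?s i)" by (intro sum_le_suminf) auto
      finally show ?thesis using fin by (rule le_less_trans)
    qed
    then have s_less: "ennreal (lam k powr (\<beta> * \<alpha> / (1 - \<beta>))) * ennpowr (J k) (1 / (1 - \<beta>)) < \<infinity>" for k
      unfolding s_eq .
    have J: "J k < \<infinity>" for k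
    proof (rule ccontr)
      assume "\<not> J k < \<infinity>"
      then have "ennpowr (J k) (1 / (1 - \<beta>)) = \<infinity>" by (simp add: ennpowr_def less_top)
      then show False using s_less[of k] lam_pos[of k] by (simp add: ennreal_mult_top)
    qed
    have "(\<Sum>k. ennreal (c k)) < \<infinity>" using fin unfolding s_fin[OF J] .
    then have "summable c" using c0 by (intro summable_suminf_not_top) auto
    then show ?thesis using J by simp
  qed
  have nec: "(\<forall>k. J k < \<infinity>) \<and> summable c" if emb: "muentz_embedding l \<alpha> r p \<mu>"
  proof -
    obtain C where C: "C > 0" "\<And>f R. f \<in> muentz_space l \<Longrightarrow> R \<ge> 0 \<Longrightarrow>
       (\<integral>\<^sup>+t. ennreal (norm (f t) powr r) \<partial>nu (\<alpha> - 1)) \<le> ennreal R \<Longrightarrow>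
       (\<integral>\<^sup>+t. ennreal (norm (f t) powr p) \<partial>\<mu>) \<le> ennreal (C * R powr \<beta>)"
      using emb muentz_embedding_iff[OF assms(8,5) r_def] by blast
    have J: "J k < \<infinity>" for k
      unfolding J_def lam_def lacunary_part_def
      by (rule embedding_imp_moment_finite[OF C(2) lpos assms(4) r0])
    have "summable (\<lambda>k. c (k + k0))"
    proof (rule embedding_imp_summable[OF C(2,1) lac q Q _ assms(7,8,5,6) r_def assms(4)])
      show "lam (k + k0) = l (nat (n (k + k0)))" for k by (simp add: lam_def lacunary_part_def)
      show "(\<integral>\<^sup>+t. ennreal (t powr (p * lam (k + k0))) \<partial>\<mu>) = ennreal (T (k + k0))" for k
        using J_T[OF J, of "k + k0"] by (simp add: J_def)
    qed (simp_all add: T0 c_def)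
    then show ?thesis using J by (simp add: summable_iff_shift)
  qed
  have iff: "muentz_embedding l \<alpha> r p \<mu> \<longleftrightarrow> (\<Sum>k. ?s k) < \<infinity>"
  proof
    assume "muentz_embedding l \<alpha> r p \<mu>"
    then have J: "\<And>k. J k < \<infinity>" and c: "summable c" using nec by auto
    show "(\<Sum>k. ?s k) < \<infinity>"
      unfolding s_fin[OF J] using suminf_ennreal_eq[OF c0 summable_sums[OF c]] by simp
  next
    assume "(\<Sum>k. ?s k) < \<infinity>"
    then interpret carleson_data l n "\<lambda>k. lam (k + k0)" "\<lambda>k. T (k + k0)" "\<lambda>k. c (k + k0)" q Q \<alpha> \<beta> p r "T 0" \<mu>
      using suff data by blast
    show "muentz_embedding l \<alpha> r p \<mu>"
      using embedding muentz_embedding_iff[OF assms(8,5) r_def] by blast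
  qed
  moreover have "muentz_embedding_compact l \<alpha> r p \<mu>" if "muentz_embedding l \<alpha> r p \<mu>"
  proof -
    interpret carleson_data l n "\<lambda>k. lam (k + k0)" "\<lambda>k. T (k + k0)" "\<lambda>k. c (k + k0)" q Q \<alpha> \<beta> p r "T 0" \<mu>
      using nec[OF that] data by blast
    show ?thesis by (rule compact)
  qed
  ultimately show ?thesis unfolding r_def by blast
qed

end
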